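(* Suppose that the level set $\mathcal{X}=\{x\in\mathbb{R}^n:F(x)\le F(x^{(0)})\}$ is compact, that $f$ is locally Lipschitz continuous on $\mathcal{X}$, and that $g^*$ satisfies the calmness condition on $\mathrm{dom}(g^* )$. If $Q$ satisfies the KL property at every $(x,y)\in\mathcal{S}$ (belonging to $\mathrm{dom}(\partial Q)$, where the property is defined), then the sequence $\{x^{(t)}:t\in\mathbb{N}\}$ generated by CMPGA_ML converges to a critical point $x^{\star}$ of $F$.
   Context: Setting. $f,g,h:\mathbb{R}^n\to(-\infty,+\infty]$ are proper lower semicontinuous functions, $\Omega:=\{x\in\mathbb{R}^n: g(x)\neq 0\}$ is nonempty, and $f$ is block-separable: $f(x)=\sum_{i=1}^N f_i(x_i)$, where the subvectors $x_i\in\mathbb{R}^{n_i}$ form a partition of the components of $x$ and each $f_i:\mathbb{R}^{n_i}\to(-\infty,+\infty]$ is proper lower semicontinuous. Standing assumptions: (a) $f$ is continuous on $\mathrm{dom}(f)$ and each $f_i$ is bounded below; (b) $h$ is locally Lipschitz differentiable on $\Omega$, i.e. every $x\in\Omega$ has a neighborhood $\mathcal{B}(x)$ and a constant $L_x$ with $\|\nabla h(u)-\nabla h(v)\|_2\le L_x\|u-v\|_2$ for all $u,v\in\mathcal{B}(x)\cap\Omega$; (c) $g$ is convex, real-valued and nonnegative on $\mathbb{R}^n$; (d) $f+h\ge 0$ on $\mathrm{dom}(f)$. Notation. $\mathrm{dom}(\varphi)=\{x:\varphi(x)<+\infty\}$; $g^*(y)=\sup_x\{\langle x,y\rangle-g(x)\}$;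 $\nabla_ih$ is the partial gradient with respect to $x_i$; $\zeta(x):=f(x)+h(x)$; $\eta(x,y):=\langle x,y\rangle-g^*(y)$. $F(x)=\zeta(x)/g(x)$ if $x\in\Omega\cap\mathrm{dom}(f)$ and $F(x)=+\infty$ otherwise. $Q(x,y)=\zeta(x)/\eta(x,y)$ if $(x,y)\in\mathrm{dom}(f)\times\mathrm{dom}(g^* )$ and $\eta(x,y)>0$, and $Q(x,y)=+\infty$ otherwise. $\mathrm{prox}_{\varphi}(x)=\arg\min_z\{\varphi(z)+\frac12\|z-x\|_2^2\}$ (possibly set-valued). $f$ locally Lipschitz on $\mathcal{X}$: every point of $\mathcal{X}$ has a neighborhood $U$ such that $f$ is Lipschitz on $U\cap\mathcal{X}$. Subdifferentials. For a proper $\varphi$ and $x\in\mathrm{dom}(\varphi)$: $\widehat{\partial}\varphi(x)=\{y:\liminf_{z\to x,z\ne x}\frac{\varphi(z)-\varphi(x)-\langle y,z-x\rangle}{\|z-x\|_2}\ge 0\}$ (Fréchet), $\partial\varphi(x)=\{y:\exists x^k\to x,\ \varphi(x^k)\to\varphi(x),\ y^k\in\widehat{\partial}\varphi(x^k),\ y^k\to y\}$ (limiting; the usual one for convex $\varphi$). $\mathrm{dom}(\partial\varphi)=\{x\in\mathrm{dom}(\varphi):\partial\varphi(x)\ne\emptyset\}$. $\mathrm{dist}(0,\emptyset)=+\infty$. $x^{\star}\in\mathrm{dom}(F)$ is a critical point of $F$ if $0\in\widehat{\partial}f(x^{\star})+\nabla h(x^{\star})-F(x^{\star})\,\partial g(x^{\star})$.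 Calmness. $\varphi$ satisfies the calmness condition on $\mathcal{A}\subseteq\mathrm{dom}(\varphi)$ if for every $x\in\mathcal{A}$ there are $\kappa_x>0$ and a neighborhood $\mathcal{B}(x)$ with $|\varphi(u)-\varphi(x)|\le\kappa_x\|u-x\|_2$ for all $u\in\mathcal{B}(x)\cap\mathcal{A}$. KL property. A proper $\varphi$ satisfies the KL property at $x\in\mathrm{dom}(\partial\varphi)$ if there exist $\epsilon\in(0,+\infty]$, $\delta>0$ and a continuous concave $\phi:[0,\epsilon)\to[0,+\infty)$ with $\phi(0)=0$, $\phi$ continuously differentiable on $(0,\epsilon)$ with $\phi'>0$, such that $\phi'(\varphi(z)-\varphi(x))\,\mathrm{dist}(0,\partial\varphi(z))\ge1$ for all $z$ with $\|z-x\|_2<\delta$ and $\varphi(x)<\varphi(z)<\varphi(x)+\epsilon$. Algorithm CMPGA_ML (cyclic multi-proximity gradient algorithm with monotone line search). Input: $x^{(0)}\in\mathrm{dom}(F)$, $y^{(0)}\in\partial g(x^{(0)})$, reals $0<\underline{\alpha}\le\overline{\alpha}$, $\sigma>0$, $0<\gamma<1$. For $t=0,1,2,\dots$: let $Q_{(t)}=Q(x^{(t)},y^{(t)})$, $i=t\bmod(N+1)$, and choose an initial $\alpha\in[\underline{\alpha},\overline{\alpha}]$. If $i=0$: set $x^{(t+1)}=x^{(t)}$, $y^{(t+1)}=\mathrm{prox}_{\alpha g^*}(y^{(t)}+\alpha x^{(t)})$. If $i\ge1$: ( * ) compute $x_i^{(t)}(\alpha)\in\mathrm{prox}_{\alpha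 f_i}\big(x_i^{(t)}-\alpha\nabla_ih(x^{(t)})+\alpha Q_{(t)}y_i^{(t)}\big)$ and let $x^{(t),i}(\alpha)$ be $x^{(t)}$ with its $i$-th block replaced by $x_i^{(t)}(\alpha)$. If $\zeta(x^{(t),i}(\alpha))+\frac{\sigma}{2}\|x^{(t),i}(\alpha)-x^{(t)}\|_2^2\le Q_{(t)}\,\eta(x^{(t),i}(\alpha),y^{(t)})$, set $(x^{(t+1)},y^{(t+1)})=(x^{(t),i}(\alpha),y^{(t)})$; otherwise replace $\alpha$ by $\alpha\gamma$ and repeat ( * ). Sets. Let $\overline{g}_{\mathcal{X}}>0$ be a constant with $g\le\overline{g}_{\mathcal{X}}$ on $\mathcal{X}$; $\mathcal{X}_{\underline{\alpha}}:=\{z:\mathrm{dist}^2(z,\mathcal{X})\le\overline{g}_{\mathcal{X}}/\underline{\alpha}\}$; $\mathcal{Y}:=\bigcup_{z\in\mathcal{X}_{\underline{\alpha}}}\partial g(z)$; $\mathcal{S}:=\{(x,y)\in\mathcal{X}\times\mathcal{Y}:\eta(x,y)>0\}$. *)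

theory Defs
  imports "HOL-Analysis.Analysis"
begin

section \<open>Extended-real-valued functions\<close>

definition edom :: "('a \<Rightarrow> ereal) \<Rightarrow> 'a set" where
  "edom \<phi> = {x. \<phi> x < \<infinity>}"

definition proper_on :: "'a set \<Rightarrow> ('a \<Rightarrow> ereal) \<Rightarrow> bool" where
  "proper_on S \<phi> \<longleftrightarrow> (\<forall>x\<in>S. \<phi> x \<noteq> -\<infinity>) \<and> (\<exists>x\<in>S. \<phi> x < \<infinity>)"

definition lsc_on :: "'a::topological_space set \<Rightarrow> ('a \<Rightarrow> ereal) \<Rightarrow> bool" where
  "lsc_on S \<phi> \<longleftrightarrow> (\<forall>x\<in>S. \<phi> x \<le> Liminf (at x within S) \<phi>)"

definition locally_lipschitz_on :: "'a::metric_space set \<Rightarrow> ('a \<Rightarrow> ereal) \<Rightarrow> bool" where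
  "locally_lipschitz_on S \<phi> \<longleftrightarrow>
     (\<forall>x\<in>S. \<bar>\<phi> x\<bar> \<noteq> \<infinity>) \<and>
     (\<forall>x\<in>S. \<exists>U L. open U \<and> x \<in> U \<and> L-lipschitz_on (U \<inter> S) (\<lambda>z. real_of_ereal (\<phi> z)))"

definition ediff_at :: "('a::real_inner \<Rightarrow> ereal) \<Rightarrow> 'a \<Rightarrow> bool" where
  "ediff_at \<phi> x \<longleftrightarrow>
     (\<forall>\<^sub>F z in nhds x. \<bar>\<phi> z\<bar> \<noteq> \<infinity>) \<and> (\<exists>v. GDERIV (\<lambda>z. real_of_ereal (\<phi> z)) x :> v)"

text \<open>Only meaningful at points where \<^const>\<open>ediff_at\<close> holds; there the gradient is unique.\<close>

definition egrad :: "('a::real_inner \<Rightarrow> ereal) \<Rightarrow> 'a \<Rightarrow> 'a" where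
  "egrad \<phi> x = (THE v. GDERIV (\<lambda>z. real_of_ereal (\<phi> z)) x :> v)"

definition loc_lipschitz_differentiable_on :: "'a::real_inner set \<Rightarrow> ('a \<Rightarrow> ereal) \<Rightarrow> bool" where
  "loc_lipschitz_differentiable_on S \<phi> \<longleftrightarrow>
     (\<forall>x\<in>S. ediff_at \<phi> x) \<and>
     (\<forall>x\<in>S. \<exists>U L. open U \<and> x \<in> U \<and> L-lipschitz_on (U \<inter> S) (egrad \<phi>))"

definition conj_fun :: "('a::real_inner \<Rightarrow> real) \<Rightarrow> 'a \<Rightarrow> ereal" where
  "conj_fun g y = (SUP x. ereal (x \<bullet> y - g x))"

text \<open>Minimisation is over \<open>S\<close>; this is used with \<open>S = UNIV\<close> and with coordinate subspaces.\<close>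

definition prox_on :: "'a::real_normed_vector set \<Rightarrow> ('a \<Rightarrow> ereal) \<Rightarrow> 'a \<Rightarrow> 'a set" where
  "prox_on S \<phi> x = {z. is_arg_min (\<lambda>z. \<phi> z + ereal (1/2 * (norm (z - x))\<^sup>2)) (\<lambda>z. z \<in> S) z}"

definition calm_on :: "'a::real_normed_vector set \<Rightarrow> ('a \<Rightarrow> ereal) \<Rightarrow> bool" where
  "calm_on A \<phi> \<longleftrightarrow> A \<subseteq> edom \<phi> \<and>
     (\<forall>x\<in>A. \<exists>\<kappa> U. \<kappa> > 0 \<and> open U \<and> x \<in> U \<and>
        (\<forall>u\<in>U \<inter> A. \<bar>\<phi> u - \<phi> x\<bar> \<le> ereal (\<kappa> * norm (u - x))))"

section \<open>Subdifferentials and the Kurdyka--Lojasiewicz property\<close>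

definition frechet_subdiff :: "('a::real_inner \<Rightarrow> ereal) \<Rightarrow> 'a \<Rightarrow> 'a set" where
  "frechet_subdiff \<phi> x = {y. x \<in> edom \<phi> \<and>
     0 \<le> Liminf (at x) (\<lambda>z. (\<phi> z - \<phi> x - ereal (y \<bullet> (z - x))) / ereal (norm (z - x)))}"

definition limiting_subdiff :: "('a::real_inner \<Rightarrow> ereal) \<Rightarrow> 'a \<Rightarrow> 'a set" where
  "limiting_subdiff \<phi> x = {y. x \<in> edom \<phi> \<and>
     (\<exists>xs ys. xs \<longlonglongrightarrow> x \<and> (\<lambda>k. \<phi> (xs k)) \<longlonglongrightarrow> \<phi> x \<and>
              (\<forall>k. ys k \<in> frechet_subdiff \<phi> (xs k)) \<and> ys \<longlonglongrightarrow> y)}"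

definition dom_subdiff :: "('a::real_inner \<Rightarrow> ereal) \<Rightarrow> 'a set" where
  "dom_subdiff \<phi> = {x \<in> edom \<phi>. limiting_subdiff \<phi> x \<noteq> {}}"

text \<open>The distance from the origin, equal to \<open>\<infinity>\<close> for the empty set (unlike \<^const>\<open>infdist\<close>).\<close>

definition edist0 :: "'a::real_normed_vector set \<Rightarrow> ereal" where
  "edist0 S = (INF y\<in>S. ereal (norm y))"

definition KL_at :: "('a::real_inner \<Rightarrow> ereal) \<Rightarrow> 'a \<Rightarrow> bool" where
  "KL_at \<phi> x \<longleftrightarrow> x \<in> dom_subdiff \<phi> \<and>
     (\<exists>(\<epsilon>::ereal) (\<delta>::real) (\<psi>::real \<Rightarrow> real) (\<psi>'::real \<Rightarrow> real).
        \<epsilon> > 0 \<and> \<delta> > 0 \<and>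
        continuous_on {s. 0 \<le> s \<and> ereal s < \<epsilon>} \<psi> \<and>
        concave_on {s. 0 \<le> s \<and> ereal s < \<epsilon>} \<psi> \<and>
        (\<forall>s. 0 \<le> s \<and> ereal s < \<epsilon> \<longrightarrow> \<psi> s \<ge> 0) \<and> \<psi> 0 = 0 \<and>
        (\<forall>s. 0 < s \<and> ereal s < \<epsilon> \<longrightarrow> (\<psi> has_real_derivative \<psi>' s) (at s) \<and> \<psi>' s > 0) \<and>
        continuous_on {s. 0 < s \<and> ereal s < \<epsilon>} \<psi>' \<and>
        (\<forall>z. norm (z - x) < \<delta> \<and> \<phi> x < \<phi> z \<and> \<phi> z < \<phi> x + \<epsilon> \<longrightarrow>
             ereal (\<psi>' (real_of_ereal (\<phi> z - \<phi> x))) * edist0 (limiting_subdiff \<phi> z) \<ge> 1))"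

section \<open>Block structure\<close>

text \<open>
  A map \<open>blk\<close> from coordinates onto \<open>{1..N}\<close> encodes a partition of the components of a
  vector into \<open>N\<close> nonempty blocks.  The space of the \<open>i\<close>-th subvectors is identified with the
  coordinate subspace of vectors vanishing outside block \<open>i\<close>; a function on it is given as a
  function on the whole space whose values off that subspace are irrelevant.
\<close>

definition block_space :: "('n \<Rightarrow> nat) \<Rightarrow> nat \<Rightarrow> (real ^ 'n::finite) set" where
  "block_space blk i = {x. \<forall>j. blk j \<noteq> i \<longrightarrow> x $ j = 0}"

definition block_proj :: "('n \<Rightarrow> nat) \<Rightarrow> nat \<Rightarrow> real ^ 'n \<Rightarrow> real ^ 'n::finite" where
  "block_proj blk i x = (\<chi> j. if blk j = i then x $ j else 0)"

definition block_replace :: "('n \<Rightarrow> nat) \<Rightarrow> nat \<Rightarrow> real ^ 'n \<Rightarrow> real ^ 'n \<Rightarrow> real ^ 'n::finite" where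
  "block_replace blk i u x = (\<chi> j. if blk j = i then u $ j else x $ j)"

section \<open>The fractional objective and its primal-dual merit function\<close>

definition Omega :: "('a \<Rightarrow> real) \<Rightarrow> 'a set" where
  "Omega g = {x. g x \<noteq> 0}"

definition zeta :: "('a \<Rightarrow> ereal) \<Rightarrow> ('a \<Rightarrow> ereal) \<Rightarrow> 'a \<Rightarrow> ereal" where
  "zeta f h x = f x + h x"

definition eta :: "('a::real_inner \<Rightarrow> real) \<Rightarrow> 'a \<Rightarrow> 'a \<Rightarrow> ereal" where
  "eta g x y = ereal (x \<bullet> y) - conj_fun g y"

definition obj_F ::
  "('a \<Rightarrow> ereal) \<Rightarrow> ('a \<Rightarrow> real) \<Rightarrow> ('a \<Rightarrow> ereal) \<Rightarrow> 'a \<Rightarrow> ereal" where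
  "obj_F f g h x = (if x \<in> Omega g \<inter> edom f then zeta f h x / ereal (g x) else \<infinity>)"

definition merit_Q ::
  "('a::real_inner \<Rightarrow> ereal) \<Rightarrow> ('a \<Rightarrow> real) \<Rightarrow> ('a \<Rightarrow> ereal) \<Rightarrow> 'a \<times> 'a \<Rightarrow> ereal" where
  "merit_Q f g h = (\<lambda>(x, y).
     if x \<in> edom f \<and> y \<in> edom (conj_fun g) \<and> eta g x y > 0
     then zeta f h x / eta g x y else \<infinity>)"

abbreviation subdiff_real :: "('a::real_inner \<Rightarrow> real) \<Rightarrow> 'a \<Rightarrow> 'a set" where
  "subdiff_real g \<equiv> limiting_subdiff (\<lambda>x. ereal (g x))"

definition critical_point ::
  "('a::real_inner \<Rightarrow> ereal) \<Rightarrow> ('a \<Rightarrow> real) \<Rightarrow> ('a \<Rightarrow> ereal) \<Rightarrow> 'a \<Rightarrow> bool" where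
  "critical_point f g h x \<longleftrightarrow> x \<in> edom (obj_F f g h) \<and>
     0 \<in> {v + egrad h x - real_of_ereal (obj_F f g h x) *\<^sub>R w | v w.
            v \<in> frechet_subdiff f x \<and> w \<in> subdiff_real g x}"

section \<open>The algorithm\<close>

definition dual_step ::
  "('a::real_inner \<Rightarrow> real) \<Rightarrow> real \<Rightarrow> real \<Rightarrow> 'a \<Rightarrow> 'a \<Rightarrow> 'a \<Rightarrow> 'a \<Rightarrow> bool" where
  "dual_step g \<alpha>lo \<alpha>up x y x' y' \<longleftrightarrow>
     x' = x \<and>
     (\<exists>\<alpha>\<in>{\<alpha>lo..\<alpha>up}. y' \<in> prox_on UNIV (\<lambda>z. ereal \<alpha> * conj_fun g z) (y + \<alpha> *\<^sub>R x))"

text \<open>The admissible values of the new \<open>i\<close>-th block for the step size \<open>\<alpha>\<close>.  The partial gradient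
  of \<open>h\<close> with respect to the \<open>i\<close>-th block is the \<open>i\<close>-th block of the gradient.\<close>

definition block_prox ::
  "(real ^ 'n \<Rightarrow> ereal) \<Rightarrow> (nat \<Rightarrow> real ^ 'n \<Rightarrow> ereal) \<Rightarrow> (real ^ 'n \<Rightarrow> real) \<Rightarrow>
   (real ^ 'n \<Rightarrow> ereal) \<Rightarrow> ('n::finite \<Rightarrow> nat) \<Rightarrow> nat \<Rightarrow> real \<Rightarrow> real ^ 'n \<Rightarrow> real ^ 'n \<Rightarrow>
   (real ^ 'n) set" where
  "block_prox f fs g h blk i \<alpha> x y =
     prox_on (block_space blk i) (\<lambda>z. ereal \<alpha> * fs i z)
       (block_proj blk i x - \<alpha> *\<^sub>R block_proj blk i (egrad h x)
         + (\<alpha> * real_of_ereal (merit_Q f g h (x, y))) *\<^sub>R block_proj blk i y)"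

definition accept ::
  "('a::real_inner \<Rightarrow> ereal) \<Rightarrow> ('a \<Rightarrow> real) \<Rightarrow> ('a \<Rightarrow> ereal) \<Rightarrow> real \<Rightarrow> 'a \<Rightarrow> 'a \<Rightarrow> 'a \<Rightarrow> bool" where
  "accept f g h \<sigma> x y x' \<longleftrightarrow>
     zeta f h x' + ereal (\<sigma> / 2 * (norm (x' - x))\<^sup>2) \<le> merit_Q f g h (x, y) * eta g x' y"

text \<open>The backtracking loop: \<open>u j\<close> is the block computed in the \<open>j\<close>-th trial, with step size
  \<open>\<alpha> * \<gamma> ^ j\<close>, and \<open>m\<close> is the index of the first accepted trial.\<close>

definition block_step ::
  "(real ^ 'n \<Rightarrow> ereal) \<Rightarrow> (nat \<Rightarrow> real ^ 'n \<Rightarrow> ereal) \<Rightarrow> (real ^ 'n \<Rightarrow> real) \<Rightarrow>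
   (real ^ 'n \<Rightarrow> ereal) \<Rightarrow> ('n::finite \<Rightarrow> nat) \<Rightarrow> real \<Rightarrow> real \<Rightarrow> real \<Rightarrow> real \<Rightarrow> nat \<Rightarrow>
   real ^ 'n \<Rightarrow> real ^ 'n \<Rightarrow> real ^ 'n \<Rightarrow> real ^ 'n \<Rightarrow> bool" where
  "block_step f fs g h blk \<alpha>lo \<alpha>up \<sigma> \<gamma> i x y x' y' \<longleftrightarrow>
     y' = y \<and>
     (\<exists>\<alpha>\<in>{\<alpha>lo..\<alpha>up}. \<exists>m u.
        (\<forall>j\<le>m. u j \<in> block_prox f fs g h blk i (\<alpha> * \<gamma> ^ j) x y) \<and>
        (\<forall>j<m. \<not> accept f g h \<sigma> x y (block_replace blk i (u j) x)) \<and>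
        accept f g h \<sigma> x y (block_replace blk i (u m) x) \<and>
        x' = block_replace blk i (u m) x)"

definition cmpga_ml ::
  "(real ^ 'n \<Rightarrow> ereal) \<Rightarrow> (nat \<Rightarrow> real ^ 'n \<Rightarrow> ereal) \<Rightarrow> (real ^ 'n \<Rightarrow> real) \<Rightarrow>
   (real ^ 'n \<Rightarrow> ereal) \<Rightarrow> nat \<Rightarrow> ('n::finite \<Rightarrow> nat) \<Rightarrow> real \<Rightarrow> real \<Rightarrow> real \<Rightarrow> real \<Rightarrow>
   (nat \<Rightarrow> real ^ 'n) \<Rightarrow> (nat \<Rightarrow> real ^ 'n) \<Rightarrow> bool" where
  "cmpga_ml f fs g h N blk \<alpha>lo \<alpha>up \<sigma> \<gamma> x y \<longleftrightarrow>
     x 0 \<in> edom (obj_F f g h) \<and> y 0 \<in> subdiff_real g (x 0) \<and>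
     (\<forall>t. let i = t mod (N + 1) in
        if i = 0
        then dual_step g \<alpha>lo \<alpha>up (x t) (y t) (x (Suc t)) (y (Suc t))
        else block_step f fs g h blk \<alpha>lo \<alpha>up \<sigma> \<gamma> i (x t) (y t) (x (Suc t)) (y (Suc t)))"

section \<open>The sets on which the Kurdyka--Lojasiewicz property is required\<close>

definition level_X ::
  "('a \<Rightarrow> ereal) \<Rightarrow> ('a \<Rightarrow> real) \<Rightarrow> ('a \<Rightarrow> ereal) \<Rightarrow> 'a \<Rightarrow> 'a set" where
  "level_X f g h x0 = {x. obj_F f g h x \<le> obj_F f g h x0}"

definition enlarged_X :: "'a::metric_space set \<Rightarrow> real \<Rightarrow> real \<Rightarrow> 'a set" where
  "enlarged_X X gX \<alpha>lo = {z. (infdist z X)\<^sup>2 \<le> gX / \<alpha>lo}"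

definition dual_Y :: "('a::real_inner \<Rightarrow> real) \<Rightarrow> 'a set \<Rightarrow> real \<Rightarrow> real \<Rightarrow> 'a set" where
  "dual_Y g X gX \<alpha>lo = (\<Union>z\<in>enlarged_X X gX \<alpha>lo. subdiff_real g z)"

definition set_S :: "('a::real_inner \<Rightarrow> real) \<Rightarrow> 'a set \<Rightarrow> real \<Rightarrow> real \<Rightarrow> ('a \<times> 'a) set" where
  "set_S g X gX \<alpha>lo = {(x, y). x \<in> X \<and> y \<in> dual_Y g X gX \<alpha>lo \<and> eta g x y > 0}"

end

theory Submission
  imports Defs
begin

text \<open>
  Along the iterates \<open>Q\<close> decreases: a block step lowers it by a multiple of
  \<open>\<parallel>x\<^sup>t\<^sup>+\<^sup>1 - x\<^sup>t\<parallel>\<^sup>2\<close>, a dual step by a multiple of \<open>Q \<parallel>y\<^sup>t\<^sup>+\<^sup>1 - y\<^sup>t\<parallel>\<^sup>2\<close>.  At the end of a full cycle of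
  \<open>N + 1\<close> steps, the optimality conditions of the proximal steps assemble into a Frechet subgradient
  of \<open>Q\<close> whose norm is at most a constant times the square root of the decrease of \<open>Q\<close> over that
  cycle.  Since the dual decrease carries the weight \<open>Q\<close>, nothing forces \<open>y\<close> to converge when \<open>Q\<close> tends
  to zero; the KL inequality is therefore made uniform over the compact set of all cluster points
  of the pairs \<open>(x, y)\<close>, on which \<open>Q\<close> is constant.  It makes the square roots of the decreases
  summable, so \<open>x\<close> has finite length.  The proximal inequalities of the block steps hold with a
  uniform constant, because the accepted step sizes are bounded away from zero; hence they survive
  the passage to the limit and yield a Frechet subgradient of \<open>f\<close> at the limit point.
\<close>

section \<open>Convex conjugates and subgradients\<close>

text \<open>The difficulty specific to a quotient is its denominator. Subgradients of
  \<open>Q\<close> carry a factor \<open>1 / \<eta>\<close>, so \<open>\<eta>\<close> must stay away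
  from zero at the ends of the cycles, while a block step only yields that it is positive. The lower
  bound comes from the dual step that opens the cycle; afterwards \<open>y\<close> is fixed, and the
  moves of \<open>x\<close> within a late cycle are too small to destroy the bound. The end of a
  cycle is the right place to evaluate a subgradient because all its block steps used the same
  \<open>y\<close> and every block already has its final value. The price is that the optimality
  condition of block \<open>i\<close> refers to the point, the gradient of \<open>h\<close> and the
  value of \<open>Q\<close> at an earlier step, so these drifts have to be bounded by the root of
  the decrease too. The limit value of \<open>Q\<close> decides how criticality is obtained. If it
  is positive, the weight \<open>Q\<close> can be divided out and the limit of \<open>y\<close> is a
  subgradient of \<open>g\<close>. If it is zero, the coefficient of the subdifferential of
  \<open>g\<close> vanishes, and any subgradient of \<open>g\<close> will do.\<close>

definition subgradients :: "('a::real_inner \<Rightarrow> real) \<Rightarrow> 'a \<Rightarrow> 'a set" where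
  "subgradients g x = {y. \<forall>z. g x + y \<bullet> (z - x) \<le> g z}"

text \<open>Separate the point of the graph over \<open>x\<close> from the strict epigraph, which is
  convex and misses that point, and rescale the normal to slope form.\<close>

lemma subgradients_nonempty:
  fixes g :: "'a::euclidean_space \<Rightarrow> real"
  assumes "convex_on UNIV g"
  shows "subgradients g x \<noteq> {}"
proof -
  define E where "E = {p::'a \<times> real. g (fst p) < snd p}"
  have cE: "convex E"
    unfolding convex_alt
  proof (intro ballI allI impI)
    fix p q :: "'a \<times> real" and u :: real
    assume pq: "p \<in> E" "q \<in> E" and u: "0 \<le> u \<and> u \<le> 1"
    have "g ((1 - u) *\<^sub>R fst p + u *\<^sub>R fst q) \<le> (1 - u) * g (fst p) + u * g (fst q)"
      using convex_onD[OF assms, of u "fst p" "fst q"] u by auto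
    also have "\<dots> < (1 - u) * snd p + u * snd q"
    proof (cases "u = 0")
      case False
      have "u * g (fst q) < u * snd q" using False u pq by (simp add: E_def)
      moreover have "(1 - u) * g (fst p) \<le> (1 - u) * snd p"
        using u pq by (intro mult_left_mono) (auto simp: E_def)
      ultimately show ?thesis by linarith
    qed (use pq in \<open>simp add: E_def\<close>)
    finally show "(1 - u) *\<^sub>R p + u *\<^sub>R q \<in> E" by (simp add: E_def)
  qed
  have neE: "(x, g x + 1) \<in> E" by (simp add: E_def)
  have disj: "(x, g x) \<notin> E" by (simp add: E_def)
  obtain a b where ab: "a \<noteq> 0" "\<forall>p\<in>{(x, g x)}. a \<bullet> p \<le> b" "\<forall>p\<in>E. a \<bullet> p \<ge> b"
  proof -
    have "\<exists>a b. a \<noteq> 0 \<and> (\<forall>p\<in>{(x, g x)}. a \<bullet> p \<le> b) \<and> (\<forall>p\<in>E. b \<le> a \<bullet> p)"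
      by (rule separating_hyperplane_sets) (use cE neE disj in auto)
    then show thesis using that by blast
  qed
  obtain v s where a: "a = (v, s)" by (cases a)
  have key: "v \<bullet> (z - x) + s * (t - g x) \<ge> 0" if "t > g z" for z t
  proof -
    have "(z, t) \<in> E" using that by (simp add: E_def)
    then have "a \<bullet> (z, t) \<ge> a \<bullet> (x, g x)" using ab by fastforce
    then show ?thesis by (simp add: a algebra_simps inner_diff_right)
  qed
  have s0: "s \<ge> 0" using key[of x "g x + 1"] by simp
  \<comment> \<open>A vertical hyperplane would make \<open>v\<close> nonnegative against every
    direction, because \<open>g\<close> is finite everywhere; the direction \<open>- v\<close>
    refutes this.\<close>
  have "s \<noteq> 0"
  proof
    assume s: "s = 0"
    have "v \<bullet> (x - v - x) \<ge> 0" using key[of "x - v" "g (x - v) + 1"] s by simp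
    then have "v \<bullet> v \<le> 0" by simp
    then have "v = 0" by (metis inner_eq_zero_iff inner_ge_zero order_antisym)
    with s a ab show False by (simp add: zero_prod_def)
  qed
  with s0 have s: "s > 0" by simp
  have "g x + (- (1/s) *\<^sub>R v) \<bullet> (z - x) \<le> g z" for z
  \<comment> \<open>The strict epigraph contains only heights above \<open>g z\<close>, hence the
    slack.\<close>
  proof (rule field_le_epsilon)
    fix e :: real assume e: "e > 0"
    have "v \<bullet> (z - x) + s * (g z + e - g x) \<ge> 0" using key[of z "g z + e"] e by simp
    then have "(v \<bullet> (z - x)) / s + (g z + e - g x) \<ge> 0"
      using s by (simp add: field_simps)
    then show "g x + (- (1/s) *\<^sub>R v) \<bullet> (z - x) \<le> g z + e" by simp
  qed
  then show ?thesis unfolding subgradients_def by blast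
qed

text \<open>Clearing the denominator of the difference quotient leaves a single \<open>ereal\<close>
  comparison, which also covers points where \<open>\<phi>\<close> is infinite and needs no
  subtraction of infinities.\<close>

lemma frechet_subdiff_iff:
  assumes c: "\<phi> x = ereal c"
  shows "y \<in> frechet_subdiff \<phi> x \<longleftrightarrow>
    (\<forall>e>0. \<forall>\<^sub>F z in at x. ereal (c + y \<bullet> (z - x) - e * norm (z - x)) \<le> \<phi> z)"
proof -
  define q where "q z = (\<phi> z - \<phi> x - ereal (y \<bullet> (z - x))) / ereal (norm (z - x))" for z
  have "y \<in> frechet_subdiff \<phi> x \<longleftrightarrow> 0 \<le> Liminf (at x) q"
    using c by (simp add: frechet_subdiff_def edom_def q_def[abs_def])
  also have "\<dots> \<longleftrightarrow> (\<forall>a<0. \<forall>\<^sub>F z in at x. a < q z)"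
    by (simp add: le_Liminf_iff)
  also have "\<dots> \<longleftrightarrow> (\<forall>e>0. \<forall>\<^sub>F z in at x. ereal (-e) \<le> q z)"
  proof (intro iffI allI impI)
    fix e :: real assume H: "\<forall>a<0. \<forall>\<^sub>F z in at x. a < q z" and e: "0 < e"
    have "\<forall>\<^sub>F z in at x. ereal (-e) < q z" using e by (intro H[rule_format]) simp
    then show "\<forall>\<^sub>F z in at x. ereal (-e) \<le> q z" by eventually_elim simp
  next
    fix a :: ereal assume H: "\<forall>e>0. \<forall>\<^sub>F z in at x. ereal (-e) \<le> q z" and a: "a < 0"
    obtain r where r: "a < ereal r" "r < 0" using ereal_dense2[OF a] by auto
    have "\<forall>\<^sub>F z in at x. ereal (- (- r)) \<le> q z" using r by (intro H[rule_format]) simp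
    then show "\<forall>\<^sub>F z in at x. a < q z" by eventually_elim (use r in \<open>simp add: less_le_trans\<close>)
  qed
  also have "\<dots> \<longleftrightarrow> (\<forall>e>0. \<forall>\<^sub>F z in at x. ereal (c + y \<bullet> (z - x) - e * norm (z - x)) \<le> \<phi> z)"
  proof -
    have "ereal (-e) \<le> q z \<longleftrightarrow> ereal (c + y \<bullet> (z - x) - e * norm (z - x)) \<le> \<phi> z" if "z \<noteq> x" for e z
      using that by (cases "\<phi> z") (auto simp: q_def c field_simps)
    then have "(\<forall>\<^sub>F z in at x. ereal (-e) \<le> q z) \<longleftrightarrow>
      (\<forall>\<^sub>F z in at x. ereal (c + y \<bullet> (z - x) - e * norm (z - x)) \<le> \<phi> z)" for e
      by (intro eventually_subst) (simp add: eventually_at_filter)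
    then show ?thesis by simp
  qed
  finally show ?thesis .
qed

lemma subgradients_limit:
  fixes g :: "'a::real_inner \<Rightarrow> real"
  assumes "continuous_on UNIV g" "xs \<longlonglongrightarrow> x" "ys \<longlonglongrightarrow> y" "\<And>k. ys k \<in> subgradients g (xs k)"
  shows "y \<in> subgradients g x"
  unfolding subgradients_def
proof (clarify)
  fix z
  have "isCont g x" using assms(1) by (simp add: continuous_on_eq_continuous_at)
  then have "(\<lambda>k. g (xs k)) \<longlonglongrightarrow> g x" using assms(2) by (rule isCont_tendsto_compose)
  then have "(\<lambda>k. g (xs k) + ys k \<bullet> (z - xs k)) \<longlonglongrightarrow> g x + y \<bullet> (z - x)"
    using assms by (intro tendsto_intros)
  then show "g x + y \<bullet> (z - x) \<le> g z"
    by (rule LIMSEQ_le_const2) (use assms(4) in \<open>auto simp: subgradients_def\<close>)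
qed

text \<open>The local Frechet inequality becomes global because convexity scales it along segments,
  so that it has to be tested close to \<open>x\<close> only. Taking limits adds nothing, as the
  graph of \<open>subgradients\<close> is closed.\<close>

lemma subdiff_real_convex:
  fixes g :: "'a::euclidean_space \<Rightarrow> real"
  assumes cvx: "convex_on UNIV g"
  shows "subdiff_real g x = subgradients g x"
proof -
  have cont: "continuous_on UNIV g" by (rule convex_on_continuous[OF open_UNIV cvx])
  have fr: "frechet_subdiff (\<lambda>x. ereal (g x)) x = subgradients g x" for x
  proof (intro equalityI subsetI)
    fix y assume "y \<in> frechet_subdiff (\<lambda>x. ereal (g x)) x"
    then have H: "\<forall>\<^sub>F z in at x. g x + y \<bullet> (z - x) - e * norm (z - x) \<le> g z" if "e > 0" for e
      using that by (simp add: frechet_subdiff_iff[OF refl])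
    have "g x + y \<bullet> (z - x) \<le> g z" for z
    proof (rule field_le_epsilon)
      fix c :: real assume c: "c > 0"
      define e where "e = c / (norm (z - x) + 1)"
      have pos: "norm (z - x) + 1 > 0" by (smt (verit) norm_ge_zero)
      have e: "e > 0" using c pos by (simp add: e_def)
      have "e * norm (z - x) \<le> c"
        using c pos by (simp add: e_def field_simps mult_left_mono)
      obtain d where d: "d > 0" "\<And>w. w \<noteq> x \<Longrightarrow> dist w x < d \<Longrightarrow> g x + y \<bullet> (w - x) - e * norm (w - x) \<le> g w"
        using H[OF e] unfolding eventually_at by auto
      show "g x + y \<bullet> (z - x) \<le> g z + c"
      proof (cases "z = x")
        case True with c show ?thesis by simp
      next
        case False
        \<comment> \<open>Brings \<open>w\<close> within \<open>d / 2\<close> of \<open>x\<close>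
          without leaving the segment to \<open>z\<close>.\<close>
        define \<theta> where "\<theta> = min 1 (d / (2 * norm (z - x)))"
        have th: "0 < \<theta>" "\<theta> \<le> 1" using d False by (auto simp: \<theta>_def)
        define w where "w = x + \<theta> *\<^sub>R (z - x)"
        have wx: "w - x = \<theta> *\<^sub>R (z - x)" by (simp add: w_def)
        have "\<theta> * norm (z - x) \<le> d / 2"
        proof -
          have "\<theta> \<le> d / (2 * norm (z - x))" by (simp add: \<theta>_def)
          then show ?thesis using False by (simp add: field_simps)
        qed
        then have "dist w x < d" using d th by (simp add: dist_norm wx)
        moreover have "w \<noteq> x" using wx th False by auto
        ultimately have 1: "g x + y \<bullet> (w - x) - e * norm (w - x) \<le> g w" using d by blast
        have "w = (1 - \<theta>) *\<^sub>R x + \<theta> *\<^sub>R z" by (simp add: w_def algebra_simps)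
        then have "g w \<le> (1 - \<theta>) * g x + \<theta> * g z"
          using convex_onD[OF cvx, of \<theta> x z] th by auto
        with 1 have "\<theta> * (y \<bullet> (z - x) - e * norm (z - x)) \<le> \<theta> * (g z - g x)"
          using th by (simp add: wx right_diff_distrib left_diff_distrib mult.left_commute)
        then have "y \<bullet> (z - x) - e * norm (z - x) \<le> g z - g x" using th by simp
        with \<open>e * norm (z - x) \<le> c\<close> show ?thesis by linarith
      qed
    qed
    then show "y \<in> subgradients g x" by (simp add: subgradients_def)
  next
    fix y assume y: "y \<in> subgradients g x"
    have "g x + y \<bullet> (z - x) - e * norm (z - x) \<le> g z" if "e > 0" for e z
    proof -
      have "g x + y \<bullet> (z - x) \<le> g z" "e * norm (z - x) \<ge> 0"
        using y that by (auto simp: subgradients_def)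
      then show ?thesis by linarith
    qed
    then show "y \<in> frechet_subdiff (\<lambda>x. ereal (g x)) x" 
      by (simp add: frechet_subdiff_iff[OF refl])
  qed
  show ?thesis
  proof (intro equalityI subsetI)
    fix y assume "y \<in> subdiff_real g x"
    then show "y \<in> subgradients g x"
      unfolding limiting_subdiff_def fr by (auto intro: subgradients_limit[OF cont])
  next
    fix y assume "y \<in> subgradients g x"
    then show "y \<in> subdiff_real g x"
      unfolding limiting_subdiff_def fr
      by (intro CollectI conjI exI[of _ "\<lambda>_. x"] exI[of _ "\<lambda>_. y"]) (auto simp: edom_def)
  qed
qed

text \<open>Test the subgradient inequality one unit along \<open>y\<close> itself:
  \<open>norm y\<close> is at most the variation of \<open>g\<close> over a ball one unit larger
  than one containing \<open>K\<close>, and continuity bounds that.\<close>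

lemma bounded_subgradients:
  fixes g :: "'a::euclidean_space \<Rightarrow> real"
  assumes cvx: "convex_on UNIV g" and K: "bounded K"
  obtains M where "M \<ge> 0" "\<And>z y. z \<in> K \<Longrightarrow> y \<in> subgradients g z \<Longrightarrow> norm y \<le> M"
proof -
  have cont: "continuous_on UNIV g" by (rule convex_on_continuous[OF open_UNIV cvx])
  obtain r where r: "\<And>z. z \<in> K \<Longrightarrow> norm z \<le> r" using K unfolding bounded_iff by blast
  have "compact (g ` cball 0 (r + 1))"
    using cont by (intro compact_continuous_image) (auto intro: continuous_on_subset)
  then obtain B where B: "\<And>z. norm z \<le> r + 1 \<Longrightarrow> \<bar>g z\<bar> \<le> B"
    by (meson bounded_real compact_imp_bounded imageI mem_cball_0)
  have *: "norm y \<le> 2 * B" if "z \<in> K" "y \<in> subgradients g z" for z y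
  proof (cases "y = 0")
    case True
    have "0 \<le> \<bar>g z\<bar>" by simp
    with B[of z] r[OF that(1)] True show ?thesis by simp
  next
    case False
    have "g z + y \<bullet> (z + sgn y - z) \<le> g (z + sgn y)"
      using that(2) unfolding subgradients_def by blast
    moreover have "y \<bullet> sgn y = norm y" using False
      by (simp add: sgn_div_norm dot_square_norm power2_eq_square)
    moreover have "norm (z + sgn y) \<le> r + 1"
      using norm_triangle_ineq[of z "sgn y"] r[OF that(1)] by (simp add: norm_sgn split: if_splits)
    ultimately show ?thesis using B[of z] B[of "z + sgn y"] r[OF that(1)] by simp
  qed
  show thesis
    by (rule that[of "max 0 (2 * B)"]) (use * in fastforce)+
qed

section \<open>The conjugate, the Fenchel--Young inequality and the dual proximal step\<close>

lemma conj_fun_le_iff: "conj_fun g y \<le> ereal c \<longleftrightarrow> (\<forall>x. x \<bullet> y - g x \<le> c)"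
  by (simp add: conj_fun_def SUP_le_iff)

lemma conj_fun_not_MInf: "conj_fun g y \<noteq> -\<infinity>"
proof -
  have "ereal (0 \<bullet> y - g 0) \<le> conj_fun g y" unfolding conj_fun_def by (rule SUP_upper) simp
  then show ?thesis by auto
qed

text \<open>Informative on \<open>edom (conj_fun g)\<close> only: elsewhere
  \<open>real_of_ereal\<close> turns infinity into 0.\<close>

definition conj_real :: "('a::real_inner \<Rightarrow> real) \<Rightarrow> 'a \<Rightarrow> real" where
  "conj_real g y = real_of_ereal (conj_fun g y)"

text \<open>For \<open>y\<close> in the domain of the conjugate this is an affine minorant of
  \<open>g\<close> in \<open>x\<close>, exact where \<open>y\<close> is a subgradient. For fixed
  \<open>x\<close> it is concave in \<open>y\<close>, and the dual step is a proximal ascent step on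
  it.\<close>

definition eta_real :: "('a::real_inner \<Rightarrow> real) \<Rightarrow> 'a \<Rightarrow> 'a \<Rightarrow> real" where
  "eta_real g x y = x \<bullet> y - conj_real g y"

lemma conj_fun_real: "y \<in> edom (conj_fun g) \<Longrightarrow> conj_fun g y = ereal (conj_real g y)"
  using conj_fun_not_MInf[of g y] by (cases "conj_fun g y") (auto simp: edom_def conj_real_def)

lemma eta_eq_real: "y \<in> edom (conj_fun g) \<Longrightarrow> eta g x y = ereal (eta_real g x y)"
  by (simp add: eta_def conj_fun_real eta_real_def)

lemma fenchel_young: "y \<in> edom (conj_fun g) \<Longrightarrow> x \<bullet> y - g x \<le> conj_real g y"
  using conj_fun_le_iff[of g y "conj_real g y"] by (simp add: conj_fun_real)

lemma eta_real_le: "y \<in> edom (conj_fun g) \<Longrightarrow> eta_real g x y \<le> g x"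
  using fenchel_young[of y g x] by (simp add: eta_real_def)

text \<open>Equality case of Fenchel--Young: the subgradient inequality says that \<open>z\<close>
  attains the supremum defining the conjugate.\<close>

lemma conj_fun_subgradient:
  assumes "y \<in> subgradients g z"
  shows "y \<in> edom (conj_fun g)" "conj_real g y = z \<bullet> y - g z"
proof -
  have "conj_fun g y \<le> ereal (z \<bullet> y - g z)"
    unfolding conj_fun_le_iff using assms
    by (auto simp: subgradients_def inner_diff_right inner_commute algebra_simps)
  moreover have "ereal (z \<bullet> y - g z) \<le> conj_fun g y"
    unfolding conj_fun_def by (rule SUP_upper) simp
  ultimately have "conj_fun g y = ereal (z \<bullet> y - g z)" by (rule antisym)
  then show "y \<in> edom (conj_fun g)" "conj_real g y = z \<bullet> y - g z"
    by (auto simp: edom_def conj_real_def)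
qed

text \<open>Inversion of subdifferentials: \<open>z\<close> is a subgradient of the conjugate at
  \<open>y\<close>, tested on the domain of the conjugate, where \<open>conj_real\<close> is
  faithful.\<close>

lemma conj_real_subgradient_ineq:
  assumes "y \<in> subgradients g z" "w \<in> edom (conj_fun g)"
  shows "conj_real g y + z \<bullet> (w - y) \<le> conj_real g w"
  using conj_fun_subgradient[OF assms(1)] fenchel_young[OF assms(2), of z]
  by (simp add: inner_diff_right)

lemma conj_fun_convex:
  assumes "y \<in> edom (conj_fun g)" "w \<in> edom (conj_fun g)" "0 \<le> \<theta>" "\<theta> \<le> 1"
  shows "(1 - \<theta>) *\<^sub>R y + \<theta> *\<^sub>R w \<in> edom (conj_fun g)"
    "conj_real g ((1 - \<theta>) *\<^sub>R y + \<theta> *\<^sub>R w) \<le> (1 - \<theta>) * conj_real g y + \<theta> * conj_real g w"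
proof -
  let ?v = "(1 - \<theta>) *\<^sub>R y + \<theta> *\<^sub>R w"
  have *: "conj_fun g ?v \<le> ereal ((1 - \<theta>) * conj_real g y + \<theta> * conj_real g w)"
    unfolding conj_fun_le_iff
  proof
    fix x
    have "(1 - \<theta>) * (x \<bullet> y - g x) \<le> (1 - \<theta>) * conj_real g y" "\<theta> * (x \<bullet> w - g x) \<le> \<theta> * conj_real g w"
      using fenchel_young[OF assms(1)] fenchel_young[OF assms(2)] assms by (auto intro!: mult_left_mono)
    then show "x \<bullet> ?v - g x \<le> (1 - \<theta>) * conj_real g y + \<theta> * conj_real g w"
      by (simp add: algebra_simps inner_add_right)
  qed
  then show dom: "?v \<in> edom (conj_fun g)" by (auto simp: edom_def)
  from * show "conj_real g ?v \<le> (1 - \<theta>) * conj_real g y + \<theta> * conj_real g w"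
    by (simp add: conj_fun_real[OF dom])
qed

text \<open>Divide by \<open>\<theta>\<close> and let it shrink. This extracts the first-order
  condition from minimality along a segment, where the proximal term contributes the factor
  \<open>\<theta>\<^sup>2\<close>.\<close>

lemma le_if_le_scaled_square:
  fixes a b :: real
  assumes "\<And>\<theta>. 0 < \<theta> \<Longrightarrow> \<theta> \<le> 1 \<Longrightarrow> \<theta> * a \<le> \<theta>\<^sup>2 * b"
  shows "a \<le> 0"
proof (rule ccontr)
  assume "\<not> a \<le> 0"
  then have a: "a > 0" by simp
  define \<theta> where "\<theta> = min 1 (a / (2 * (\<bar>b\<bar> + 1)))"
  have th: "0 < \<theta>" "\<theta> \<le> 1" using a by (auto simp: \<theta>_def)
  from assms[OF this] have "a \<le> \<theta> * b" using th by (simp add: power2_eq_square mult.assoc)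
  also have "\<dots> \<le> \<theta> * (\<bar>b\<bar> + 1)" using th by (intro mult_left_mono) auto
  also have "\<dots> \<le> a / (2 * (\<bar>b\<bar> + 1)) * (\<bar>b\<bar> + 1)" by (intro mult_right_mono) (auto simp: \<theta>_def)
  also have "\<dots> = a / 2" by (simp add: field_simps) 
  finally show False using a by simp
qed

text \<open>First-order optimality, perturbing the minimiser along segments, gives \<open>z \<in> \<partial>g\<^sup>*(y')\<close> for
  \<open>z = x - (y' - y) / \<alpha>\<close>; a subgradient of \<open>g\<close> at \<open>z\<close> turns this into \<open>y' \<in> \<partial>g(z)\<close>.\<close>

lemma prox_conj_subgradient:
  fixes g :: "'a::euclidean_space \<Rightarrow> real"
  assumes cvx: "convex_on UNIV g" and \<alpha>: "\<alpha> > 0"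
    and y: "y \<in> edom (conj_fun g)"
    and prox: "y' \<in> prox_on UNIV (\<lambda>z. ereal \<alpha> * conj_fun g z) (y + \<alpha> *\<^sub>R x)"
  shows "y' \<in> subgradients g (x - (1/\<alpha>) *\<^sub>R (y' - y))"
proof -
  define z where "z = x - (1/\<alpha>) *\<^sub>R (y' - y)"
  have min: "ereal \<alpha> * conj_fun g y' + ereal (1/2 * (norm (y' - (y + \<alpha> *\<^sub>R x)))\<^sup>2)
     \<le> ereal \<alpha> * conj_fun g w + ereal (1/2 * (norm (w - (y + \<alpha> *\<^sub>R x)))\<^sup>2)" for w
    using prox by (auto simp: prox_on_def is_arg_min_def not_less)
  have y': "y' \<in> edom (conj_fun g)"
  proof (rule ccontr)
    assume "y' \<notin> edom (conj_fun g)"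
    then have "conj_fun g y' = \<infinity>" by (simp add: edom_def)
    with min[of y] conj_fun_real[OF y] \<alpha> show False by simp
  qed
  have minr: "\<alpha> * conj_real g y' + 1/2 * (norm (y' - (y + \<alpha> *\<^sub>R x)))\<^sup>2
     \<le> \<alpha> * conj_real g w + 1/2 * (norm (w - (y + \<alpha> *\<^sub>R x)))\<^sup>2" if "w \<in> edom (conj_fun g)" for w
    using min[of w] conj_fun_real[OF that] conj_fun_real[OF y'] by simp
  have opt: "conj_real g y' + z \<bullet> (w - y') \<le> conj_real g w" if w: "w \<in> edom (conj_fun g)" for w
  proof -
    define a where "a = conj_real g y' + z \<bullet> (w - y') - conj_real g w"
    have "\<theta> * a \<le> \<theta>\<^sup>2 * ((norm (w - y'))\<^sup>2 / (2 * \<alpha>))" if th: "0 < \<theta>" "\<theta> \<le> 1" for \<theta>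
    proof -
      let ?v = "(1 - \<theta>) *\<^sub>R y' + \<theta> *\<^sub>R w"
      note c = conj_fun_convex[OF y' w, of \<theta>]
      have v: "?v - (y + \<alpha> *\<^sub>R x) = (y' - (y + \<alpha> *\<^sub>R x)) + \<theta> *\<^sub>R (w - y')" by (simp add: algebra_simps)
      have n: "(norm (?v - (y + \<alpha> *\<^sub>R x)))\<^sup>2 = (norm (y' - (y + \<alpha> *\<^sub>R x)))\<^sup>2
         + 2 * \<theta> * ((y' - (y + \<alpha> *\<^sub>R x)) \<bullet> (w - y')) + \<theta>\<^sup>2 * (norm (w - y'))\<^sup>2"
        unfolding v power2_norm_eq_inner
        by (simp add: inner_add_left inner_add_right inner_commute power2_eq_square algebra_simps)
      \<comment> \<open>The choice of \<open>z\<close> makes the gradient of the quadratic term at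
        \<open>y'\<close> a multiple of \<open>z\<close>.\<close>
      have zz: "y' - (y + \<alpha> *\<^sub>R x) = - \<alpha> *\<^sub>R z" using \<alpha> by (simp add: z_def algebra_simps)
      have "\<alpha> * conj_real g y' \<le> \<alpha> * ((1 - \<theta>) * conj_real g y' + \<theta> * conj_real g w)
         - \<alpha> * \<theta> * (z \<bullet> (w - y')) + \<theta>\<^sup>2 * (norm (w - y'))\<^sup>2 / 2"
        using minr[of ?v] c th \<alpha> mult_left_mono[OF c(2), of \<alpha>] unfolding n zz
        by (simp add: algebra_simps)
      then have "\<alpha> * (\<theta> * a) \<le> \<theta>\<^sup>2 * (norm (w - y'))\<^sup>2 / 2"
        by (simp add: a_def algebra_simps)
      then show ?thesis using \<alpha> by (simp add: field_simps)
    qed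
    then have "a \<le> 0" by (rule le_if_le_scaled_square)
    then show ?thesis by (simp add: a_def)
  qed
  obtain w where w: "w \<in> subgradients g z" using subgradients_nonempty[OF cvx] by blast
  have gz: "g z \<le> z \<bullet> y' - conj_real g y'"
    using opt[OF conj_fun_subgradient(1)[OF w]] conj_fun_subgradient(2)[OF w]
    by (simp add: inner_diff_right)
  have "g z + y' \<bullet> (u - z) \<le> g u" for u
    using fenchel_young[OF y', of u] gz by (simp add: inner_diff_right inner_commute)
  then show ?thesis by (simp add: subgradients_def z_def)
qed

text \<open>The base point \<open>z - (1/\<alpha>) *\<^sub>R (y' - y)\<close> is a subgradient of
  the conjugate at \<open>y'\<close>, so \<open>(1/\<alpha>) *\<^sub>R (y' - y)\<close> is a
  supergradient there of the concave function \<open>eta_real g z\<close>.\<close>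

lemma eta_dual_step:
  fixes g :: "'a::real_inner \<Rightarrow> real"
  assumes "y' \<in> subgradients g (z - (1/\<alpha>) *\<^sub>R (y' - y))" "w \<in> edom (conj_fun g)"
  shows "eta_real g z w \<le> eta_real g z y' + (1/\<alpha>) * ((y' - y) \<bullet> (w - y'))"
  using conj_real_subgradient_ineq[OF assms]
  by (simp add: eta_real_def inner_diff_left inner_diff_right algebra_simps)

text \<open>The supergradient inequality at the old dual point \<open>w = y\<close>.\<close>

lemma eta_dual_increase:
  fixes g :: "'a::real_inner \<Rightarrow> real"
  assumes "y' \<in> subgradients g (z - (1/\<alpha>) *\<^sub>R (y' - y))" "y \<in> edom (conj_fun g)"
  shows "eta_real g z y + (1/\<alpha>) * (norm (y' - y))\<^sup>2 \<le> eta_real g z y'"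
proof -
  have "(y' - y) \<bullet> (y - y') = - (norm (y' - y))\<^sup>2"
    by (metis inner_minus_right minus_diff_eq power2_norm_eq_inner)
  with eta_dual_step[OF assms] show ?thesis by simp
qed

text \<open>Either the dual step is short, and then \<open>\<eta>\<close> is close to \<open>g\<close>, or it is long and itself
  increases \<open>\<eta>\<close>.\<close>

lemma eta_dual_lower_bound:
  fixes g :: "'a::real_inner \<Rightarrow> real"
  assumes y': "y' \<in> subgradients g (z - (1/\<alpha>) *\<^sub>R (y' - y))" and y: "y \<in> edom (conj_fun g)"
    and pos: "eta_real g z y \<ge> 0"
    and w: "w \<in> subgradients g z" and M: "norm w \<le> M" "norm y' \<le> M" and \<alpha>: "0 < lo" "lo \<le> \<alpha>" "\<alpha> \<le> up"
    and c: "c \<le> g z" "c > 0"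
  shows "min (c / 2) ((c * lo / (4 * (M + 1)))\<^sup>2 / up) \<le> eta_real g z y'"
\<comment> \<open>The threshold makes the correction term of \<open>eta_dual_step\<close>, at most
  \<open>norm (y' - y) * (2 * (M + 1)) / lo\<close>, cost half of \<open>c\<close>. Using
  \<open>M + 1\<close> avoids a zero denominator.\<close>
proof (cases "norm (y' - y) \<le> c * lo / (4 * (M + 1))")
  case True
  have M0: "M \<ge> 0" using M(1) norm_ge_zero order_trans by blast
  have "eta_real g z w = g z"
    using conj_fun_subgradient[OF w] by (simp add: eta_real_def)
  then have "c \<le> eta_real g z y' + (1/\<alpha>) * ((y' - y) \<bullet> (w - y'))"
    using eta_dual_step[OF y' conj_fun_subgradient(1)[OF w]] c by simp
  also have "(1/\<alpha>) * ((y' - y) \<bullet> (w - y')) \<le> (1/lo) * (norm (y' - y) * (2 * (M + 1)))"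
  proof -
    have "norm (w - y') \<le> 2 * (M + 1)" using norm_triangle_ineq4[of w y'] M by simp
    then have "(y' - y) \<bullet> (w - y') \<le> norm (y' - y) * (2 * (M + 1))"
      using norm_cauchy_schwarz[of "y' - y" "w - y'"] mult_left_mono[of "norm (w - y')" "2 * (M + 1)" "norm (y' - y)"]
      by simp
    then have "(1/\<alpha>) * ((y' - y) \<bullet> (w - y')) \<le> (1/\<alpha>) * (norm (y' - y) * (2 * (M + 1)))"
      using \<alpha> by (intro mult_left_mono) auto
    also have "\<dots> \<le> (1/lo) * (norm (y' - y) * (2 * (M + 1)))"
      using \<alpha> M0 by (intro mult_right_mono) (auto simp: frac_le)
    finally show ?thesis .
  qed
  also have "\<dots> \<le> (1/lo) * (c * lo / (4 * (M + 1)) * (2 * (M + 1)))"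
    using True \<alpha> M0 by (intro mult_left_mono mult_right_mono) auto
  also have "\<dots> = c / 2"
  proof -
    have "lo \<noteq> 0" "M + 1 \<noteq> 0" using \<alpha> M0 by auto
    then show ?thesis by (simp add: divide_simps)
  qed
  finally show ?thesis by (simp add: min_le_iff_disj)
next
  case False
  have M0: "M \<ge> 0" using M(1) norm_ge_zero order_trans by blast
  have "(c * lo / (4 * (M + 1)))\<^sup>2 / up \<le> (norm (y' - y))\<^sup>2 / up"
    using False c \<alpha> M0 by (intro divide_right_mono power_mono) auto
  also have "\<dots> \<le> (norm (y' - y))\<^sup>2 / \<alpha>" using \<alpha> by (intro divide_left_mono) auto
  also have "\<dots> \<le> eta_real g z y'" using eta_dual_increase[OF y' y] pos by simp
  finally show ?thesis by (simp add: min_le_iff_disj)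
qed

section \<open>The Kurdyka--Lojasiewicz inequality\<close>

lemma two_le_add_if_square_le_mult:
  fixes a b c :: real
  assumes "b\<^sup>2 \<le> a * c" "a \<ge> 0" "c \<ge> 0"
  shows "2 * b \<le> a + c"
proof -
  have "(2 * b)\<^sup>2 \<le> (a + c)\<^sup>2"
    using assms(1) zero_le_power2[of "a - c"] by (simp add: power2_eq_square algebra_simps)
  from power2_le_imp_le[OF this] show ?thesis using assms(2,3) by simp
qed

text \<open>A desingularising function, with concavity reduced to the single consequence that is used.\<close>

definition desingularizing :: "real \<Rightarrow> (real \<Rightarrow> real) \<Rightarrow> (real \<Rightarrow> real) \<Rightarrow> bool" where
  "desingularizing \<epsilon> \<psi> \<psi>' \<longleftrightarrow> \<epsilon> > 0 \<and> (\<forall>s. 0 \<le> s \<and> s < \<epsilon> \<longrightarrow> \<psi> s \<ge> 0) \<and>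
     (\<forall>s. 0 < s \<and> s < \<epsilon> \<longrightarrow> \<psi>' s > 0) \<and>
     (\<forall>s t. 0 \<le> t \<and> t < s \<and> s < \<epsilon> \<longrightarrow> \<psi>' s * (s - t) \<le> \<psi> s - \<psi> t)"

text \<open>With \<open>b k\<close> the root of the decrease, KL and the residual bound give
  \<open>1 \<le> \<psi>' (q (Suc k)) * (C * b k)\<close>, and the tangent inequality bounds
  \<open>\<psi>' (q (Suc k)) * (b (Suc k))\<^sup>2\<close> by a drop of \<open>\<psi>\<close>. So
  \<open>(b (Suc k))\<^sup>2\<close> is at most \<open>b k\<close> times a telescoping term, and the
  inequality of arithmetic and geometric means makes the roots summable.\<close>

lemma summable_sqrt_decrease:
  fixes q r :: "nat \<Rightarrow> real"
  assumes q0: "\<And>k. q k \<ge> 0" and dec: "\<And>k. q (Suc k) \<le> q k" and lim: "q \<longlonglongrightarrow> 0"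
    and ds: "desingularizing \<epsilon> \<psi> \<psi>'" and C: "C \<ge> 0"
    and res: "\<And>k. k \<ge> K \<Longrightarrow> r (Suc k) \<le> C * sqrt (q k - q (Suc k))"
    and KL: "\<And>k. k \<ge> K \<Longrightarrow> q k > 0 \<Longrightarrow> q k < \<epsilon> \<Longrightarrow> \<psi>' (q k) * r k \<ge> 1"
  shows "summable (\<lambda>k. sqrt (q k - q (Suc k)))"
\<comment> \<open>KL says nothing at the limit value itself. If \<open>q\<close> reaches it,
  monotonicity keeps \<open>q\<close> there and the sum is finite.\<close>
proof (cases "\<exists>k. q k = 0")
  case True
  then obtain k0 where k0: "q k0 = 0" by blast
  have dec': "q k \<le> q k0" if "k \<ge> k0" for k
    using lift_Suc_antimono_le[of q, OF dec that] .
  have z: "q k = 0" if "k \<ge> k0" for k using dec'[OF that] q0[of k] k0 by simp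
  show ?thesis
    by (rule summable_finite[of "{..<k0}"]) (auto simp: z not_less)
next
  case False
  then have pos: "q k > 0" for k using q0[of k] by (auto simp: less_le)
  define b where "b k = sqrt (q k - q (Suc k))" for k
  have b0: "b k \<ge> 0" for k using dec[of k] by (simp add: b_def)
  have b2: "(b k)\<^sup>2 = q k - q (Suc k)" for k using dec[of k] by (simp add: b_def)
  have "\<epsilon> > 0" using ds by (simp add: desingularizing_def)
  then have "\<forall>\<^sub>F k in sequentially. q k < \<epsilon>" using lim by (auto dest: order_tendstoD(2))
  then obtain K1 where K1: "\<And>k. k \<ge> K1 \<Longrightarrow> q k < \<epsilon>" by (auto simp: eventually_sequentially)
  define k0 where "k0 = max K K1"
  have step: "2 * b (Suc k) \<le> b k + C * (\<psi> (q (Suc k)) - \<psi> (q (Suc (Suc k))))" if k: "k \<ge> k0" for k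
  proof -
    have qs: "q (Suc k) < \<epsilon>" using K1 k by (simp add: k0_def)
    have p': "\<psi>' (q (Suc k)) > 0" using ds pos qs by (auto simp: desingularizing_def)
    have "1 \<le> \<psi>' (q (Suc k)) * r (Suc k)" using KL[of "Suc k"] pos qs k by (simp add: k0_def)
    also have "\<dots> \<le> \<psi>' (q (Suc k)) * (C * b k)"
      using res[of k] k p' by (intro mult_left_mono) (auto simp: k0_def b_def)
    finally have 1: "1 \<le> \<psi>' (q (Suc k)) * (C * b k)" .
    have 2: "\<psi>' (q (Suc k)) * (b (Suc k))\<^sup>2 \<le> \<psi> (q (Suc k)) - \<psi> (q (Suc (Suc k)))"
    proof (cases "q (Suc (Suc k)) < q (Suc k)")
      case True
      then show ?thesis using ds qs q0[of "Suc (Suc k)"] by (auto simp: desingularizing_def b2)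
    next
      case False
      then have "q (Suc (Suc k)) = q (Suc k)" using dec[of "Suc k"] by simp
      then show ?thesis by (simp add: b2)
    qed
    have "(b (Suc k))\<^sup>2 \<le> (\<psi>' (q (Suc k)) * (C * b k)) * (b (Suc k))\<^sup>2"
      using 1 by (intro mult_le_cancel_right1[THEN iffD2]) auto
    also have "\<dots> = (C * b k) * (\<psi>' (q (Suc k)) * (b (Suc k))\<^sup>2)" by simp
    also have "\<dots> \<le> (C * b k) * (\<psi> (q (Suc k)) - \<psi> (q (Suc (Suc k))))"
      using 2 C b0 by (intro mult_left_mono) auto
    finally have "(b (Suc k))\<^sup>2 \<le> b k * (C * (\<psi> (q (Suc k)) - \<psi> (q (Suc (Suc k)))))" by (simp add: mult_ac)
    moreover have "0 \<le> \<psi> (q (Suc k)) - \<psi> (q (Suc (Suc k)))" 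
      using order_trans[OF mult_nonneg_nonneg[OF less_imp_le[OF p'] zero_le_power2] 2] .
    ultimately show ?thesis using C b0 by (intro two_le_add_if_square_le_mult) auto
  qed
  \<comment> \<open>Of the two copies of \<open>b (Suc k)\<close> on the left of
    \<open>step\<close>, one cancels against the next right-hand side; only
    \<open>b k0 - b (k0 + n)\<close> is left of them.\<close>
  have ind: "(\<Sum>j<n. b (Suc k0 + j)) \<le> b k0 - b (k0 + n) + C * (\<psi> (q (Suc k0)) - \<psi> (q (Suc k0 + n)))" for n
  proof (induction n)
    case (Suc n)
    have "2 * b (Suc (k0 + n)) \<le> b (k0 + n) + C * (\<psi> (q (Suc (k0 + n))) - \<psi> (q (Suc (Suc (k0 + n)))))"
      by (rule step) simp
    with Suc show ?case by (simp add: algebra_simps)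
  qed simp
  have "(\<Sum>j<n. b (Suc k0 + j)) \<le> b k0 + C * \<psi> (q (Suc k0))" for n
  proof -
    have "q (Suc k0 + n) < \<epsilon>" using K1 by (simp add: k0_def)
    then have "\<psi> (q (Suc k0 + n)) \<ge> 0" using ds q0 by (auto simp: desingularizing_def)
    with C have "C * (\<psi> (q (Suc k0)) - \<psi> (q (Suc k0 + n))) \<le> C * \<psi> (q (Suc k0))"
      by (intro mult_left_mono) auto
    with ind[of n] b0[of "k0 + n"] show ?thesis by simp
  qed
  then have "summable (\<lambda>j. b (Suc k0 + j))" by (intro summableI_nonneg_bounded) (auto simp: b0)
  then have "summable (\<lambda>j. b (j + Suc k0))" by (simp add: add.commute)
  then have "summable b" by (rule summable_iff_shift[THEN iffD1])
  then show ?thesis by (simp add: b_def[abs_def])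
qed

text \<open>The slopes of secants ending at \<open>s\<close> decrease as their other end approaches
  \<open>s\<close> from the left, and their limit is \<open>d\<close>.\<close>

lemma concave_on_tangent:
  fixes \<psi> :: "real \<Rightarrow> real"
  assumes conc: "concave_on I \<psi>" and t: "t \<in> I" and s: "s \<in> I" "t < s"
    and D: "(\<psi> has_real_derivative d) (at s)"
  shows "d * (s - t) \<le> \<psi> s - \<psi> t"
proof -
  have conv: "convex_on I (\<lambda>x. - \<psi> x)" using conc by (simp add: concave_on_def)
  have "((\<lambda>w. (\<psi> w - \<psi> s) / (w - s)) \<longlongrightarrow> d) (at s)"
    using D by (simp add: has_field_derivative_iff)
  then have lim: "((\<lambda>w. (\<psi> w - \<psi> s) / (w - s)) \<longlongrightarrow> d) (at_left s)"
    by (rule filterlim_mono) (auto intro: at_le)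
  have ev: "\<forall>\<^sub>F w in at_left s. t < w \<and> w < s"
    using s(2) eventually_at_left_real by (auto elim: eventually_mono)
  have "\<forall>\<^sub>F w in at_left s. (\<psi> w - \<psi> s) / (w - s) \<le> (\<psi> s - \<psi> t) / (s - t)"
    using ev
  proof eventually_elim
    case (elim w)
    define l where "l = (w - t) / (s - t)"
    have l: "0 \<le> l" "l \<le> 1" using elim by (auto simp: l_def)
    have "l * (s - t) = w - t" using elim by (simp add: l_def)
    then have w: "w = (1 - l) * t + l * s" by (simp add: algebra_simps)
    have "(1 - l) * \<psi> t + l * \<psi> s \<le> \<psi> w"
      using convex_onD[OF conv l t s(1)] by (simp add: w algebra_simps)
    then have "\<psi> s - \<psi> w \<le> (1 - l) * (\<psi> s - \<psi> t)" by (simp add: algebra_simps)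
    moreover have "1 - l = (s - w) / (s - t)" using elim by (simp add: l_def field_simps)
    ultimately have "\<psi> s - \<psi> w \<le> (s - w) * ((\<psi> s - \<psi> t) / (s - t))" by simp
    then have "(\<psi> s - \<psi> w) / (s - w) \<le> (\<psi> s - \<psi> t) / (s - t)"
      using elim by (simp add: pos_divide_le_eq mult.commute)
    moreover have "(\<psi> w - \<psi> s) / (w - s) = (\<psi> s - \<psi> w) / (s - w)"
      using minus_divide_divide[of "\<psi> s - \<psi> w" "s - w"] by simp
    ultimately show ?case by simp
  qed
  then have "d \<le> (\<psi> s - \<psi> t) / (s - t)"
    by (intro tendsto_upperbound[OF lim]) auto
  then show ?thesis using s by (simp add: pos_le_divide_eq)
qed

text \<open>\<open>edist0\<close> is an infimum, so the norm of any single subgradient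
  \<open>w\<close> may replace it.\<close>

lemma KL_at_desingularizing:
  assumes KL: "KL_at \<phi> x" and v: "\<phi> x = ereal v"
  shows "\<exists>\<epsilon> \<delta> \<psi> \<psi>'. desingularizing \<epsilon> \<psi> \<psi>' \<and> \<delta> > 0 \<and>
     (\<forall>z w c. dist z x < \<delta> \<longrightarrow> \<phi> z = ereal c \<longrightarrow> v < c \<longrightarrow> c < v + \<epsilon> \<longrightarrow>
       w \<in> limiting_subdiff \<phi> z \<longrightarrow> 1 \<le> \<psi>' (c - v) * norm w)"
proof -
  obtain \<epsilon> :: ereal and \<delta> :: real and \<psi> \<psi>' where KL':
    "\<epsilon> > 0" "\<delta> > 0" "concave_on {s. 0 \<le> s \<and> ereal s < \<epsilon>} \<psi>"
    "\<forall>s. 0 \<le> s \<and> ereal s < \<epsilon> \<longrightarrow> \<psi> s \<ge> 0"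
    "\<forall>s. 0 < s \<and> ereal s < \<epsilon> \<longrightarrow> (\<psi> has_real_derivative \<psi>' s) (at s) \<and> \<psi>' s > 0"
    "\<forall>z. norm (z - x) < \<delta> \<and> \<phi> x < \<phi> z \<and> \<phi> z < \<phi> x + \<epsilon> \<longrightarrow>
       ereal (\<psi>' (real_of_ereal (\<phi> z - \<phi> x))) * edist0 (limiting_subdiff \<phi> z) \<ge> 1"
    using KL unfolding KL_at_def by blast
  \<comment> \<open>\<open>\<epsilon>\<close> may be infinite; a real bound below it is enough,
    since only values close to the level matter.\<close>
  obtain e where e: "0 < e" "ereal e < \<epsilon>" using ereal_dense2[OF KL'(1)] by auto
  have less: "ereal s < \<epsilon>" if "s < e" for s using less_trans[of "ereal s" "ereal e" \<epsilon>] that e(2) by simp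
  have ds: "desingularizing e \<psi> \<psi>'"
    unfolding desingularizing_def
  proof (intro conjI allI impI)
    fix s t assume st: "0 \<le> t \<and> t < s \<and> s < e"
    show "\<psi>' s * (s - t) \<le> \<psi> s - \<psi> t"
      by (rule concave_on_tangent[OF KL'(3)]) (use KL'(5) st less in auto)
  qed (use KL' e less in auto)
  show ?thesis
  proof (intro exI conjI allI impI)
    show "desingularizing e \<psi> \<psi>'" "\<delta> > 0" by (fact ds KL'(2))+
    fix z w c
    assume z: "dist z x < \<delta>" "\<phi> z = ereal c" "v < c" "c < v + e" and w: "w \<in> limiting_subdiff \<phi> z"
    have "\<phi> z < \<phi> x + \<epsilon>"
      using less[of "c - v"] z v by (cases \<epsilon>) auto
    then have 1: "1 \<le> ereal (\<psi>' (c - v)) * edist0 (limiting_subdiff \<phi> z)"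
      using KL'(6)[rule_format, of z] z v by (auto simp: dist_norm)
    also have "edist0 (limiting_subdiff \<phi> z) \<le> ereal (norm w)"
      unfolding edist0_def using w by (rule INF_lower)
    then have "ereal (\<psi>' (c - v)) * edist0 (limiting_subdiff \<phi> z) \<le> ereal (\<psi>' (c - v)) * ereal (norm w)"
      using KL'(5) z less[of "c - v"] by (intro ereal_mult_left_mono) (auto simp: less_imp_le)
    finally show "1 \<le> \<psi>' (c - v) * norm w" by (simp add: one_ereal_def)
  qed
qed

text \<open>Each clause is additive on the shortest of the intervals.\<close>

lemma desingularizing_sum:
  assumes "finite I" "I \<noteq> {}" "\<And>i. i \<in> I \<Longrightarrow> desingularizing (\<epsilon> i) (\<psi> i) (\<psi>' i)"
  shows "desingularizing (Min (\<epsilon> ` I)) (\<lambda>s. \<Sum>i\<in>I. \<psi> i s) (\<lambda>s. \<Sum>i\<in>I. \<psi>' i s)"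
proof -
  have m: "s < \<epsilon> i" if "s < Min (\<epsilon> ` I)" "i \<in> I" for s i
    by (rule less_le_trans[OF that(1) Min_le]) (use that(2) assms(1) in auto)
  have ds: "\<epsilon> i > 0" "0 \<le> s \<Longrightarrow> s < \<epsilon> i \<Longrightarrow> \<psi> i s \<ge> 0" "0 < s \<Longrightarrow> s < \<epsilon> i \<Longrightarrow> \<psi>' i s > 0"
    "0 \<le> t \<Longrightarrow> t < s \<Longrightarrow> s < \<epsilon> i \<Longrightarrow> \<psi>' i s * (s - t) \<le> \<psi> i s - \<psi> i t"
    if "i \<in> I" for i s t
    using assms(3)[OF that] unfolding desingularizing_def by auto
  show ?thesis
    unfolding desingularizing_def
  proof (intro conjI allI impI)
    show "Min (\<epsilon> ` I) > 0" using assms ds by auto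
    fix s assume "0 \<le> s \<and> s < Min (\<epsilon> ` I)"
    then show "(\<Sum>i\<in>I. \<psi> i s) \<ge> 0" by (intro sum_nonneg ds(2) m) auto
  next
    fix s assume "0 < s \<and> s < Min (\<epsilon> ` I)"
    then show "(\<Sum>i\<in>I. \<psi>' i s) > 0" using assms(1,2) by (intro sum_pos ds(3) m) auto
  next
    fix s t assume st: "0 \<le> t \<and> t < s \<and> s < Min (\<epsilon> ` I)"
    have "(\<Sum>i\<in>I. \<psi>' i s * (s - t)) \<le> (\<Sum>i\<in>I. \<psi> i s - \<psi> i t)"
      by (intro sum_mono ds(4) m) (use st in auto)
    then show "(\<Sum>i\<in>I. \<psi>' i s) * (s - t) \<le> (\<Sum>i\<in>I. \<psi> i s) - (\<Sum>i\<in>I. \<psi> i t)"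
      by (simp add: sum_distrib_right sum_subtractf)
  qed
qed

text \<open>The uniformised KL property of Bolte, Sabach and Teboulle: a finite subcover, with the sum
  of the finitely many desingularising functions.\<close>

lemma uniform_KL:
  fixes \<phi> :: "'a::real_inner \<Rightarrow> ereal"
  assumes K: "compact K" "K \<noteq> {}" and KL: "\<And>p. p \<in> K \<Longrightarrow> KL_at \<phi> p" and v: "\<And>p. p \<in> K \<Longrightarrow> \<phi> p = ereal v"
  obtains \<epsilon> :: real and \<psi> \<psi>' and U where "desingularizing \<epsilon> \<psi> \<psi>'" "open U" "K \<subseteq> U"
    "\<And>z w c. z \<in> U \<Longrightarrow> \<phi> z = ereal c \<Longrightarrow> v < c \<Longrightarrow> c < v + \<epsilon> \<Longrightarrow>
       w \<in> limiting_subdiff \<phi> z \<Longrightarrow> 1 \<le> \<psi>' (c - v) * norm w"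
proof -
  have "\<forall>p\<in>K. \<exists>\<epsilon> \<delta> \<psi> \<psi>'. desingularizing \<epsilon> \<psi> \<psi>' \<and> \<delta> > 0 \<and>
     (\<forall>z w c. dist z p < \<delta> \<longrightarrow> \<phi> z = ereal c \<longrightarrow> v < c \<longrightarrow> c < v + \<epsilon> \<longrightarrow>
       w \<in> limiting_subdiff \<phi> z \<longrightarrow> 1 \<le> \<psi>' (c - v) * norm w)"
    using KL_at_desingularizing[OF KL v] by blast
  then obtain \<epsilon> \<delta> \<psi> \<psi>' where H': "\<forall>p\<in>K. desingularizing (\<epsilon> p) (\<psi> p) (\<psi>' p) \<and> \<delta> p > 0 \<and>
     (\<forall>z w c. dist z p < \<delta> p \<longrightarrow> \<phi> z = ereal c \<longrightarrow> v < c \<longrightarrow> c < v + \<epsilon> p \<longrightarrow>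
       w \<in> limiting_subdiff \<phi> z \<longrightarrow> 1 \<le> \<psi>' p (c - v) * norm w)"
    unfolding bchoice_iff by blast
  have H: "\<And>p. p \<in> K \<Longrightarrow> desingularizing (\<epsilon> p) (\<psi> p) (\<psi>' p)" "\<And>p. p \<in> K \<Longrightarrow> \<delta> p > 0"
    "\<And>p z w c. p \<in> K \<Longrightarrow> dist z p < \<delta> p \<Longrightarrow> \<phi> z = ereal c \<Longrightarrow> v < c \<Longrightarrow> c < v + \<epsilon> p \<Longrightarrow>
       w \<in> limiting_subdiff \<phi> z \<Longrightarrow> 1 \<le> \<psi>' p (c - v) * norm w"
    using H' by blast+
  obtain C where C: "C \<subseteq> K" "finite C" "K \<subseteq> (\<Union>c\<in>C. ball c (\<delta> c))"
    by (rule compactE_image[OF K(1), of K "\<lambda>c. ball c (\<delta> c)"]) (use H in auto)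
  have "C \<noteq> {}" using C K by auto
  have ds: "desingularizing (Min (\<epsilon> ` C)) (\<lambda>s. \<Sum>i\<in>C. \<psi> i s) (\<lambda>s. \<Sum>i\<in>C. \<psi>' i s)"
    by (rule desingularizing_sum) (use C \<open>C \<noteq> {}\<close> H in auto)
  show thesis
  proof (rule that[OF ds])
    show "open (\<Union>c\<in>C. ball c (\<delta> c))" by auto
    show "K \<subseteq> (\<Union>c\<in>C. ball c (\<delta> c))" by (rule C)
    fix z w c
    assume z: "z \<in> (\<Union>c\<in>C. ball c (\<delta> c))" "\<phi> z = ereal c" "v < c" "c < v + Min (\<epsilon> ` C)"
      and w: "w \<in> limiting_subdiff \<phi> z"
    then obtain p where p: "p \<in> C" "dist z p < \<delta> p" by (auto simp: dist_commute)
    have m: "c - v < \<epsilon> i" if "i \<in> C" for i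
    proof -
      have "Min (\<epsilon> ` C) \<le> \<epsilon> i" using that C by simp
      with z show ?thesis by linarith
    qed
    have "1 \<le> \<psi>' p (c - v) * norm w"
      by (rule H(3)) (use p C z w m[OF p(1)] in auto)
    \<comment> \<open>The level \<open>v\<close> is the same at all centres, so all the
      \<open>\<psi>' i\<close> are positive at the one argument \<open>c - v\<close>, and their sum
      dominates the one that belongs to \<open>p\<close>.\<close>
    also have "\<dots> \<le> (\<Sum>i\<in>C. \<psi>' i (c - v)) * norm w"
    proof (intro mult_right_mono member_le_sum)
      fix i assume "i \<in> C - {p}"
      then have "desingularizing (\<epsilon> i) (\<psi> i) (\<psi>' i)" "c - v < \<epsilon> i" using H(1) C m by auto
      then show "0 \<le> \<psi>' i (c - v)" using z by (auto simp: desingularizing_def less_imp_le)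
    qed (use p C in auto)
    finally show "1 \<le> (\<Sum>i\<in>C. \<psi>' i (c - v)) * norm w" .
  qed
qed

section \<open>Frechet subgradients, proximal points and gradients\<close>

lemma frechet_imp_limiting: "w \<in> frechet_subdiff \<phi> z \<Longrightarrow> w \<in> limiting_subdiff \<phi> z"
  unfolding limiting_subdiff_def
  by (intro CollectI conjI exI[of _ "\<lambda>_. z"] exI[of _ "\<lambda>_. w"]) (auto simp: frechet_subdiff_def)

text \<open>Near \<open>x\<close> the quadratic remainder is below any given multiple of the norm.
  The hypothesis is global in \<open>u\<close> with a fixed \<open>C\<close>, which makes it closed
  under limits, unlike the Frechet condition that it implies.\<close>

lemma frechet_subdiff_proximal:
  assumes c: "\<phi> x = ereal c" and C: "C \<ge> 0"
    and v: "\<And>u. ereal (c + v \<bullet> (u - x) - C * (norm (u - x))\<^sup>2) \<le> \<phi> u"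
  shows "v \<in> frechet_subdiff \<phi> x"
  unfolding frechet_subdiff_iff[where \<phi> = \<phi> and x = x, OF c]
proof (intro allI impI)
  fix e :: real assume e: "e > 0"
  have "((\<lambda>u. C * norm (u - x)) \<longlongrightarrow> C * norm (x - x)) (at x)" by (intro tendsto_intros)
  then have "\<forall>\<^sub>F u in at x. C * norm (u - x) < e" using e by (intro order_tendstoD(2)) auto
  then show "\<forall>\<^sub>F u in at x. ereal (c + v \<bullet> (u - x) - e * norm (u - x)) \<le> \<phi> u"
  proof eventually_elim
    case (elim u)
    have "C * norm (u - x) * norm (u - x) \<le> e * norm (u - x)" using elim by (intro mult_right_mono) auto
    then have "ereal (c + v \<bullet> (u - x) - e * norm (u - x)) \<le> ereal (c + v \<bullet> (u - x) - C * (norm (u - x))\<^sup>2)"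
      by (simp add: power2_eq_square mult.assoc)
    also have "\<dots> \<le> \<phi> u" by (rule v)
    finally show ?case .
  qed
qed

text \<open>Expanding the square around \<open>u\<close> turns
  \<open>(1/\<alpha>) *\<^sub>R (c - u)\<close> into a proximal subgradient relative to
  \<open>S\<close>. Since \<open>\<phi>\<close> need not be convex, the quadratic term
  remains.\<close>

lemma prox_on_inequality:
  fixes u c :: "'a::real_inner"
  assumes u: "u \<in> prox_on S (\<lambda>z. ereal \<alpha> * \<phi> z) c" and \<alpha>: "\<alpha> > 0"
    and proper: "\<And>z. z \<in> S \<Longrightarrow> \<phi> z \<noteq> -\<infinity>" and w0: "w0 \<in> S" "\<phi> w0 < \<infinity>"
  shows "u \<in> S" "\<bar>\<phi> u\<bar> \<noteq> \<infinity>"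
    "\<And>w. w \<in> S \<Longrightarrow> ereal (real_of_ereal (\<phi> u) + ((1/\<alpha>) *\<^sub>R (c - u)) \<bullet> (w - u) - 1/(2*\<alpha>) * (norm (w - u))\<^sup>2) \<le> \<phi> w"
proof -
  show uS: "u \<in> S" using u by (auto simp: prox_on_def is_arg_min_def)
  have min: "ereal \<alpha> * \<phi> u + ereal (1/2 * (norm (u - c))\<^sup>2) \<le> ereal \<alpha> * \<phi> w + ereal (1/2 * (norm (w - c))\<^sup>2)"
    if "w \<in> S" for w
    using u that by (auto simp: prox_on_def is_arg_min_def not_less)
  show fin: "\<bar>\<phi> u\<bar> \<noteq> \<infinity>"
    using min[OF w0(1)] proper[OF uS] proper[OF w0(1)] w0(2) \<alpha>
    by (cases "\<phi> u"; cases "\<phi> w0") auto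
  then obtain a where a: "\<phi> u = ereal a" by (cases "\<phi> u") auto
  fix w assume w: "w \<in> S"
  show "ereal (real_of_ereal (\<phi> u) + ((1/\<alpha>) *\<^sub>R (c - u)) \<bullet> (w - u) - 1/(2*\<alpha>) * (norm (w - u))\<^sup>2) \<le> \<phi> w"
  proof (cases "\<phi> w")
    case (real b)
    have "w - c = (w - u) + (u - c)" by simp
    then have n: "(norm (w - c))\<^sup>2 = (norm (w - u))\<^sup>2 + 2 * ((w - u) \<bullet> (u - c)) + (norm (u - c))\<^sup>2"
      unfolding power2_norm_eq_inner by (simp only: inner_add_left inner_add_right inner_commute)
    have "\<alpha> * a + 1/2 * (norm (u - c))\<^sup>2 \<le> \<alpha> * b + 1/2 * (norm (w - c))\<^sup>2"
      using min[OF w] by (simp add: a real)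
    then have "\<alpha> * a \<le> \<alpha> * b + 1/2 * (norm (w - u))\<^sup>2 - (w - u) \<bullet> (c - u)"
      unfolding n by (simp add: inner_diff_right algebra_simps)
    then have "a \<le> b + (1/(2*\<alpha>) * (norm (w - u))\<^sup>2 - (1/\<alpha>) * ((w - u) \<bullet> (c - u)))"
      using \<alpha> by (simp add: field_simps)
    then show ?thesis by (simp add: a real inner_commute)
  qed (use proper[OF w] in auto)
qed

text \<open>Balls of half the admissible radius cover \<open>K\<close>. A point closer to
  \<open>x\<close> than every half radius still lies in the full ball around the centre whose half
  ball contains \<open>x\<close>.\<close>

lemma uniform_lipschitz_on_compact:
  fixes F :: "'a::metric_space \<Rightarrow> 'b::metric_space"
  assumes K: "compact K" "K \<subseteq> S"
    and loc: "\<forall>x\<in>K. \<exists>U L. open U \<and> x \<in> U \<and> L-lipschitz_on (U \<inter> S) F"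
  obtains r L where "r > 0" "L \<ge> 0"
    "\<And>x u. x \<in> K \<Longrightarrow> u \<in> S \<Longrightarrow> dist u x < r \<Longrightarrow> dist (F u) (F x) \<le> L * dist u x"
proof -
  have "\<forall>x\<in>K. \<exists>d L. d > 0 \<and> L-lipschitz_on (ball x (2 * d) \<inter> S) F"
  proof
    fix x assume "x \<in> K"
    then obtain U L where U: "open U" "x \<in> U" "L-lipschitz_on (U \<inter> S) F" using loc by blast
    then obtain e where e: "e > 0" "ball x e \<subseteq> U" by (meson openE)
    have "L-lipschitz_on (ball x (2 * (e/2)) \<inter> S) F"
      using U(3) by (rule lipschitz_on_subset) (use e in auto)
    with e show "\<exists>d L. d > 0 \<and> L-lipschitz_on (ball x (2 * d) \<inter> S) F"
      by (intro exI[of _ "e/2"] exI[of _ L]) simp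
  qed
  then obtain d L where dL': "\<forall>x\<in>K. d x > 0 \<and> (L x)-lipschitz_on (ball x (2 * d x) \<inter> S) F"
    unfolding bchoice_iff by blast
  then have dL: "\<And>x. x \<in> K \<Longrightarrow> d x > 0"
    "\<And>x. x \<in> K \<Longrightarrow> (L x)-lipschitz_on (ball x (2 * d x) \<inter> S) F" by blast+
  obtain C where C: "C \<subseteq> K" "finite C" "K \<subseteq> (\<Union>c\<in>C. ball c (d c))"
    by (rule compactE_image[OF K(1), of K "\<lambda>c. ball c (d c)"]) (use dL in auto)
  \<comment> \<open>The inserted 1, and 0 in \<open>M\<close>, provide a value when the cover is
    empty; the 0 also makes \<open>M\<close> nonnegative.\<close>
  define r where "r = Min (insert 1 (d ` C))"
  define M where "M = Max (insert 0 (L ` C))"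
  show thesis
  proof (rule that)
    show "r > 0" unfolding r_def using C dL by (subst Min_gr_iff) auto
    show "M \<ge> 0" unfolding M_def using C by auto
    fix x u assume x: "x \<in> K" and u: "u \<in> S" "dist u x < r"
    then obtain c where c: "c \<in> C" "x \<in> ball c (d c)" using C by blast
    have cK: "c \<in> K" using c C by auto
    have "r \<le> d c" unfolding r_def using c C by auto
    then have "dist c u < 2 * d c"
      using c u dist_triangle[of c u x] by (simp add: dist_commute)
    moreover have "dist c x < 2 * d c" using c dL(1)[OF cK] by simp
    ultimately have "dist (F u) (F x) \<le> L c * dist u x"
      using lipschitz_onD[OF dL(2)[OF cK], of u x] x u K by auto
    also have "\<dots> \<le> M * dist u x"
      unfolding M_def using c C by (intro mult_right_mono Max_ge) auto
    finally show "dist (F u) (F x) \<le> M * dist u x" .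
  qed
qed

text \<open>Mean value theorem along the segment. It gives \<open>L\<close> where integration would
  give \<open>L / 2\<close>; any constant serves the later estimates.\<close>

lemma gradient_lipschitz_bound:
  fixes h :: "'a::real_inner \<Rightarrow> real"
  assumes deriv: "\<And>u. norm (u - x) < r \<Longrightarrow> GDERIV h u :> d u"
    and lip: "\<And>u. norm (u - x) < r \<Longrightarrow> norm (d u - d x) \<le> L * norm (u - x)"
    and L: "L \<ge> 0" and u: "norm (u - x) < r"
  shows "\<bar>h u - h x - d x \<bullet> (u - x)\<bar> \<le> L * (norm (u - x))\<^sup>2"
proof -
  define \<gamma> where "\<gamma> t = x + t *\<^sub>R (u - x)" for t :: real
  have near: "norm (\<gamma> t - x) \<le> norm (u - x)" if "0 \<le> t" "t \<le> 1" for t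
    using that by (simp add: \<gamma>_def mult_left_le_one_le)
  have D: "((\<lambda>t. h (\<gamma> t)) has_derivative (\<lambda>s. (s *\<^sub>R (u - x)) \<bullet> d (\<gamma> t))) (at t within {0..1})"
    if "0 \<le> t" "t \<le> 1" for t
  proof -
    have "GDERIV h (\<gamma> t) :> d (\<gamma> t)" using near[OF that] u by (intro deriv) simp
    then have h: "(h has_derivative (\<lambda>v. v \<bullet> d (\<gamma> t))) (at (\<gamma> t))" by (simp add: gderiv_def)
    have g: "(\<gamma> has_derivative (\<lambda>s. s *\<^sub>R (u - x))) (at t within {0..1})"
      unfolding \<gamma>_def by (auto intro!: derivative_eq_intros)
    show ?thesis using has_derivative_compose[OF g h] .
  qed
  have "\<exists>t\<in>{0<..<1}. h (\<gamma> 1) - h (\<gamma> 0) = ((1 - 0) *\<^sub>R (u - x)) \<bullet> d (\<gamma> t)"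
    by (rule mvt_simple[of 0 1 "\<lambda>t. h (\<gamma> t)" "\<lambda>t s. (s *\<^sub>R (u - x)) \<bullet> d (\<gamma> t)"]) (use D in auto)
  then obtain t where t: "0 < t" "t < 1" "h u - h x = (u - x) \<bullet> d (\<gamma> t)"
    by (auto simp: \<gamma>_def)
  have "\<bar>h u - h x - d x \<bullet> (u - x)\<bar> = \<bar>(u - x) \<bullet> (d (\<gamma> t) - d x)\<bar>"
    by (simp add: t(3) inner_diff_right inner_commute)
  also have "\<dots> \<le> norm (u - x) * norm (d (\<gamma> t) - d x)" by (rule Cauchy_Schwarz_ineq2)
  also have "\<dots> \<le> norm (u - x) * (L * norm (\<gamma> t - x))"
    using near[of t] t u by (intro mult_left_mono lip) auto
  also have "\<dots> \<le> norm (u - x) * (L * norm (u - x))"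
    using near[of t] t L by (intro mult_left_mono) auto
  finally show ?thesis by (simp add: power2_eq_square mult_ac)
qed

lemma calm_continuous_on_conj_real:
  fixes g :: "'a::real_inner \<Rightarrow> real"
  assumes calm: "calm_on (edom (conj_fun g)) (conj_fun g)"
  shows "continuous_on (edom (conj_fun g)) (conj_real g)"
  unfolding continuous_on_iff
proof (intro ballI allI impI)
  fix x and e :: real assume x: "x \<in> edom (conj_fun g)" and e: "e > 0"
  obtain \<kappa> U where U: "\<kappa> > 0" "open U" "x \<in> U"
    "\<forall>u\<in>U \<inter> edom (conj_fun g). \<bar>conj_fun g u - conj_fun g x\<bar> \<le> ereal (\<kappa> * norm (u - x))"
    using calm x unfolding calm_on_def by blast
  obtain d where d: "d > 0" "ball x d \<subseteq> U" using U by (meson openE)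
  show "\<exists>d>0. \<forall>x'\<in>edom (conj_fun g). dist x' x < d \<longrightarrow> dist (conj_real g x') (conj_real g x) < e"
  proof (intro exI[of _ "min d (e/\<kappa>)"] conjI ballI impI)
    show "min d (e/\<kappa>) > 0" using d e U by simp
    fix u assume u: "u \<in> edom (conj_fun g)" "dist u x < min d (e/\<kappa>)"
    then have "u \<in> U" using d by (auto simp: dist_commute)
    then have "\<bar>conj_fun g u - conj_fun g x\<bar> \<le> ereal (\<kappa> * norm (u - x))"
      using U(4) u by blast
    then have "\<bar>conj_real g u - conj_real g x\<bar> \<le> \<kappa> * norm (u - x)"
      by (simp add: conj_fun_real[OF u(1)] conj_fun_real[OF x])
    also have "\<dots> < e" using u U by (simp add: dist_norm field_simps)
    finally show "dist (conj_real g u) (conj_real g x) < e" by (simp add: dist_real_def)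
  qed
qed

section \<open>Differentiability of extended-valued functions and the quotient rule\<close>

lemma ediff_at_finite:
  assumes "ediff_at h x"
  shows "\<bar>h x\<bar> \<noteq> \<infinity>"
  using eventually_nhds_x_imp_x[OF conjunct1[OF assms[unfolded ediff_at_def]]] .

lemma ediff_at_GDERIV:
  assumes "ediff_at h x"
  shows "GDERIV (\<lambda>z. real_of_ereal (h z)) x :> egrad h x"
proof -
  obtain v where v: "GDERIV (\<lambda>z. real_of_ereal (h z)) x :> v" using assms by (auto simp: ediff_at_def)
  have "w = v" if "GDERIV (\<lambda>z. real_of_ereal (h z)) x :> w" for w
  proof -
    have "(\<lambda>u. u \<bullet> w) = (\<lambda>u. u \<bullet> v)"
      using that v unfolding gderiv_def by (rule has_derivative_unique)
    then have "(w - v) \<bullet> w = (w - v) \<bullet> v" by metis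
    then have "(w - v) \<bullet> (w - v) = 0" by (simp add: inner_diff_right)
    then show ?thesis by simp
  qed
  with v show ?thesis unfolding egrad_def by (metis theI)
qed

lemma ediff_at_expansion:
  assumes "ediff_at h x" "e > 0"
  shows "\<forall>\<^sub>F u in nhds x. \<bar>h u\<bar> \<noteq> \<infinity> \<and>
    \<bar>real_of_ereal (h u) - real_of_ereal (h x) - egrad h x \<bullet> (u - x)\<bar> \<le> e * norm (u - x)"
proof -
  have "((\<lambda>z. real_of_ereal (h z)) has_derivative (\<lambda>v. v \<bullet> egrad h x)) (at x)"
    using ediff_at_GDERIV[OF assms(1)] by (simp add: gderiv_def)
  then obtain d where d: "d > 0" "\<And>u. norm (u - x) < d \<Longrightarrow>
     norm (real_of_ereal (h u) - real_of_ereal (h x) - (u - x) \<bullet> egrad h x) \<le> e * norm (u - x)"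
    unfolding has_derivative_at_alt using assms(2) by blast
  have "\<forall>\<^sub>F u in nhds x. dist u x < d" using d by (auto simp: eventually_nhds_metric)
  moreover have "\<forall>\<^sub>F u in nhds x. \<bar>h u\<bar> \<noteq> \<infinity>" using assms by (simp add: ediff_at_def)
  ultimately show ?thesis
    by eventually_elim (use d(2) in \<open>auto simp: dist_norm inner_commute\<close>)
qed

text \<open>A proximal subgradient \<open>v\<close> of \<open>f\<close> at \<open>x\<close> and a point \<open>\<xi>\<close> with \<open>y \<in> \<partial>g(\<xi>)\<close>, that is
  \<open>\<xi> \<in> \<partial>g\<^sup>*(y)\<close>, combine by the quotient rule.  Calmness makes the denominator continuous
  on the domain.\<close>

lemma merit_Q_frechet:
  fixes f h :: "'a::euclidean_space \<Rightarrow> ereal" and g :: "'a \<Rightarrow> real"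
  assumes f_proper: "\<And>u. f u \<noteq> -\<infinity>" and h_proper: "\<And>u. h u \<noteq> -\<infinity>"
    and calm: "calm_on (edom (conj_fun g)) (conj_fun g)"
    and x: "f x = ereal fx" and h: "ediff_at h x"
    and y: "y \<in> subgradients g \<xi>"
    and eta: "eta_real g x y > 0"
    and Q: "Q = (fx + real_of_ereal (h x)) / eta_real g x y" "Q \<ge> 0"
    and C: "C \<ge> 0"
    and v: "\<And>u. ereal (fx + v \<bullet> (u - x) - C * (norm (u - x))\<^sup>2) \<le> f u"
  shows "((1 / eta_real g x y) *\<^sub>R (v + egrad h x - Q *\<^sub>R y), (Q / eta_real g x y) *\<^sub>R (\<xi> - x))
    \<in> frechet_subdiff (merit_Q f g h) (x, y)"
proof -
  define D where "D = edom (conj_fun g)"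
  define E where "E = eta_real g x y"
  define a where "a = v + egrad h x - Q *\<^sub>R y"
  define hx where "hx = real_of_ereal (h x)"
  have yD: "y \<in> D" using conj_fun_subgradient[OF y] by (simp add: D_def)
  have hfin: "h x = ereal hx" using ediff_at_finite[OF h] by (cases "h x") (auto simp: hx_def)
  have E: "E > 0" using eta by (simp add: E_def)
  have QE: "Q * E = fx + hx" using Q E by (simp add: E_def hx_def)
  have Qxy: "merit_Q f g h (x, y) = ereal Q"
    using x hfin yD E eta_eq_real[of y g x]
    by (simp add: merit_Q_def edom_def D_def zeta_def Q(1) hx_def[symmetric] E_def[symmetric])
  \<comment> \<open>\<open>E\<close> times the claimed subgradient: the linear part of a lower
    expansion, at \<open>(x, y)\<close>, of \<zeta> minus \<open>Q\<close> times \<eta>, which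
    vanishes there.\<close>
  define lin where "lin z = a \<bullet> (fst z - x) + Q * ((\<xi> - x) \<bullet> (snd z - y))" for z :: "'a \<times> 'a"
  define A where "A = norm a + Q * norm (\<xi> - x)"
  have A0: "A \<ge> 0" using Q(2) by (simp add: A_def)
  have norms: "norm (fst z - x) \<le> norm (z - (x, y))" "norm (snd z - y) \<le> norm (z - (x, y))" for z
    using norm_fst_le[of "fst z - x" "snd z - y"] norm_snd_le[of "snd z - y" "fst z - x"]
    by (simp_all add: minus_prod_def)
  have lin_le: "\<bar>lin z\<bar> \<le> A * norm (z - (x, y))" for z
  proof -
    have "\<bar>lin z\<bar> \<le> \<bar>a \<bullet> (fst z - x)\<bar> + \<bar>Q * ((\<xi> - x) \<bullet> (snd z - y))\<bar>" by (simp add: lin_def)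
    also have "\<dots> \<le> norm a * norm (fst z - x) + Q * (norm (\<xi> - x) * norm (snd z - y))"
      using Q(2) Cauchy_Schwarz_ineq2[of a "fst z - x"] Cauchy_Schwarz_ineq2[of "\<xi> - x" "snd z - y"]
      by (auto simp: abs_mult intro!: add_mono mult_left_mono)
    also have "\<dots> \<le> norm a * norm (z - (x, y)) + Q * (norm (\<xi> - x) * norm (z - (x, y)))"
      using Q(2) norms by (intro add_mono mult_left_mono norms) auto
    finally show ?thesis by (simp add: A_def algebra_simps)
  qed
  \<comment> \<open>With \<open>E'\<close> the denominator at \<open>z\<close>, the increment
    \<open>(fu + hu) / E' - Q\<close> equals \<open>(fu + hu - Q * E') / E'\<close>. So a lower
    expansion of the numerator suffices, and no quotient has to be differentiated.\<close>
  have num: "lin z - ((C + Q) * norm (z - (x, y)) + e) * norm (z - (x, y)) \<le> fu + hu - Q * eta_real g (fst z) (snd z)"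
    if fu: "f (fst z) = ereal fu" and w: "snd z \<in> D" and
      hu: "\<bar>hu - hx - egrad h x \<bullet> (fst z - x)\<bar> \<le> e * norm (fst z - x)" and e: "e \<ge> 0"
    for z fu hu e
  proof -
    define n where "n = norm (z - (x, y))"
    define u where "u = fst z - x"
    define s where "s = snd z - y"
    have n: "norm u \<le> n" "norm s \<le> n" "n \<ge> 0" using norms by (auto simp: n_def u_def s_def)
    have 1: "fx + v \<bullet> u - C * (norm u)\<^sup>2 \<le> fu" using v[of "fst z"] fu by (simp add: u_def)
    have 2: "hx + egrad h x \<bullet> u - e * norm u \<le> hu" using hu by (simp add: u_def abs_le_iff)
    \<comment> \<open>The subgradient \<open>\<xi>\<close> of the conjugate bounds
      \<open>eta_real\<close> from above, and \<open>Q \<ge> 0\<close> allows multiplying by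
      \<open>Q\<close>. The bilinear remainder \<open>u \<bullet> s\<close> is of second
      order.\<close>
    have 3: "eta_real g (fst z) (snd z) \<le> E + u \<bullet> y + (x - \<xi>) \<bullet> s + u \<bullet> s"
    proof -
      have "conj_real g y + \<xi> \<bullet> s \<le> conj_real g (snd z)"
        using conj_real_subgradient_ineq[OF y] w by (simp add: D_def s_def)
      moreover have "fst z \<bullet> snd z = x \<bullet> y + u \<bullet> y + x \<bullet> s + u \<bullet> s"
        by (simp add: u_def s_def inner_diff_left inner_diff_right)
      ultimately show ?thesis by (simp add: eta_real_def E_def inner_diff_left)
    qed
    have 4: "u \<bullet> s \<le> n * n"
      using norm_cauchy_schwarz[of u s] mult_mono[OF n(1,2)] n by force
    have "Q * eta_real g (fst z) (snd z) \<le> Q * (E + u \<bullet> y + (x - \<xi>) \<bullet> s + n * n)"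
      using 3 4 Q(2) by (intro mult_left_mono) auto
    moreover have "C * (norm u)\<^sup>2 \<le> C * (n * n)"
      using C n by (intro mult_left_mono) (auto simp: power2_eq_square intro: mult_mono)
    moreover have "e * norm u \<le> e * n" using n e by (intro mult_left_mono)
    moreover have "lin z = v \<bullet> u + egrad h x \<bullet> u - Q * (u \<bullet> y) - Q * ((x - \<xi>) \<bullet> s)"
      by (simp add: lin_def a_def u_def s_def inner_add_left inner_diff_left inner_diff_right
          inner_commute algebra_simps)
    ultimately show ?thesis using 1 2 QE unfolding n_def[symmetric] by (simp add: algebra_simps)
  qed
  have cont: "((\<lambda>z. eta_real g (fst z) (snd z)) \<longlongrightarrow> E) (at (x, y) within UNIV \<times> D)"
  proof -
    have "continuous_on (UNIV \<times> D) (\<lambda>z. eta_real g (fst z) (snd z))"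
      unfolding eta_real_def
      by (intro continuous_intros continuous_on_compose2[OF calm_continuous_on_conj_real[OF calm], of _ snd])
        (auto simp: D_def)
    then show ?thesis using yD by (force simp: continuous_on E_def)
  qed
  have goal: "\<forall>\<^sub>F z in at (x, y). ereal (Q + ((1 / E) *\<^sub>R a, (Q / E) *\<^sub>R (\<xi> - x)) \<bullet> (z - (x, y)) - e * norm (z - (x, y)))
      \<le> merit_Q f g h z" if e: "e > 0" for e
  proof -
    \<comment> \<open>Two errors of at most \<open>e1 * n\<close> each, over a denominator above
      \<open>E / 2\<close>, cost \<open>e / 2 * n\<close>. The other half of \<open>e\<close> pays
      for replacing \<open>1 / E'\<close> by \<open>1 / E\<close>.\<close>
    define e1 where "e1 = e * E / 8"
    have e1: "e1 > 0" using e E by (simp add: e1_def)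
    have near: "\<forall>\<^sub>F z in at (x, y). (C + Q) * norm (z - (x, y)) < e1"
    proof -
      have "((\<lambda>z. (C + Q) * norm (z - (x, y))) \<longlongrightarrow> (C + Q) * norm ((x, y) - (x, y))) (at (x, y))"
        by (intro tendsto_intros)
      then show ?thesis using e1 by (intro order_tendstoD(2)) auto
    qed
    have hev: "\<forall>\<^sub>F z in at (x, y). \<bar>h (fst z)\<bar> \<noteq> \<infinity> \<and>
      \<bar>real_of_ereal (h (fst z)) - hx - egrad h x \<bullet> (fst z - x)\<bar> \<le> e1 * norm (fst z - x)"
    proof -
      have "filterlim fst (nhds x) (at (x, y))"
        using tendsto_fst[OF tendsto_ident_at[of "(x, y)" UNIV]] by simp
      with ediff_at_expansion[OF h e1] show ?thesis
        unfolding hx_def by (rule eventually_compose_filterlim)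
    qed
    \<comment> \<open>Calmness controls the denominator on \<open>D\<close> only. Off
      \<open>D\<close> the merit function is infinite, and the inequality is trivial.\<close>
    have "\<forall>\<^sub>F z in at (x, y) within UNIV \<times> D. eta_real g (fst z) (snd z) > E / 2 \<and>
       A * \<bar>1 / eta_real g (fst z) (snd z) - 1 / E\<bar> < e / 2"
    proof (intro eventually_conj)
      show "\<forall>\<^sub>F z in at (x, y) within UNIV \<times> D. eta_real g (fst z) (snd z) > E / 2"
        using cont E by (intro order_tendstoD) auto
      have "((\<lambda>z. A * \<bar>1 / eta_real g (fst z) (snd z) - 1 / E\<bar>) \<longlongrightarrow> A * \<bar>1 / E - 1 / E\<bar>) (at (x, y) within UNIV \<times> D)"
        using cont E by (intro tendsto_intros) auto
      then show "\<forall>\<^sub>F z in at (x, y) within UNIV \<times> D. A * \<bar>1 / eta_real g (fst z) (snd z) - 1 / E\<bar> < e / 2"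
        using e by (intro order_tendstoD(2)) auto
    qed
    then have "\<forall>\<^sub>F z in at (x, y). snd z \<in> D \<longrightarrow> eta_real g (fst z) (snd z) > E / 2 \<and>
       A * \<bar>1 / eta_real g (fst z) (snd z) - 1 / E\<bar> < e / 2"
      unfolding eventually_at_filter by eventually_elim auto
    with near hev show ?thesis
    proof eventually_elim
      case (elim z)
      show ?case
      proof (cases "fst z \<in> edom f \<and> snd z \<in> D \<and> eta g (fst z) (snd z) > 0")
        case False
        then show ?thesis by (auto simp: merit_Q_def D_def split: prod.splits)
      next
        case True
        define n where "n = norm (z - (x, y))"
        define E' where "E' = eta_real g (fst z) (snd z)"
        obtain fu where fu: "f (fst z) = ereal fu" using True f_proper[of "fst z"]
          by (cases "f (fst z)") (auto simp: edom_def)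
        obtain hu where hu: "h (fst z) = ereal hu" using elim(2) by (cases "h (fst z)") auto
        have E': "E' > E / 2" "A * \<bar>1 / E' - 1 / E\<bar> < e / 2" using elim True by (auto simp: E'_def)
        have E'0: "E' > 0" using E' E by simp
        have Qz: "merit_Q f g h z = ereal ((fu + hu) / E')"
          using True fu hu E'0 eta_eq_real[of "snd z" g "fst z"]
          by (auto simp: merit_Q_def D_def zeta_def E'_def split: prod.splits)
        have "lin z - ((C + Q) * n + e1) * n \<le> fu + hu - Q * E'"
          unfolding E'_def n_def by (rule num) (use True fu hu elim e1 in auto)
        moreover have "((C + Q) * n + e1) * n \<le> (2 * e1) * n"
          using elim(1) by (intro mult_right_mono) (auto simp: n_def)
        ultimately have "(lin z - (2 * e1) * n) / E' \<le> (fu + hu - Q * E') / E'"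
          using E'0 by (intro divide_right_mono) auto
        then have 1: "Q + lin z / E' - (2 * e1) * n / E' \<le> (fu + hu) / E'"
          using E'0 by (simp add: diff_divide_distrib)
        have "(2 * e1) * n / E' \<le> (2 * e1) * n / (E / 2)"
          using E' E e1 by (intro divide_left_mono) (auto simp: n_def)
        also have "\<dots> = e / 2 * n" using E by (simp add: e1_def)
        finally have 2: "(2 * e1) * n / E' \<le> e / 2 * n" .
        have "lin z / E - lin z / E' \<le> \<bar>lin z * (1 / E' - 1 / E)\<bar>"
          by (simp add: algebra_simps)
        also have "\<dots> \<le> (A * n) * \<bar>1 / E' - 1 / E\<bar>"
          unfolding abs_mult using lin_le[of z] by (intro mult_right_mono) (auto simp: n_def)
        also have "\<dots> = (A * \<bar>1 / E' - 1 / E\<bar>) * n" by simp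
        also have "\<dots> \<le> e / 2 * n" using E'(2) by (intro mult_right_mono) (auto simp: n_def)
        finally have 3: "lin z / E - lin z / E' \<le> e / 2 * n" .
        have "((1 / E) *\<^sub>R a, (Q / E) *\<^sub>R (\<xi> - x)) \<bullet> (z - (x, y)) = lin z / E"
          by (simp add: lin_def inner_prod_def add_divide_distrib)
        moreover have "Q + lin z / E - e * n \<le> (fu + hu) / E'" using 1 2 3 by linarith
        ultimately show ?thesis by (simp only: Qz n_def[symmetric] ereal_less_eq(3))
      qed
    qed
  qed
  show ?thesis
    unfolding frechet_subdiff_iff[where \<phi> = "merit_Q f g h" and x = "(x, y)", OF Qxy] using goal by (simp add: E_def a_def)
qed

section \<open>Block-separable fractional programs\<close>

lemma block_proj_linear:
  "block_proj blk i (a + b) = block_proj blk i a + block_proj blk i b"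
  "block_proj blk i (a - b) = block_proj blk i a - block_proj blk i b"
  "block_proj blk i (c *\<^sub>R a) = c *\<^sub>R block_proj blk i a"
  by (auto simp: block_proj_def vec_eq_iff)

lemma block_proj_in_space: "block_proj blk i a \<in> block_space blk i"
  by (simp add: block_proj_def block_space_def)

lemma block_space_diff: "u \<in> block_space blk i \<Longrightarrow> v \<in> block_space blk i \<Longrightarrow> u - v \<in> block_space blk i"
  by (auto simp: block_space_def)

lemma block_proj_inner: "d \<in> block_space blk i \<Longrightarrow> block_proj blk i a \<bullet> d = a \<bullet> d"
  by (auto simp: inner_vec_def block_proj_def block_space_def intro!: sum.cong)

lemma norm_block_proj_le: "norm (block_proj blk i a) \<le> norm a"
  by (rule norm_le_componentwise_cart) (simp add: block_proj_def)

lemma block_replace_eq: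
  assumes "u \<in> block_space blk i"
  shows "block_replace blk i u a = a + (u - block_proj blk i a)"
  using assms by (auto simp: block_replace_def block_proj_def block_space_def vec_eq_iff)

lemma block_proj_replace:
  assumes "u \<in> block_space blk i"
  shows "block_proj blk i (block_replace blk i u a) = u"
    and "j \<noteq> i \<Longrightarrow> block_proj blk j (block_replace blk i u a) = block_proj blk j a"
  using assms by (auto simp: block_replace_def block_proj_def block_space_def vec_eq_iff)

lemma sum_block_proj:
  assumes "range blk = {1..N}"
  shows "(\<Sum>i=1..N. block_proj blk i a) = a"
proof (rule vec_eq_iff[THEN iffD2], rule allI)
  fix j
  have "blk j \<in> {1..N}" using assms by (metis rangeI)
  then show "(\<Sum>i=1..N. block_proj blk i a) $ j = a $ j"
    by (simp add: block_proj_def)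
qed

text \<open>Static data only: the initial point enters through its level set, so the estimates below
  are uniform over a compact set and do not refer to the iterates.\<close>

locale fractional_program =
  fixes f h :: "real ^ 'n::finite \<Rightarrow> ereal"
    and g :: "real ^ 'n \<Rightarrow> real"
    and fs :: "nat \<Rightarrow> real ^ 'n \<Rightarrow> ereal"
    and N :: nat and blk :: "'n \<Rightarrow> nat" and x0 :: "real ^ 'n"
  assumes f_proper: "proper_on UNIV f" and h_proper: "proper_on UNIV h"
    and blocks: "range blk = {1..N}"
    and f_separable: "\<And>z. f z = (\<Sum>i=1..N. fs i (block_proj blk i z))"
    and fs_proper: "\<And>i. i \<in> {1..N} \<Longrightarrow> proper_on (block_space blk i) (fs i)"
    and fs_bounded_below:
      "\<And>i. i \<in> {1..N} \<Longrightarrow> \<exists>c::real. \<forall>z\<in>block_space blk i. ereal c \<le> fs i z"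
    and h_smooth: "loc_lipschitz_differentiable_on (Omega g) h"
    and g_convex: "convex_on UNIV g"
    and g_nonneg: "\<And>z. g z \<ge> 0"
    and zeta_nonneg: "\<And>z. z \<in> edom f \<Longrightarrow> zeta f h z \<ge> 0"
    and x0: "x0 \<in> edom (obj_F f g h)"
    and X_compact: "compact (level_X f g h x0)"
    and f_loc_lipschitz: "locally_lipschitz_on (level_X f g h x0) f"
begin

abbreviation "X \<equiv> level_X f g h x0"
abbreviation "D \<equiv> edom (conj_fun g)"
abbreviation "P \<equiv> block_proj blk"
definition "fr z = real_of_ereal (f z)"
definition "hr z = real_of_ereal (h z)"
definition "fsr i z = real_of_ereal (fs i z)"
definition "Z z = fr z + hr z"
definition "F0 = Z x0 / g x0"

lemma f_not_MInf: "f z \<noteq> -\<infinity>" and h_not_MInf: "h z \<noteq> -\<infinity>"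
  using f_proper h_proper by (auto simp: proper_on_def)

lemma f_real: "z \<in> edom f \<Longrightarrow> f z = ereal (fr z)"
  using f_not_MInf[of z] by (cases "f z") (auto simp: edom_def fr_def)

lemma h_ediff: "z \<in> Omega g \<Longrightarrow> ediff_at h z"
  using h_smooth by (auto simp: loc_lipschitz_differentiable_on_def)

lemma h_real: "z \<in> Omega g \<Longrightarrow> h z = ereal (hr z)"
  using ediff_at_finite[OF h_ediff[of z]] by (cases "h z") (auto simp: hr_def)

lemma zeta_real: "z \<in> edom f \<Longrightarrow> z \<in> Omega g \<Longrightarrow> zeta f h z = ereal (Z z)"
  by (simp add: zeta_def f_real h_real Z_def)

lemma Z_nonneg: "z \<in> edom f \<Longrightarrow> z \<in> Omega g \<Longrightarrow> Z z \<ge> 0"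
  using zeta_nonneg[of z] by (simp add: zeta_real)

lemma g_pos: "z \<in> Omega g \<Longrightarrow> g z > 0"
  using g_nonneg[of z] by (simp add: Omega_def)

lemma obj_F_real: "z \<in> edom f \<Longrightarrow> z \<in> Omega g \<Longrightarrow> obj_F f g h z = ereal (Z z / g z)"
  using g_pos[of z] by (simp add: obj_F_def zeta_real)

lemma edom_obj_F: "edom (obj_F f g h) = edom f \<inter> Omega g"
  by (auto simp: edom_def obj_F_def split: if_splits)
    (use obj_F_real in \<open>auto simp: obj_F_def edom_def\<close>)

lemma x0_dom: "x0 \<in> edom f" "x0 \<in> Omega g"
  using x0 by (auto simp: edom_obj_F)

lemma X_iff: "z \<in> X \<longleftrightarrow> z \<in> edom f \<and> z \<in> Omega g \<and> Z z / g z \<le> F0"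
proof (cases "z \<in> edom f \<and> z \<in> Omega g")
  case True
  then show ?thesis using x0_dom by (simp add: level_X_def obj_F_real F0_def)
next
  case False
  then have "obj_F f g h z = \<infinity>" by (auto simp: obj_F_def)
  then show ?thesis using False x0_dom by (auto simp: level_X_def obj_F_real)
qed

lemma X_dom: "z \<in> X \<Longrightarrow> z \<in> edom f" "z \<in> X \<Longrightarrow> z \<in> Omega g"
  by (auto simp: X_iff)

lemma x0_X: "x0 \<in> X" by (simp add: level_X_def)

lemma F0_nonneg: "F0 \<ge> 0"
  using Z_nonneg[OF x0_dom] g_pos[OF x0_dom(2)] by (simp add: F0_def)

lemma eta_pos_Omega: "w \<in> D \<Longrightarrow> eta_real g z w > 0 \<Longrightarrow> z \<in> Omega g"
  using eta_real_le[of w g z] by (simp add: Omega_def)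

lemma merit_real:
  assumes "z \<in> edom f" "w \<in> D" "eta_real g z w > 0"
  shows "merit_Q f g h (z, w) = ereal (Z z / eta_real g z w)"
  using assms zeta_real[OF assms(1) eta_pos_Omega[OF assms(2,3)]] eta_eq_real[OF assms(2)]
  by (simp add: merit_Q_def)

lemma g_continuous: "continuous_on UNIV g"
  by (rule convex_on_continuous[OF open_UNIV g_convex])

lemma Omega_open: "open (Omega g)"
proof -
  have "Omega g = g -` (- {0})" by (auto simp: Omega_def)
  then show ?thesis using g_continuous by (auto intro!: open_vimage)
qed

section \<open>Uniform bounds on the compact level set\<close>

lemma g_lower_bound: obtains c where "c > 0" "\<And>z. z \<in> X \<Longrightarrow> c \<le> g z"
proof -
  have "\<exists>z\<in>X. \<forall>w\<in>X. g z \<le> g w"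
    using X_compact x0_X g_continuous by (intro continuous_attains_inf) (auto intro: continuous_on_subset)
  then obtain z where "z \<in> X" "\<forall>w\<in>X. g z \<le> g w" by blast
  then show thesis using g_pos[OF X_dom(2)] by (intro that[of "g z"]) auto
qed

lemma fs_not_MInf: "i \<in> {1..N} \<Longrightarrow> z \<in> block_space blk i \<Longrightarrow> fs i z \<noteq> -\<infinity>"
  using fs_proper[of i] by (auto simp: proper_on_def)

lemma fs_finite:
  assumes "z \<in> edom f" "i \<in> {1..N}"
  shows "fs i (P i z) = ereal (fsr i (P i z))"
proof -
  have "fs i (P i z) \<noteq> \<infinity>"
  proof
    assume "fs i (P i z) = \<infinity>"
    then have "(\<Sum>i=1..N. fs i (P i z)) = \<infinity>" using assms(2) by (subst sum_Pinfty) auto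
    with assms(1) f_separable[of z] show False by (simp add: edom_def)
  qed
  with fs_not_MInf[OF assms(2) block_proj_in_space] show ?thesis by (cases "fs i (P i z)") (auto simp: fsr_def)
qed

lemma fr_sum:
  assumes "z \<in> edom f"
  shows "fr z = (\<Sum>i=1..N. fsr i (P i z))"
proof -
  have "f z = (\<Sum>i=1..N. ereal (fsr i (P i z)))"
    unfolding f_separable[of z] using fs_finite[OF assms] by (intro sum.cong) auto
  then show ?thesis by (simp add: fr_def)
qed

lemma fr_uniform_lipschitz:
  obtains r L where "r > 0" "L \<ge> 0"
    "\<And>z u. z \<in> X \<Longrightarrow> u \<in> X \<Longrightarrow> norm (u - z) < r \<Longrightarrow> \<bar>fr u - fr z\<bar> \<le> L * norm (u - z)"
proof -
  have "\<forall>z\<in>X. \<exists>U L. open U \<and> z \<in> U \<and> L-lipschitz_on (U \<inter> X) fr"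
    using f_loc_lipschitz by (simp add: locally_lipschitz_on_def fr_def[abs_def])
  from uniform_lipschitz_on_compact[OF X_compact order_refl this] that show thesis
    by (metis dist_norm dist_real_def)
qed

lemma fr_continuous: "continuous_on X fr"
  unfolding continuous_on_iff
proof (intro ballI allI impI)
  fix z and e :: real assume z: "z \<in> X" and e: "e > 0"
  obtain r L where L: "r > 0" "L \<ge> 0"
    "\<And>z u. z \<in> X \<Longrightarrow> u \<in> X \<Longrightarrow> norm (u - z) < r \<Longrightarrow> \<bar>fr u - fr z\<bar> \<le> L * norm (u - z)"
    using fr_uniform_lipschitz by blast
  show "\<exists>d>0. \<forall>u\<in>X. dist u z < d \<longrightarrow> dist (fr u) (fr z) < e"
  proof (intro exI[of _ "min r (e / (L + 1))"] conjI ballI impI)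
    show "min r (e / (L + 1)) > 0" using L e by simp
    fix u assume u: "u \<in> X" "dist u z < min r (e / (L + 1))"
    have "\<bar>fr u - fr z\<bar> \<le> L * norm (u - z)" using L(3)[OF z u(1)] u by (simp add: dist_norm)
    also have "\<dots> \<le> (L + 1) * norm (u - z)" by (intro mult_right_mono) auto
    also have "\<dots> < e" using u(2) L(2) by (simp add: dist_norm field_simps)
    finally show "dist (fr u) (fr z) < e" by (simp add: dist_real_def)
  qed
qed

lemma fr_bounded: obtains B where "\<And>z. z \<in> X \<Longrightarrow> \<bar>fr z\<bar> \<le> B"
proof -
  have "bounded (fr ` X)" by (intro compact_imp_bounded compact_continuous_image fr_continuous X_compact)
  then show thesis using that by (auto simp: bounded_iff)
qed

lemma h_uniform_smooth:
  obtains r L where "r > 0" "L \<ge> 0"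
    "\<And>z u. z \<in> X \<Longrightarrow> norm (u - z) < r \<Longrightarrow> u \<in> Omega g"
    "\<And>z u. z \<in> X \<Longrightarrow> norm (u - z) < r \<Longrightarrow> norm (egrad h u - egrad h z) \<le> L * norm (u - z)"
    "\<And>z u. z \<in> X \<Longrightarrow> norm (u - z) < r \<Longrightarrow>
       \<bar>hr u - hr z - egrad h z \<bullet> (u - z)\<bar> \<le> L * (norm (u - z))\<^sup>2"
proof -
  have XO: "X \<subseteq> Omega g" using X_dom by auto
  have "\<forall>z\<in>X. \<exists>U L. open U \<and> z \<in> U \<and> L-lipschitz_on (U \<inter> Omega g) (egrad h)"
    using h_smooth XO by (auto simp: loc_lipschitz_differentiable_on_def)
  then obtain r1 L where r1: "r1 > 0" "L \<ge> 0"
    "\<And>z u. z \<in> X \<Longrightarrow> u \<in> Omega g \<Longrightarrow> dist u z < r1 \<Longrightarrow> dist (egrad h u) (egrad h z) \<le> L * dist u z"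
    using uniform_lipschitz_on_compact[OF X_compact XO] by blast
  \<comment> \<open>Keeps the segments from points of \<open>X\<close> inside
    \<open>Omega g\<close>, where \<open>h\<close> is differentiable, as the mean value estimate
    requires.\<close>
  obtain r2 where r2: "r2 > 0" "(\<Union>z\<in>X. ball z r2) \<subseteq> Omega g"
    using compact_subset_open_imp_ball_epsilon_subset[OF X_compact Omega_open XO] .
  define r where "r = min r1 r2"
  have O: "u \<in> Omega g" if "z \<in> X" "norm (u - z) < r" for z u
    using r2(2) that by (force simp: r_def dist_norm norm_minus_commute)
  have lip: "norm (egrad h u - egrad h z) \<le> L * norm (u - z)" if "z \<in> X" "norm (u - z) < r" for z u
    using r1(3)[OF that(1) O[OF that]] that by (simp add: r_def dist_norm)
  have "\<bar>hr u - hr z - egrad h z \<bullet> (u - z)\<bar> \<le> L * (norm (u - z))\<^sup>2"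
    if "z \<in> X" "norm (u - z) < r" for z u
    by (rule gradient_lipschitz_bound[OF _ lip[OF that(1)] r1(2) that(2)])
      (use ediff_at_GDERIV[OF h_ediff[OF O[OF that(1)]]] in \<open>auto simp: hr_def[abs_def]\<close>)
  with that[of r L] r1 r2 O lip show thesis by (simp add: r_def)
qed

lemma egrad_continuous: "continuous_on X (egrad h)"
proof (rule continuous_on_subset)
  show "continuous_on (Omega g) (egrad h)"
    unfolding continuous_on_eq_continuous_at[OF Omega_open]
  proof
    fix z assume z: "z \<in> Omega g"
    then obtain U L where U: "open U" "z \<in> U" "L-lipschitz_on (U \<inter> Omega g) (egrad h)"
      using h_smooth by (auto simp: loc_lipschitz_differentiable_on_def)
    show "isCont (egrad h) z"
      using lipschitz_on_continuous_on[OF U(3)] U z Omega_open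
      by (simp add: continuous_on_eq_continuous_at open_Int)
  qed
  show "X \<subseteq> Omega g" using X_dom by auto
qed

lemma egrad_bounded: obtains M where "M \<ge> 0" "\<And>z. z \<in> X \<Longrightarrow> norm (egrad h z) \<le> M"
proof -
  have "bounded (egrad h ` X)" by (intro compact_imp_bounded compact_continuous_image egrad_continuous X_compact)
  then obtain M where M: "\<And>z. z \<in> X \<Longrightarrow> norm (egrad h z) \<le> M" by (auto simp: bounded_iff)
  then have "M \<ge> 0" using x0_X norm_ge_zero order_trans by blast
  with M that show thesis by blast
qed

text \<open>Lower bounds are assumed block by block, whereas an upper bound on \<open>X\<close> is
  known only for the sum \<open>f\<close>. Subtracting the lower bounds of the other blocks
  transfers it to each block.\<close>

lemma fs_bounds:
  obtains B c where "\<And>i z. i \<in> {1..N} \<Longrightarrow> z \<in> block_space blk i \<Longrightarrow> ereal (- c) \<le> fs i z"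
    "\<And>i z. i \<in> {1..N} \<Longrightarrow> z \<in> X \<Longrightarrow> fsr i (P i z) \<le> B"
proof -
  obtain b where b: "\<And>i z. i \<in> {1..N} \<Longrightarrow> z \<in> block_space blk i \<Longrightarrow> ereal (b i) \<le> fs i z"
    using fs_bounded_below by metis
  define c where "c = (\<Sum>i=1..N. \<bar>b i\<bar>)"
  have bc: "- c \<le> b i" if "i \<in> {1..N}" for i
    using member_le_sum[of i "{1..N}" "\<lambda>i. \<bar>b i\<bar>"] that by (force simp: c_def)
  have low: "ereal (- c) \<le> fs i z" if "i \<in> {1..N}" "z \<in> block_space blk i" for i z
    using b[OF that] bc[OF that(1)] by (meson ereal_less_eq(3) order_trans)
  obtain B where B: "\<And>z. z \<in> X \<Longrightarrow> \<bar>fr z\<bar> \<le> B" using fr_bounded by blast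
  have "fsr i (P i z) \<le> B + (\<Sum>j\<in>{1..N} - {i}. c)" if i: "i \<in> {1..N}" and z: "z \<in> X" for i z
  proof -
    have "fr z = fsr i (P i z) + (\<Sum>j\<in>{1..N}-{i}. fsr j (P j z))"
      unfolding fr_sum[OF X_dom(1)[OF z]] using i by (subst sum.remove[of _ i]) auto
    moreover have "(\<Sum>j\<in>{1..N}-{i}. - c) \<le> (\<Sum>j\<in>{1..N}-{i}. fsr j (P j z))"
    proof (rule sum_mono)
      fix j assume j: "j \<in> {1..N} - {i}"
      then have "ereal (- c) \<le> ereal (fsr j (P j z))"
        using low[of j "P j z"] fs_finite[OF X_dom(1)[OF z], of j] by (simp add: block_proj_in_space)
      then show "- c \<le> fsr j (P j z)" by simp
    qed
    ultimately show ?thesis using B[OF z] by (simp add: sum_negf abs_le_iff)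
  qed
  moreover have "(\<Sum>j\<in>{1..N} - {i}. c) = real (N - 1) * c" if "i \<in> {1..N}" for i
    using that by (simp add: card_Diff_singleton)
  ultimately have "\<And>i z. i \<in> {1..N} \<Longrightarrow> z \<in> X \<Longrightarrow> fsr i (P i z) \<le> B + real (N - 1) * c"
    by metis
  with low show thesis by (rule that)
qed

text \<open>By separability only the \<open>i\<close>-th summand of \<open>f\<close> changes. The
  last claim is the proximal inequality at the old block \<open>P i z\<close>, where the linear part
  contributes \<open>(1/\<alpha>) * (norm d)\<^sup>2\<close> and the remainder takes half of it
  away.\<close>

lemma block_proxD:
  assumes u: "u \<in> block_prox f fs g h blk i \<alpha> z w" and i: "i \<in> {1..N}" and \<alpha>: "\<alpha> > 0"
    and z: "z \<in> edom f" and w: "w \<in> D" "eta_real g z w > 0"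
  defines "q \<equiv> Z z / eta_real g z w" and "d \<equiv> u - P i z" and "z' \<equiv> block_replace blk i u z"
  shows "u \<in> block_space blk i" "z' = z + d" "d \<in> block_space blk i" "z' \<in> edom f"
    "fr z' = fr z - fsr i (P i z) + fsr i u"
    "fs i u = ereal (fsr i u)"
    "\<And>a. a \<in> block_space blk i \<Longrightarrow>
      ereal (fsr i u + ((1/\<alpha>) *\<^sub>R (P i z - u) - P i (egrad h z) + q *\<^sub>R P i w) \<bullet> (a - u) - 1/(2*\<alpha>) * (norm (a - u))\<^sup>2) \<le> fs i a"
    "fsr i u + 1/(2*\<alpha>) * (norm d)\<^sup>2 + egrad h z \<bullet> d - q * (w \<bullet> d) \<le> fsr i (P i z)"
proof -
  let ?S = "block_space blk i"
  define c where "c = P i z - \<alpha> *\<^sub>R P i (egrad h z) + (\<alpha> * q) *\<^sub>R P i w"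
  have u': "u \<in> prox_on ?S (\<lambda>z. ereal \<alpha> * fs i z) c"
    using u merit_real[OF z w] by (simp add: block_prox_def c_def q_def)
  have fin: "fs i (P i z) < \<infinity>" using fs_finite[OF z i] by simp
  note pr = prox_on_inequality[OF u' \<alpha> fs_not_MInf[OF i] block_proj_in_space fin, folded fsr_def]
  show uS: "u \<in> ?S" by (rule pr(1))
  show z': "z' = z + d" unfolding z'_def d_def by (rule block_replace_eq[OF uS])
  show dS: "d \<in> ?S" unfolding d_def by (intro block_space_diff uS block_proj_in_space)
  show fu: "fs i u = ereal (fsr i u)" using pr(2) by (cases "fs i u") (auto simp: fsr_def)
  have sum: "f z' = ereal (fsr i u + (\<Sum>j\<in>{1..N}-{i}. fsr j (P j z)))"
  proof -
    have "f z' = fs i (P i z') + (\<Sum>j\<in>{1..N}-{i}. fs j (P j z'))"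
      unfolding f_separable[of z'] using i by (subst sum.remove[of _ i]) auto
    also have "(\<Sum>j\<in>{1..N}-{i}. fs j (P j z')) = (\<Sum>j\<in>{1..N}-{i}. ereal (fsr j (P j z)))"
      using fs_finite[OF z] block_proj_replace(2)[OF uS] by (intro sum.cong) (auto simp: z'_def)
    finally show ?thesis using fu block_proj_replace(1)[OF uS] by (simp add: z'_def)
  qed
  then show "z' \<in> edom f" by (simp add: edom_def)
  have "fr z = fsr i (P i z) + (\<Sum>j\<in>{1..N}-{i}. fsr j (P j z))"
    unfolding fr_sum[OF z] using i by (subst sum.remove[of _ i]) auto
  with sum show "fr z' = fr z - fsr i (P i z) + fsr i u" by (simp add: fr_def)
  have c: "(1/\<alpha>) *\<^sub>R (c - u) = (1/\<alpha>) *\<^sub>R (P i z - u) - P i (egrad h z) + q *\<^sub>R P i w"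
    using \<alpha> by (simp add: c_def algebra_simps)
  show 7: "ereal (fsr i u + ((1/\<alpha>) *\<^sub>R (P i z - u) - P i (egrad h z) + q *\<^sub>R P i w) \<bullet> (a - u) - 1/(2*\<alpha>) * (norm (a - u))\<^sup>2) \<le> fs i a"
    if "a \<in> ?S" for a
    by (rule pr(3)[unfolded c]) (use that in auto)
  have "fsr i u + ((1/\<alpha>) *\<^sub>R (P i z - u) - P i (egrad h z) + q *\<^sub>R P i w) \<bullet> (P i z - u) - 1/(2*\<alpha>) * (norm (P i z - u))\<^sup>2 \<le> fsr i (P i z)"
    using 7[OF block_proj_in_space[of blk i z]] fs_finite[OF z i] by simp
  moreover have pd: "P i z - u = - d" by (simp add: d_def)
  moreover have "((1/\<alpha>) *\<^sub>R (- d) - P i (egrad h z) + q *\<^sub>R P i w) \<bullet> (- d)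
     = (1/\<alpha>) * (norm d)\<^sup>2 + egrad h z \<bullet> d - q * (w \<bullet> d)"
    by (simp add: inner_add_left inner_diff_left block_proj_inner[OF dS] power2_norm_eq_inner)
  ultimately have "fsr i u + ((1/\<alpha>) * (norm d)\<^sup>2 + egrad h z \<bullet> d - q * (w \<bullet> d)) - 1/(2*\<alpha>) * (norm d)\<^sup>2 \<le> fsr i (P i z)"
    unfolding pd by simp
  moreover have "(1/\<alpha>) * (norm d)\<^sup>2 - 1/(2*\<alpha>) * (norm d)\<^sup>2 = 1/(2*\<alpha>) * (norm d)\<^sup>2"
    using \<alpha> by (simp add: field_simps)
  ultimately show "fsr i u + 1/(2*\<alpha>) * (norm d)\<^sup>2 + egrad h z \<bullet> d - q * (w \<bullet> d) \<le> fsr i (P i z)"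
    by linarith
qed

lemma accept_iff:
  assumes z: "z \<in> edom f" "z' \<in> edom f" "z' \<in> Omega g" and w: "w \<in> D" "eta_real g z w > 0"
  shows "accept f g h \<sigma> z w z' \<longleftrightarrow>
    Z z' + \<sigma> / 2 * (norm (z' - z))\<^sup>2 \<le> Z z / eta_real g z w * eta_real g z' w"
  unfolding accept_def merit_real[OF z(1) w] eta_eq_real[OF w(1)] zeta_real[OF z(2,3)] by simp

text \<open>Minimality against the old block bounds \<open>(norm d)\<^sup>2 / (2 * \<alpha>)\<close>
  by \<open>A + A' * norm d\<close>. A small \<open>\<alpha>\<close> therefore forces the trial
  point into the ball where \<open>h\<close> has a quadratic upper bound, and there the proximal
  term absorbs both this bound and the \<open>\<sigma>\<close> term of the acceptance test.\<close>

lemma stepsize_lower_bound: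
  assumes \<sigma>: "\<sigma> > 0" and M: "M \<ge> 0"
  obtains a where "a > 0"
    "\<And>z w i \<alpha> u. z \<in> X \<Longrightarrow> w \<in> D \<Longrightarrow> eta_real g z w > 0 \<Longrightarrow> norm w \<le> M \<Longrightarrow> Z z / eta_real g z w \<le> F0 \<Longrightarrow>
      i \<in> {1..N} \<Longrightarrow> 0 < \<alpha> \<Longrightarrow> \<alpha> \<le> a \<Longrightarrow> u \<in> block_prox f fs g h blk i \<alpha> z w \<Longrightarrow>
      accept f g h \<sigma> z w (block_replace blk i u z)"
proof -
  obtain r L where r: "r > 0" "L \<ge> 0"
    "\<And>z u. z \<in> X \<Longrightarrow> norm (u - z) < r \<Longrightarrow> u \<in> Omega g"
    "\<And>z u. z \<in> X \<Longrightarrow> norm (u - z) < r \<Longrightarrow>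
       \<bar>hr u - hr z - egrad h z \<bullet> (u - z)\<bar> \<le> L * (norm (u - z))\<^sup>2"
    by (rule h_uniform_smooth) (rule that)
  obtain Mh where Mh: "Mh \<ge> 0" "\<And>z. z \<in> X \<Longrightarrow> norm (egrad h z) \<le> Mh" using egrad_bounded by blast
  obtain B c where fsb: "\<And>i z. i \<in> {1..N} \<Longrightarrow> z \<in> block_space blk i \<Longrightarrow> ereal (- c) \<le> fs i z"
    "\<And>i z. i \<in> {1..N} \<Longrightarrow> z \<in> X \<Longrightarrow> fsr i (P i z) \<le> B"
    by (rule fs_bounds) (rule that)
  define A where "A = max 0 (B + c)"
  define A' where "A' = Mh + F0 * M"
  have A: "A \<ge> 0" "B + c \<le> A" "A' \<ge> 0" using Mh F0_nonneg M by (auto simp: A_def A'_def)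
  \<comment> \<open>The first entry gives \<open>L + \<sigma> / 2 \<le> 1 / (2 * \<alpha>)\<close>.
    The second excludes \<open>norm d \<ge> r\<close>, under which \<open>A + A' * norm d\<close> is
    at most \<open>(A / r\<^sup>2 + A' / r) * (norm d)\<^sup>2\<close>; the added 1 makes the
    contradiction strict.\<close>
  define a where "a = min (1 / (2 * L + \<sigma>)) (1 / (4 * (A / r\<^sup>2 + A' / r + 1)))"
  have den: "A / r\<^sup>2 + A' / r + 1 > 0" "2 * L + \<sigma> > 0" using A r \<sigma> by (auto intro!: add_nonneg_pos)
  have a: "a > 0" using den by (simp add: a_def)
  show thesis
  proof (rule that[OF a])
    fix z w i \<alpha> u
    assume z: "z \<in> X" and w: "w \<in> D" "eta_real g z w > 0" "norm w \<le> M" "Z z / eta_real g z w \<le> F0"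
      and i: "i \<in> {1..N}" and \<alpha>: "0 < \<alpha>" "\<alpha> \<le> a" and u: "u \<in> block_prox f fs g h blk i \<alpha> z w"
    define q where "q = Z z / eta_real g z w"
    define d where "d = u - P i z"
    define z' where "z' = block_replace blk i u z"
    note bp = block_proxD[OF u i \<alpha>(1) X_dom(1)[OF z] w(1,2), folded q_def d_def z'_def]
    have q: "0 \<le> q" "q \<le> F0" using Z_nonneg[OF X_dom[OF z]] w by (auto simp: q_def)
    have "- c \<le> fsr i u"
    proof -
      have "ereal (- c) \<le> ereal (fsr i u)" using fsb(1)[OF i bp(1)] bp(6) by simp
      then show ?thesis by simp
    qed
    moreover have "- (Mh * norm d) \<le> egrad h z \<bullet> d"
    proof -
      have "\<bar>egrad h z \<bullet> d\<bar> \<le> Mh * norm d"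
        using Cauchy_Schwarz_ineq2[of "egrad h z" d] mult_right_mono[OF Mh(2)[OF z], of "norm d"] by simp
      then show ?thesis by linarith
    qed
    moreover have "q * (w \<bullet> d) \<le> F0 * M * norm d"
    proof -
      have "w \<bullet> d \<le> M * norm d"
        using norm_cauchy_schwarz[of w d] mult_right_mono[OF w(3), of "norm d"] by simp
      then have "q * (w \<bullet> d) \<le> q * (M * norm d)" using q by (intro mult_left_mono)
      also have "\<dots> \<le> F0 * (M * norm d)" using q M by (intro mult_right_mono) auto
      finally show ?thesis by simp
    qed
    ultimately have dd: "1/(2*\<alpha>) * (norm d)\<^sup>2 \<le> A + A' * norm d"
      using bp(8) fsb(2)[OF i z] A(2) by (simp add: A'_def algebra_simps)
    have dr: "norm d < r"
    proof (rule ccontr)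
      assume "\<not> norm d < r"
      then have nd: "norm d \<ge> r" by simp
      have "A + A' * norm d \<le> (A / r\<^sup>2 + A' / r) * (norm d)\<^sup>2"
      proof -
        have "A \<le> A / r\<^sup>2 * (norm d)\<^sup>2"
        proof -
          have "r\<^sup>2 \<le> (norm d)\<^sup>2" using nd r by (intro power_mono) auto
          then have "A * r\<^sup>2 \<le> A * (norm d)\<^sup>2" using A by (intro mult_left_mono)
          then show ?thesis using r by (simp add: field_simps)
        qed
        moreover have "A' * norm d \<le> A' / r * (norm d)\<^sup>2"
        proof -
          have "r * norm d \<le> norm d * norm d" using nd by (intro mult_right_mono) auto
          then have "A' * (r * norm d) \<le> A' * (norm d * norm d)" using A by (intro mult_left_mono)
          then show ?thesis using r by (simp add: field_simps power2_eq_square)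
        qed
        ultimately show ?thesis by (simp add: distrib_right)
      qed
      also have "\<dots> < (A / r\<^sup>2 + A' / r + 1) * (norm d)\<^sup>2"
        using less_le_trans[OF r(1) nd] by (simp add: distrib_right)
      finally have "1/(2*\<alpha>) * (norm d)\<^sup>2 < (A / r\<^sup>2 + A' / r + 1) * (norm d)\<^sup>2" using dd by linarith
      then have "1/(2*\<alpha>) < A / r\<^sup>2 + A' / r + 1" by (rule mult_right_less_imp_less) simp
      moreover have "A / r\<^sup>2 + A' / r + 1 \<le> 1/(2*\<alpha>)"
      proof -
        define K where "K = A / r\<^sup>2 + A' / r + 1"
        have "\<alpha> \<le> 1 / (4 * K)" using \<alpha> by (simp add: a_def K_def)
        then have "\<alpha> * (4 * K) \<le> 1" using den by (simp add: pos_le_divide_eq K_def)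
        moreover have "\<alpha> * K > 0" using den \<alpha> by (simp add: K_def)
        ultimately have "K * (2 * \<alpha>) \<le> 1" by (simp add: mult_ac)
        then have "(A / r\<^sup>2 + A' / r + 1) * (2 * \<alpha>) \<le> 1" by (simp only: K_def)
        then show ?thesis using \<alpha> by (simp add: pos_le_divide_eq)
      qed
      ultimately show False by simp
    qed
    have zd: "z' - z = d" by (simp add: bp(2))
    have z'O: "z' \<in> Omega g" using r(3)[OF z] dr zd by simp
    have hb: "hr z' \<le> hr z + egrad h z \<bullet> d + L * (norm d)\<^sup>2"
      using r(4)[OF z, of z'] dr unfolding zd by (simp add: abs_le_iff)
    have "(2 * L + \<sigma>) \<le> 1 / \<alpha>"
    proof -
      have "\<alpha> \<le> 1 / (2 * L + \<sigma>)" using \<alpha> by (simp add: a_def)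
      then show ?thesis using \<alpha> den by (simp add: field_simps)
    qed
    then have "(L + \<sigma> / 2) * (norm d)\<^sup>2 \<le> (1/(2*\<alpha>)) * (norm d)\<^sup>2"
      by (intro mult_right_mono) (auto simp: field_simps)
    then have "Z z' + \<sigma> / 2 * (norm d)\<^sup>2 \<le> Z z + q * (w \<bullet> d)"
      using bp(5,8) hb by (simp add: Z_def algebra_simps)
    also have "\<dots> = q * eta_real g z' w"
    proof -
      have "eta_real g z' w = eta_real g z w + w \<bullet> d"
        by (simp add: bp(2) eta_real_def inner_add_left inner_commute[of d w])
      moreover have "q * eta_real g z w = Z z" using w by (simp add: q_def)
      ultimately show ?thesis by (simp add: algebra_simps)
    qed
    finally show "accept f g h \<sigma> z w (block_replace blk i u z)"
      unfolding z'_def[symmetric] accept_iff[OF X_dom(1)[OF z] bp(4) z'O w(1,2)] zd q_def .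
  qed
qed

end

section \<open>The algorithm\<close>

text \<open>The limit set is the intersection of the closures of the tails. If \<open>p\<close> left
  \<open>U\<close> infinitely often, the terms outside would have a cluster point outside
  \<open>U\<close>.\<close>

lemma cluster_set:
  fixes p :: "nat \<Rightarrow> 'a::heine_borel"
  assumes bdd: "bounded (range p)"
  obtains \<Omega> where "compact \<Omega>" "\<Omega> \<noteq> {}"
    "\<And>q. q \<in> \<Omega> \<Longrightarrow> \<exists>k. filterlim k at_top sequentially \<and> (\<lambda>n. p (k n)) \<longlonglongrightarrow> q"
    "\<And>U. open U \<Longrightarrow> \<Omega> \<subseteq> U \<Longrightarrow> \<forall>\<^sub>F n in sequentially. p n \<in> U"
proof -
  define \<Omega> where "\<Omega> = (\<Inter>n. closure (p ` {n..}))"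
  have "closed \<Omega>" by (auto simp: \<Omega>_def)
  moreover have "bounded \<Omega>"
    by (rule bounded_subset[OF bounded_closure[OF bdd]])
      (auto simp: \<Omega>_def intro: closure_mono[THEN subsetD, rotated])
  ultimately have comp: "compact \<Omega>" by (simp add: compact_eq_bounded_closed)
  have seq: "\<exists>k. filterlim k at_top sequentially \<and> (\<lambda>n. p (k n)) \<longlonglongrightarrow> q" if q: "q \<in> \<Omega>" for q
  proof -
    have "\<exists>m\<ge>n. dist (p m) q < inverse (real (Suc n))" for n
    proof -
      have "q \<in> closure (p ` {n..})" using q by (auto simp: \<Omega>_def)
      then show ?thesis unfolding closure_approachable by (metis atLeast_iff imageE inverse_Suc)
    qed
    then obtain k where k: "\<And>n. k n \<ge> n" "\<And>n. dist (p (k n)) q < inverse (real (Suc n))" by metis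
    have "filterlim k at_top sequentially"
      by (rule filterlim_at_top_mono[OF filterlim_ident]) (use k in auto)
    moreover have "(\<lambda>n. dist (p (k n)) q) \<longlonglongrightarrow> 0"
      by (rule tendsto_sandwich[OF _ _ tendsto_const LIMSEQ_inverse_real_of_nat])
        (use k(2) in \<open>auto intro!: always_eventually less_imp_le\<close>)
    ultimately show ?thesis using tendsto_dist_iff[of "\<lambda>n. p (k n)" q] by blast
  qed
  have ev: "\<forall>\<^sub>F n in sequentially. p n \<in> U" if U: "open U" "\<Omega> \<subseteq> U" for U
  proof (rule ccontr)
    assume "\<not> ?thesis"
    then have "\<forall>n. \<exists>m\<ge>n. p m \<notin> U" by (auto simp: eventually_sequentially)
    then obtain k where k: "\<And>n. k n \<ge> n" "\<And>n. p (k n) \<notin> U" by metis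
    have "compact (closure (range p))" using bdd by (simp add: compact_closure)
    moreover have "\<forall>n. p (k n) \<in> closure (range p)" by (meson closure_subset rangeI subsetD)
    ultimately obtain l r where lr: "strict_mono r" "((\<lambda>n. p (k n)) \<circ> r) \<longlonglongrightarrow> l"
      unfolding compact_def by metis
    have "l \<in> closure (p ` {n..})" for n
    proof (rule Lim_in_closed_set[OF closed_closure _ _ lr(2)])
      show "\<forall>\<^sub>F j in sequentially. ((\<lambda>n. p (k n)) \<circ> r) j \<in> closure (p ` {n..})"
        unfolding eventually_sequentially
      proof (intro exI[of _ n] allI impI)
        fix j assume "n \<le> j"
        then have "n \<le> k (r j)" using k(1)[of "r j"] seq_suble[OF lr(1), of j] by linarith
        then show "((\<lambda>n. p (k n)) \<circ> r) j \<in> closure (p ` {n..})" by (auto intro: closure_subset[THEN subsetD])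
      qed
    qed simp
    then have "l \<in> \<Omega>" by (auto simp: \<Omega>_def)
    moreover have "l \<in> - U"
      by (rule Lim_in_closed_set[OF _ _ _ lr(2)]) (use U k(2) in auto)
    ultimately show False using U by auto
  qed
  \<comment> \<open>An empty limit set would force the sequence eventually into the open set
    \<open>{}\<close>.\<close>
  have "\<Omega> \<noteq> {}" using ev[of "{}"] by auto
  with that comp seq ev show thesis by blast
qed

locale cmpga = fractional_program f h g fs N blk "x 0"
  for f h :: "real ^ 'n::finite \<Rightarrow> ereal" and g fs N blk and x :: "nat \<Rightarrow> real ^ 'n" +
  fixes \<alpha>lo \<alpha>up \<sigma> \<gamma> gX :: real and y :: "nat \<Rightarrow> real ^ 'n"
  assumes params: "0 < \<alpha>lo" "\<alpha>lo \<le> \<alpha>up" "0 < \<sigma>" "0 < \<gamma>" "\<gamma> < 1"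
    and algorithm: "cmpga_ml f fs g h N blk \<alpha>lo \<alpha>up \<sigma> \<gamma> x y"
    and gX: "gX > 0" "\<And>z. z \<in> level_X f g h (x 0) \<Longrightarrow> g z \<le> gX"
    and g_conj_calm: "calm_on (edom (conj_fun g)) (conj_fun g)"
    and KL: "\<And>p. p \<in> set_S g (level_X f g h (x 0)) gX \<alpha>lo \<Longrightarrow>
               p \<in> dom_subdiff (merit_Q f g h) \<Longrightarrow> KL_at (merit_Q f g h) p"
begin

definition "E t = eta_real g (x t) (y t)"
definition "Q t = Z (x t) / E t"
text \<open>The induction invariant. Since \<open>E t \<le> g (x t)\<close>, the bound
  \<open>Q t \<le> F0\<close> implies the level-set inequality at \<open>x t\<close>, and it is the
  bound that the steps propagate.\<close>

definition "admissible t \<longleftrightarrow> x t \<in> X \<and> y t \<in> D \<and> E t > 0 \<and> Q t \<le> F0"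

section \<open>Effect of a single step on the merit value\<close>

lemma dual_update:
  assumes "admissible t" "t mod (N + 1) = 0"
  shows "x (Suc t) = x t"
    "\<exists>\<alpha>. \<alpha>lo \<le> \<alpha> \<and> \<alpha> \<le> \<alpha>up \<and> y (Suc t) \<in> subgradients g (x t - (1/\<alpha>) *\<^sub>R (y (Suc t) - y t))"
proof -
  have "dual_step g \<alpha>lo \<alpha>up (x t) (y t) (x (Suc t)) (y (Suc t))"
    using algorithm assms(2) unfolding cmpga_ml_def by (auto simp: Let_def)
  then obtain \<alpha> where \<alpha>: "\<alpha> \<in> {\<alpha>lo..\<alpha>up}" and xs: "x (Suc t) = x t"
    and prox: "y (Suc t) \<in> prox_on UNIV (\<lambda>z. ereal \<alpha> * conj_fun g z) (y t + \<alpha> *\<^sub>R x t)"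
    unfolding dual_step_def by blast
  have "\<alpha> > 0" using \<alpha> params by auto
  from prox_conj_subgradient[OF g_convex this _ prox] assms \<alpha>
  show "\<exists>\<alpha>. \<alpha>lo \<le> \<alpha> \<and> \<alpha> \<le> \<alpha>up \<and> y (Suc t) \<in> subgradients g (x t - (1/\<alpha>) *\<^sub>R (y (Suc t) - y t))"
    by (intro exI[of _ \<alpha>]) (auto simp: admissible_def)
  show "x (Suc t) = x t" by (rule xs)
qed

lemma Z_x_nonneg: "x t \<in> X \<Longrightarrow> Z (x t) \<ge> 0"
  using Z_nonneg X_dom by blast

lemma Q_times_E: "E t > 0 \<Longrightarrow> Q t * E t = Z (x t)"
  by (simp add: Q_def)

lemma E_le_gX: "admissible t \<Longrightarrow> E t \<le> gX"
  using eta_real_le[of "y t" g "x t"] gX(2)[of "x t"] by (auto simp: admissible_def E_def)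

lemma Q_nonneg_admissible: "admissible t \<Longrightarrow> Q t \<ge> 0"
  using Z_x_nonneg[of t] by (auto simp: admissible_def Q_def)

text \<open>With \<open>x\<close> fixed the numerator does not change, so
  \<open>Q t * E t = Q (Suc t) * E (Suc t)\<close>. Multiplying the growth of \<open>E\<close> by
  \<open>Q (Suc t)\<close> turns it into a drop of \<open>Q\<close>, which is the origin of the
  weight.\<close>

lemma dual_update_admissible:
  assumes t: "admissible t" and "t mod (N + 1) = 0"
  shows "admissible (Suc t)" "Q (Suc t) \<le> Q t"
    "Q (Suc t) * (norm (y (Suc t) - y t))\<^sup>2 \<le> \<alpha>up * gX * (Q t - Q (Suc t))"
proof -
  obtain \<alpha> where \<alpha>: "\<alpha>lo \<le> \<alpha>" "\<alpha> \<le> \<alpha>up" and y': "y (Suc t) \<in> subgradients g (x t - (1/\<alpha>) *\<^sub>R (y (Suc t) - y t))"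
    using dual_update[OF assms] by blast
  have \<alpha>0: "\<alpha> > 0" using \<alpha> params by simp
  have xs: "x (Suc t) = x t" using dual_update[OF assms] by blast
  have yD: "y t \<in> D" "y (Suc t) \<in> D" using t conj_fun_subgradient(1)[OF y'] by (auto simp: admissible_def)
  have inc: "E t + (1/\<alpha>) * (norm (y (Suc t) - y t))\<^sup>2 \<le> E (Suc t)"
    using eta_dual_increase[OF y' yD(1)] by (simp add: E_def xs)
  have E: "0 < E t" "E t \<le> E (Suc t)"
  proof -
    show "0 < E t" using t by (simp add: admissible_def)
    have "0 \<le> (1/\<alpha>) * (norm (y (Suc t) - y t))\<^sup>2" using \<alpha>0 by simp
    with inc show "E t \<le> E (Suc t)" by linarith
  qed
  have Z0: "Z (x t) \<ge> 0" using t Z_x_nonneg by (simp add: admissible_def)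
  show Qd: "Q (Suc t) \<le> Q t"
    unfolding Q_def xs using E Z0 by (intro divide_left_mono) auto
  then show adm: "admissible (Suc t)" using t E yD by (auto simp: admissible_def xs)
  have Q0: "Q (Suc t) \<ge> 0" using Q_nonneg_admissible[OF adm] .
  have "Q t * E t = Q (Suc t) * E (Suc t)" using Q_times_E[of t] Q_times_E[of "Suc t"] E by (simp add: xs)
  moreover have "Q (Suc t) * (E t + (1/\<alpha>) * (norm (y (Suc t) - y t))\<^sup>2) \<le> Q (Suc t) * E (Suc t)"
    using inc Q0 by (intro mult_left_mono)
  ultimately have "Q (Suc t) * ((1/\<alpha>) * (norm (y (Suc t) - y t))\<^sup>2) \<le> (Q t - Q (Suc t)) * E t"
    by (simp add: algebra_simps)
  also have "\<dots> \<le> (Q t - Q (Suc t)) * gX" using Qd E_le_gX[OF t] by (intro mult_left_mono) auto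
  finally have "Q (Suc t) * (norm (y (Suc t) - y t))\<^sup>2 \<le> \<alpha> * ((Q t - Q (Suc t)) * gX)"
    using \<alpha>0 by (simp add: field_simps)
  also have "\<dots> \<le> \<alpha>up * ((Q t - Q (Suc t)) * gX)" using \<alpha> Qd gX by (intro mult_right_mono) auto
  finally show "Q (Suc t) * (norm (y (Suc t) - y t))\<^sup>2 \<le> \<alpha>up * gX * (Q t - Q (Suc t))" by (simp add: mult_ac)
qed

lemma block_update:
  assumes "t mod (N + 1) = i" "i \<noteq> 0"
  shows "y (Suc t) = y t"
    "\<exists>\<alpha> m u. \<alpha>lo \<le> \<alpha> \<and> \<alpha> \<le> \<alpha>up \<and> (\<forall>j\<le>m. u j \<in> block_prox f fs g h blk i (\<alpha> * \<gamma> ^ j) (x t) (y t)) \<and>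
       (\<forall>j<m. \<not> accept f g h \<sigma> (x t) (y t) (block_replace blk i (u j) (x t))) \<and>
       accept f g h \<sigma> (x t) (y t) (x (Suc t)) \<and> x (Suc t) = block_replace blk i (u m) (x t)"
proof -
  have "block_step f fs g h blk \<alpha>lo \<alpha>up \<sigma> \<gamma> i (x t) (y t) (x (Suc t)) (y (Suc t))"
    using algorithm assms unfolding cmpga_ml_def by (auto simp: Let_def)
  then show "y (Suc t) = y t"
    "\<exists>\<alpha> m u. \<alpha>lo \<le> \<alpha> \<and> \<alpha> \<le> \<alpha>up \<and> (\<forall>j\<le>m. u j \<in> block_prox f fs g h blk i (\<alpha> * \<gamma> ^ j) (x t) (y t)) \<and>
       (\<forall>j<m. \<not> accept f g h \<sigma> (x t) (y t) (block_replace blk i (u j) (x t))) \<and>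
       accept f g h \<sigma> (x t) (y t) (x (Suc t)) \<and> x (Suc t) = block_replace blk i (u m) (x t)"
    unfolding block_step_def by auto blast
qed

lemma block_update_admissible:
  assumes t: "admissible t" and i: "t mod (N + 1) = i" "i \<noteq> 0"
  shows "admissible (Suc t)" "(norm (x (Suc t) - x t))\<^sup>2 \<le> 2 * gX / \<sigma> * (Q t - Q (Suc t))"
proof -
  obtain \<alpha> m u where \<alpha>: "\<alpha>lo \<le> \<alpha>" and u: "\<forall>j\<le>m. u j \<in> block_prox f fs g h blk i (\<alpha> * \<gamma> ^ j) (x t) (y t)"
    and acc: "accept f g h \<sigma> (x t) (y t) (x (Suc t))" and xs: "x (Suc t) = block_replace blk i (u m) (x t)"
    using block_update(2)[OF i] by blast
  have ys: "y (Suc t) = y t" by (rule block_update(1)[OF i])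
  have iN: "i \<in> {1..N}" using i mod_less_divisor[of "N + 1" t] by auto
  have xt: "x t \<in> edom f" "x t \<in> Omega g" using t X_dom by (auto simp: admissible_def)
  have y: "y t \<in> D" "eta_real g (x t) (y t) > 0" using t by (auto simp: admissible_def E_def)
  have Q0: "Q t \<ge> 0" by (rule Q_nonneg_admissible[OF t])
  have "\<alpha> * \<gamma> ^ m > 0" using \<alpha> params by simp
  from block_proxD(4)[OF _ iN this xt(1) y, of "u m"] u
  have xf: "x (Suc t) \<in> edom f" by (simp add: xs)
  \<comment> \<open>\<open>zeta\<close> stays extended real here: the new point is known to lie in
    \<open>Omega g\<close> only once \<open>E (Suc t) > 0\<close> is.\<close>
  have acc': "zeta f h (x (Suc t)) + ereal (\<sigma> / 2 * (norm (x (Suc t) - x t))\<^sup>2) \<le> ereal (Q t * E (Suc t))"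
    using acc unfolding accept_def merit_real[OF xt(1) y] eta_eq_real[OF y(1)]
    by (simp add: Q_def E_def ys)
  have ze: "zeta f h (x (Suc t)) \<ge> 0" using zeta_nonneg[OF xf] .
  have up: "\<sigma> / 2 * (norm (x (Suc t) - x t))\<^sup>2 \<le> Q t * E (Suc t)"
  proof -
    have "0 + ereal (\<sigma> / 2 * (norm (x (Suc t) - x t))\<^sup>2) \<le> ereal (Q t * E (Suc t))"
      using add_right_mono[OF ze] acc' by (rule order_trans)
    then show ?thesis by simp
  qed
  \<comment> \<open>The acceptance test does not mention the sign of the new denominator. A
    nonpositive one would force \<open>x (Suc t) = x t\<close>, where the denominator is
    positive.\<close>
  have E': "E (Suc t) > 0"
  proof (rule ccontr)
    assume neg: "\<not> E (Suc t) > 0"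
    then have "Q t * E (Suc t) \<le> 0" using Q0 by (simp add: mult_nonneg_nonpos)
    with up have "\<sigma> / 2 * (norm (x (Suc t) - x t))\<^sup>2 \<le> 0" by linarith
    then have "(norm (x (Suc t) - x t))\<^sup>2 \<le> 0" using params by (simp add: mult_le_0_iff)
    then have "x (Suc t) = x t" by simp
    with neg y show False by (simp add: E_def ys)
  qed
  have xO: "x (Suc t) \<in> Omega g" using eta_pos_Omega[OF y(1)] E' by (simp add: E_def ys)
  have Zi: "Z (x (Suc t)) + \<sigma> / 2 * (norm (x (Suc t) - x t))\<^sup>2 \<le> Q t * E (Suc t)"
    using acc' by (simp add: zeta_real[OF xf xO])
  have Eg: "E (Suc t) \<le> g (x (Suc t))" using eta_real_le[OF y(1)] by (simp add: E_def ys)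
  have Z0: "Z (x (Suc t)) \<ge> 0" by (rule Z_nonneg[OF xf xO])
  have "0 \<le> \<sigma> / 2 * (norm (x (Suc t) - x t))\<^sup>2" using params by simp
  with Zi have "Z (x (Suc t)) \<le> Q t * E (Suc t)" by linarith
  then have Qd: "Q (Suc t) \<le> Q t" using E' by (simp add: Q_def pos_divide_le_eq)
  have "Z (x (Suc t)) / g (x (Suc t)) \<le> Q (Suc t)"
    unfolding Q_def using Eg E' Z0 by (intro divide_left_mono) auto
  also have "\<dots> \<le> F0" using Qd t by (auto simp: admissible_def)
  finally have "x (Suc t) \<in> X" using xf xO by (simp add: X_iff)
  then show adm: "admissible (Suc t)" using y E' Qd t by (auto simp: admissible_def ys)
  have "\<sigma> / 2 * (norm (x (Suc t) - x t))\<^sup>2 \<le> (Q t - Q (Suc t)) * E (Suc t)"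
    using Zi Q_times_E[OF E'] by (simp add: algebra_simps)
  also have "\<dots> \<le> (Q t - Q (Suc t)) * gX" using Qd E_le_gX[OF adm] by (intro mult_left_mono) auto
  finally show "(norm (x (Suc t) - x t))\<^sup>2 \<le> 2 * gX / \<sigma> * (Q t - Q (Suc t))"
    using params by (simp add: field_simps)
qed

lemma y0: "y 0 \<in> subgradients g (x 0)"
  using algorithm unfolding cmpga_ml_def subdiff_real_convex[OF g_convex] by simp

lemma admissible: "admissible t"
proof (induction t)
  case 0
  \<comment> \<open>\<open>y 0\<close> is a subgradient at \<open>x 0\<close>, so the merit value
    starts exactly at the objective value \<open>F0\<close>.\<close>
  have "E 0 = g (x 0)" using conj_fun_subgradient(2)[OF y0] by (simp add: E_def eta_real_def)
  then show ?case
    using x0_X conj_fun_subgradient(1)[OF y0] g_pos[OF x0_dom(2)] by (simp add: admissible_def Q_def F0_def)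
next
  case (Suc t)
  then show ?case
    using dual_update_admissible(1) block_update_admissible(1) by blast
qed

lemma x_in_X: "x t \<in> X" and y_in_D: "y t \<in> D" and E_pos: "E t > 0" and Q_le_F0: "Q t \<le> F0"
  using admissible[of t] by (auto simp: admissible_def)

lemma Q_nonneg: "Q t \<ge> 0"
  by (rule Q_nonneg_admissible[OF admissible])

lemma x_step: "(norm (x (Suc t) - x t))\<^sup>2 \<le> 2 * gX / \<sigma> * (Q t - Q (Suc t))"
proof (cases "t mod (N + 1) = 0")
  case True
  then show ?thesis
    using dual_update(1)[OF admissible True] dual_update_admissible(2)[OF admissible True] gX params by simp
qed (use block_update_admissible(2)[OF admissible] in blast)

lemma Q_step: "Q (Suc t) \<le> Q t"
proof -
  have "0 \<le> 2 * gX / \<sigma> * (Q t - Q (Suc t))" using x_step[of t] zero_le_power2 order_trans by blast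
  moreover have "2 * gX / \<sigma> > 0" using gX params by simp
  ultimately show ?thesis unfolding zero_le_mult_iff by linarith
qed

lemma Q_antimono: "s \<le> t \<Longrightarrow> Q t \<le> Q s"
  by (rule lift_Suc_antimono_le[of Q, OF Q_step])

lemma Q_tendsto: obtains Qs where "Q \<longlonglongrightarrow> Qs" "\<And>t. Qs \<le> Q t" "Qs \<ge> 0"
proof -
  have "decseq Q" using Q_antimono by (simp add: decseq_def)
  then obtain L where L: "Q \<longlonglongrightarrow> L" "\<forall>i. L \<le> Q i" using decseq_convergent[of Q 0] Q_nonneg by metis
  moreover have "L \<ge> 0" using L(1) Q_nonneg by (intro LIMSEQ_le_const[OF L(1)]) auto
  ultimately show thesis using that by blast
qed

text \<open>A dual step makes \<open>y\<close> a subgradient at \<open>?z\<close>, at distance at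
  most \<open>norm (y (Suc t) - y t) / \<alpha>\<close> from \<open>X\<close>. The step raises
  \<eta> by \<open>(norm (y (Suc t) - y t))\<^sup>2 / \<alpha>\<close>, and \<eta> remains between 0
  and \<open>gX\<close>; this is where the size of the enlarged set comes from.\<close>

lemma y_in_dual_Y: "y t \<in> dual_Y g X gX \<alpha>lo"
proof (induction t)
  case 0
  have "x 0 \<in> enlarged_X X gX \<alpha>lo" using x0_X gX params by (simp add: enlarged_X_def)
  then show ?case using y0 by (auto simp: dual_Y_def subdiff_real_convex[OF g_convex])
next
  case (Suc t)
  show ?case
  proof (cases "t mod (N + 1) = 0")
    case True
    obtain \<alpha> where \<alpha>: "\<alpha>lo \<le> \<alpha>" "\<alpha> \<le> \<alpha>up" and y': "y (Suc t) \<in> subgradients g (x t - (1/\<alpha>) *\<^sub>R (y (Suc t) - y t))"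
      using dual_update[OF admissible True] by blast
    have \<alpha>0: "\<alpha> > 0" using \<alpha> params by simp
    let ?z = "x t - (1/\<alpha>) *\<^sub>R (y (Suc t) - y t)"
    have "infdist ?z X \<le> dist ?z (x t)" using x_in_X by (rule infdist_le)
    also have "\<dots> = (1/\<alpha>) * norm (y (Suc t) - y t)" using \<alpha>0 by (simp add: dist_norm)
    finally have "(infdist ?z X)\<^sup>2 \<le> ((1/\<alpha>) * norm (y (Suc t) - y t))\<^sup>2"
      using infdist_nonneg by (intro power_mono)
    also have "\<dots> = (1/\<alpha>) * ((1/\<alpha>) * (norm (y (Suc t) - y t))\<^sup>2)"
      by (simp add: power2_eq_square)
    also have "\<dots> \<le> (1/\<alpha>) * gX"
    proof (intro mult_left_mono)
      have "E t + (1/\<alpha>) * (norm (y (Suc t) - y t))\<^sup>2 \<le> E (Suc t)"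
        using eta_dual_increase[OF y' y_in_D] dual_update(1)[OF admissible True] by (simp add: E_def)
      then show "(1/\<alpha>) * (norm (y (Suc t) - y t))\<^sup>2 \<le> gX"
        using E_pos[of t] E_le_gX[OF admissible, of "Suc t"] by linarith
    qed (use \<alpha>0 in simp)
    also have "\<dots> \<le> gX / \<alpha>lo" using \<alpha> params gX by (simp add: frac_le)
    finally have "?z \<in> enlarged_X X gX \<alpha>lo" by (simp add: enlarged_X_def)
    with y' show ?thesis unfolding dual_Y_def subdiff_real_convex[OF g_convex] by blast
  qed (use block_update(1)[of t] Suc in simp)
qed

lemma compact_enlarged_X: "compact (enlarged_X X gX \<alpha>lo)"
proof -
  have ne: "X \<noteq> {}" using x0_X by auto
  have "closed {z. (infdist z X)\<^sup>2 \<le> gX / \<alpha>lo}"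
    by (intro closed_Collect_le continuous_intros)
  moreover have "bounded {z. (infdist z X)\<^sup>2 \<le> gX / \<alpha>lo}"
  proof -
    obtain B where B: "\<And>z. z \<in> X \<Longrightarrow> norm z \<le> B" using compact_imp_bounded[OF X_compact] by (auto simp: bounded_iff)
    have "norm z \<le> B + sqrt (gX / \<alpha>lo)" if "(infdist z X)\<^sup>2 \<le> gX / \<alpha>lo" for z
    proof -
      obtain w where w: "w \<in> X" "infdist z X = dist z w"
        using infdist_attains_inf[OF compact_imp_closed[OF X_compact] ne] by metis
      have "dist z w \<le> sqrt (gX / \<alpha>lo)" using that w(2) by (intro real_le_rsqrt) simp
      then show ?thesis using B[OF w(1)] norm_triangle_ineq[of w "z - w"] by (simp add: dist_norm)
    qed
    then show ?thesis by (auto simp: bounded_iff)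
  qed
  ultimately show ?thesis by (simp add: enlarged_X_def compact_eq_bounded_closed)
qed

lemma dual_Y_bounded: obtains M where "M \<ge> 0" "\<And>w. w \<in> dual_Y g X gX \<alpha>lo \<Longrightarrow> norm w \<le> M"
proof -
  obtain M where "M \<ge> 0" "\<And>z w. z \<in> enlarged_X X gX \<alpha>lo \<Longrightarrow> w \<in> subgradients g z \<Longrightarrow> norm w \<le> M"
    using bounded_subgradients[OF g_convex compact_imp_bounded[OF compact_enlarged_X]] by blast
  then show thesis using that unfolding dual_Y_def subdiff_real_convex[OF g_convex] by blast
qed

text \<open>The base points of the subgradients lie in a compact set, so those of a subsequence
  converge and the closed graph applies.\<close>

lemma dual_Y_closed:
  assumes "ys \<longlonglongrightarrow> w" "\<And>n. ys n \<in> dual_Y g X gX \<alpha>lo"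
  shows "w \<in> dual_Y g X gX \<alpha>lo"
proof -
  have "\<forall>n. \<exists>z. z \<in> enlarged_X X gX \<alpha>lo \<and> ys n \<in> subgradients g z"
    using assms(2) unfolding dual_Y_def subdiff_real_convex[OF g_convex] by blast
  then obtain z where z: "\<And>n. z n \<in> enlarged_X X gX \<alpha>lo" "\<And>n. ys n \<in> subgradients g (z n)" by metis
  obtain l r where l: "l \<in> enlarged_X X gX \<alpha>lo" "strict_mono r" "(z \<circ> r) \<longlonglongrightarrow> l"
    using compact_enlarged_X z(1) unfolding compact_def by metis
  have "w \<in> subgradients g l"
    by (rule subgradients_limit[OF g_continuous l(3) LIMSEQ_subseq_LIMSEQ[OF assms(1) l(2)]])
      (use z(2) in simp)
  with l(1) show ?thesis unfolding dual_Y_def subdiff_real_convex[OF g_convex] by blast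
qed

lemma E_dual_lower_bound:
  obtains e where "e > 0" "\<And>t. t mod (N + 1) = 0 \<Longrightarrow> e \<le> E (Suc t)"
proof -
  obtain M where M: "M \<ge> 0" "\<And>w. w \<in> dual_Y g X gX \<alpha>lo \<Longrightarrow> norm w \<le> M" by (rule dual_Y_bounded) (rule that)
  obtain c where c: "c > 0" "\<And>z. z \<in> X \<Longrightarrow> c \<le> g z" by (rule g_lower_bound) (rule that)
  define e where "e = min (c / 2) ((c * \<alpha>lo / (4 * (M + 1)))\<^sup>2 / \<alpha>up)"
  show thesis
  proof (rule that)
    show "e > 0" using c M params by (simp add: e_def)
    fix t assume t: "t mod (N + 1) = 0"
    obtain \<alpha> where \<alpha>: "\<alpha>lo \<le> \<alpha>" "\<alpha> \<le> \<alpha>up" and y': "y (Suc t) \<in> subgradients g (x t - (1/\<alpha>) *\<^sub>R (y (Suc t) - y t))"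
      using dual_update[OF admissible t] by blast
    obtain w where w: "w \<in> subgradients g (x t)" using subgradients_nonempty[OF g_convex] by blast
    \<comment> \<open>The auxiliary subgradient is taken at a point of \<open>X\<close> and so obeys
      the same bound \<open>M\<close> as the iterates \<open>y\<close>.\<close>
    have "x t \<in> enlarged_X X gX \<alpha>lo" using x_in_X gX params by (simp add: enlarged_X_def)
    then have "w \<in> dual_Y g X gX \<alpha>lo" using w unfolding dual_Y_def subdiff_real_convex[OF g_convex] by blast
    then have "e \<le> eta_real g (x t) (y (Suc t))" unfolding e_def
      using E_pos[of t]
      by (intro eta_dual_lower_bound[OF y' y_in_D _ w _ _ params(1) \<alpha> c(2)[OF x_in_X] c(1)])
        (auto intro: M y_in_dual_Y simp: E_def)
    then show "e \<le> E (Suc t)" using dual_update(1)[OF admissible t] by (simp add: E_def)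
  qed
qed

text \<open>Either the first trial is accepted, with a step of at least \<open>\<alpha>lo\<close>,
  or the trial before the accepted one was rejected and had a step above the threshold
  \<open>a\<close>; one more factor \<open>\<gamma>\<close> gives the accepted step.\<close>

lemma block_update_stepsize:
  obtains a where "a > 0"
    "\<And>t i. t mod (N + 1) = i \<Longrightarrow> i \<noteq> 0 \<Longrightarrow>
       \<exists>\<alpha> u. a \<le> \<alpha> \<and> u \<in> block_prox f fs g h blk i \<alpha> (x t) (y t) \<and> x (Suc t) = block_replace blk i u (x t)"
proof -
  obtain M where M: "M \<ge> 0" "\<And>w. w \<in> dual_Y g X gX \<alpha>lo \<Longrightarrow> norm w \<le> M" by (rule dual_Y_bounded) (rule that)
  obtain a where a: "a > 0"
    "\<And>z w i \<alpha> u. z \<in> X \<Longrightarrow> w \<in> D \<Longrightarrow> eta_real g z w > 0 \<Longrightarrow> norm w \<le> M \<Longrightarrow> Z z / eta_real g z w \<le> F0 \<Longrightarrow>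
      i \<in> {1..N} \<Longrightarrow> 0 < \<alpha> \<Longrightarrow> \<alpha> \<le> a \<Longrightarrow> u \<in> block_prox f fs g h blk i \<alpha> z w \<Longrightarrow>
      accept f g h \<sigma> z w (block_replace blk i u z)"
    by (rule stepsize_lower_bound[OF params(3) M(1)]) (rule that)
  show thesis
  proof (rule that)
    show "min \<alpha>lo (\<gamma> * a) > 0" using a params by simp
    fix t i assume i: "t mod (N + 1) = i" "i \<noteq> 0"
    have iN: "i \<in> {1..N}" using i mod_less_divisor[of "N + 1" t] by auto
    obtain \<alpha> m u where \<alpha>: "\<alpha>lo \<le> \<alpha>" and u: "\<forall>j\<le>m. u j \<in> block_prox f fs g h blk i (\<alpha> * \<gamma> ^ j) (x t) (y t)"
      and rej: "\<forall>j<m. \<not> accept f g h \<sigma> (x t) (y t) (block_replace blk i (u j) (x t))"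
      and xs: "x (Suc t) = block_replace blk i (u m) (x t)"
      using block_update(2)[OF i] by blast
    have "min \<alpha>lo (\<gamma> * a) \<le> \<alpha> * \<gamma> ^ m"
    proof (cases m)
      case 0
      then show ?thesis using \<alpha> by simp
    next
      case (Suc k)
      have "\<not> \<alpha> * \<gamma> ^ k \<le> a"
      proof
        assume le: "\<alpha> * \<gamma> ^ k \<le> a"
        have "accept f g h \<sigma> (x t) (y t) (block_replace blk i (u k) (x t))"
          by (rule a(2)[OF x_in_X y_in_D _ M(2)[OF y_in_dual_Y] _ iN _ le])
            (use E_pos[of t] Q_le_F0[of t] \<alpha> params u Suc in \<open>auto simp: E_def Q_def\<close>)
        with rej Suc show False by simp
      qed
      then have "\<gamma> * a \<le> \<gamma> * (\<alpha> * \<gamma> ^ k)" using params by (intro mult_left_mono) auto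
      then show ?thesis using Suc by (simp add: mult_ac)
    qed
    with u xs show "\<exists>\<alpha> u. min \<alpha>lo (\<gamma> * a) \<le> \<alpha> \<and> u \<in> block_prox f fs g h blk i \<alpha> (x t) (y t) \<and>
        x (Suc t) = block_replace blk i u (x t)" by blast
  qed
qed

section \<open>Estimates over full cycles\<close>

definition "T k = k * (N + 1)"
definition "b k = sqrt (Q (T k) - Q (T (Suc k)))"
text \<open>A cycle has \<open>N + 1\<close> steps, each of length at most
  \<open>sqrt (2 * gX / \<sigma>) * b k\<close>.\<close>

definition "K1 = real (N + 1) * sqrt (2 * gX / \<sigma>)"
definition "Qs = lim Q"

lemma Qs: "Q \<longlonglongrightarrow> Qs" "Qs \<le> Q t" "Qs \<ge> 0"
proof -
  obtain L where L: "Q \<longlonglongrightarrow> L" "\<And>t. L \<le> Q t" "L \<ge> 0" by (rule Q_tendsto) (rule that)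
  then have "Qs = L" unfolding Qs_def by (intro limI)
  with L show "Q \<longlonglongrightarrow> Qs" "Qs \<le> Q t" "Qs \<ge> 0" by auto
qed

lemma T_Suc: "T (Suc k) = T k + N + 1"
  by (simp add: T_def)

lemma T_mod: "T k mod (N + 1) = 0"
  unfolding T_def by (rule mod_mult_self2_is_0)

lemma filterlim_T: "filterlim T at_top sequentially"
  by (rule filterlim_at_top_mono[OF filterlim_ident]) (simp add: T_def)

lemma b_square: "(b k)\<^sup>2 = Q (T k) - Q (T (Suc k))"
  using Q_antimono[of "T k" "T (Suc k)"] by (simp add: b_def T_Suc)

lemma b_nonneg: "b k \<ge> 0"
  using Q_antimono[of "T k" "T (Suc k)"] by (simp add: b_def T_Suc)

lemma Q_T_tendsto: "(\<lambda>k. Q (T k)) \<longlonglongrightarrow> Qs"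
  by (rule filterlim_compose[OF Qs(1) filterlim_T])

lemma b_tendsto: "b \<longlonglongrightarrow> 0"
proof -
  have "(\<lambda>k. sqrt (Q (T k) - Q (T (Suc k)))) \<longlonglongrightarrow> sqrt (Qs - Qs)"
    by (intro tendsto_intros Q_T_tendsto LIMSEQ_Suc[OF Q_T_tendsto])
  then show ?thesis by (simp add: b_def[abs_def])
qed

lemma K1_nonneg: "K1 \<ge> 0"
  using gX params by (simp add: K1_def)

lemma Q_decrease_le_b:
  assumes "T k \<le> t" "t < T (Suc k)"
  shows "Q t - Q (Suc t) \<le> (b k)\<^sup>2"
  using Q_antimono[of "T k" t] Q_antimono[of "Suc t" "T (Suc k)"] assms by (simp add: b_square)

lemma x_step_cycle:
  assumes "T k \<le> t" "t < T (Suc k)"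
  shows "norm (x (Suc t) - x t) \<le> sqrt (2 * gX / \<sigma>) * b k"
proof -
  have "(norm (x (Suc t) - x t))\<^sup>2 \<le> 2 * gX / \<sigma> * (b k)\<^sup>2"
    using x_step[of t] mult_left_mono[OF Q_decrease_le_b[OF assms], of "2 * gX / \<sigma>"] gX params by simp
  then have "norm (x (Suc t) - x t) \<le> sqrt (2 * gX / \<sigma> * (b k)\<^sup>2)" by (rule real_le_rsqrt)
  also have "\<dots> = sqrt (2 * gX / \<sigma>) * b k"
    by (simp only: real_sqrt_mult real_sqrt_abs abs_of_nonneg[OF b_nonneg])
  finally show ?thesis .
qed

lemma x_dist_cycle:
  assumes "T k \<le> s" "s \<le> t" "t \<le> T (Suc k)"
  shows "norm (x t - x s) \<le> K1 * b k"
proof -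
  have "norm (x t - x s) \<le> real (t - s) * (sqrt (2 * gX / \<sigma>) * b k)"
    using assms(2,3)
  proof (induction t rule: dec_induct)
    case (step t)
    have "norm (x (Suc t) - x s) \<le> norm (x (Suc t) - x t) + norm (x t - x s)"
      using norm_triangle_ineq[of "x (Suc t) - x t" "x t - x s"] by simp
    also have "\<dots> \<le> sqrt (2 * gX / \<sigma>) * b k + real (t - s) * (sqrt (2 * gX / \<sigma>) * b k)"
      using step assms by (intro add_mono x_step_cycle) auto
    also have "\<dots> = real (Suc t - s) * (sqrt (2 * gX / \<sigma>) * b k)"
      using step by (simp add: Suc_diff_le algebra_simps)
    finally show ?case .
  qed simp
  also have "\<dots> \<le> real (N + 1) * (sqrt (2 * gX / \<sigma>) * b k)"
    using assms gX params b_nonneg[of k] by (intro mult_right_mono) (auto simp: T_Suc)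
  finally show ?thesis by (simp add: K1_def mult_ac)
qed

lemma cycle_mod:
  assumes "T k < t" "t < T (Suc k)"
  shows "t mod (N + 1) = t - T k" "t - T k \<in> {1..N}"
proof -
  have "t = (t - T k) + k * (N + 1)" using assms by (simp add: T_def)
  then have "t mod (N + 1) = (t - T k) mod (N + 1)" by (metis mod_mult_self1)
  then show "t mod (N + 1) = t - T k" using assms by (simp add: T_Suc)
  show "t - T k \<in> {1..N}" using assms unfolding T_Suc atLeastAtMost_iff by linarith
qed

lemma y_cycle:
  assumes "T k < t" "t \<le> T (Suc k)"
  shows "y t = y (T (Suc k))"
  using assms(2,1)
proof (induction t rule: inc_induct)
  case (step t)
  have "y (Suc t) = y t" using step by (intro block_update(1)[OF cycle_mod(1)[of k t]]) auto
  with step show ?case by simp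
qed simp

text \<open>Block \<open>i\<close> moves only at step \<open>T k + i\<close>, so right after it the
  block has its value at the end of the cycle.\<close>

lemma block_cycle:
  assumes "i \<in> {1..N}" "T k + i < t" "t \<le> T (Suc k)"
  shows "P i (x t) = P i (x (T (Suc k)))"
  using assms(3,2)
proof (induction t rule: inc_induct)
  case (step t)
  define j where "j = t - T k"
  have j: "t mod (N + 1) = j" "j \<in> {1..N}" "j \<noteq> 0" "i \<noteq> j"
    using cycle_mod[of k t] step assms(1) by (auto simp: j_def)
  obtain \<alpha> m u where \<alpha>: "\<alpha>lo \<le> \<alpha>" and u: "\<forall>l\<le>m. u l \<in> block_prox f fs g h blk j (\<alpha> * \<gamma> ^ l) (x t) (y t)"
    and xs: "x (Suc t) = block_replace blk j (u m) (x t)"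
    using block_update(2)[OF j(1,3)] by blast
  have "u m \<in> block_space blk j"
    using u by (auto simp: block_prox_def prox_on_def is_arg_min_def)
  then have "P i (x (Suc t)) = P i (x t)" unfolding xs by (rule block_proj_replace(2)) (rule j(4))
  with step show ?case by simp
qed simp

lemma eventually_b_less: "c > 0 \<Longrightarrow> \<exists>K. \<forall>k\<ge>K. K1 * b k < c"
proof -
  assume c: "c > 0"
  have "(\<lambda>k. K1 * b k) \<longlonglongrightarrow> K1 * 0" by (intro tendsto_intros b_tendsto)
  then have "\<forall>\<^sub>F k in sequentially. K1 * b k < c" using c by (intro order_tendstoD(2)) auto
  then show ?thesis by (simp add: eventually_sequentially)
qed

text \<open>The dual step opening the cycle leaves \<eta> at least \<open>e\<close>. Afterwards
  \<open>y\<close> is fixed and \<open>x\<close> moves by at most \<open>K1 * b k\<close>, which for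
  late cycles costs no more than half of \<open>e\<close>.\<close>

lemma E_cycle_lower_bound:
  obtains e K where "e > 0" "\<And>k. k \<ge> K \<Longrightarrow> e \<le> E (T (Suc k))"
proof -
  obtain M where M: "M \<ge> 0" "\<And>w. w \<in> dual_Y g X gX \<alpha>lo \<Longrightarrow> norm w \<le> M" by (rule dual_Y_bounded) (rule that)
  obtain e where e: "e > 0" "\<And>t. t mod (N + 1) = 0 \<Longrightarrow> e \<le> E (Suc t)" by (rule E_dual_lower_bound) (rule that)
  obtain K where K: "\<And>k. k \<ge> K \<Longrightarrow> K1 * b k < e / (2 * (M + 1))"
    using eventually_b_less[of "e / (2 * (M + 1))"] e M by auto
  show thesis
  proof (rule that)
    show "e / 2 > 0" using e by simp
    fix k assume k: "k \<ge> K"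
    let ?t = "T (Suc k)" and ?s = "Suc (T k)"
    have ys: "y ?s = y ?t" by (rule y_cycle) (simp_all add: T_Suc)
    have "E ?s - E ?t = (x ?s - x ?t) \<bullet> y ?t" by (simp add: E_def eta_real_def ys inner_diff_left)
    also have "\<dots> \<le> norm (x ?t - x ?s) * norm (y ?t)"
      using norm_cauchy_schwarz[of "x ?s - x ?t" "y ?t"] by (simp add: norm_minus_commute)
    also have "\<dots> \<le> (K1 * b k) * (M + 1)"
      using M(2)[OF y_in_dual_Y[of ?t]] K1_nonneg b_nonneg
      by (intro mult_mono x_dist_cycle) (auto simp: T_Suc)
    also have "\<dots> \<le> e / (2 * (M + 1)) * (M + 1)"
      using K[OF k] M by (intro mult_right_mono) auto
    also have "\<dots> = e / 2" using M by (simp add: field_simps add_nonneg_eq_0_iff)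
    finally show "e / 2 \<le> E ?t" using e(2)[OF T_mod[of k]] by linarith
  qed
qed

text \<open>Within a cycle \<open>y\<close> is constant after the dual step, so the variation of \<open>Q\<close> is controlled
  by that of \<open>\<zeta>\<close>; this is where local Lipschitz continuity of \<open>f\<close> enters.\<close>

lemma Q_variation_cycle:
  obtains C K where "C \<ge> 0" "\<And>k s. k \<ge> K \<Longrightarrow> T k < s \<Longrightarrow> s \<le> T (Suc k) \<Longrightarrow> Q s - Q (T (Suc k)) \<le> C * b k"
proof -
  obtain M where M: "M \<ge> 0" "\<And>w. w \<in> dual_Y g X gX \<alpha>lo \<Longrightarrow> norm w \<le> M" by (rule dual_Y_bounded) (rule that)
  obtain e Ke where e: "e > 0" "\<And>k. k \<ge> Ke \<Longrightarrow> e \<le> E (T (Suc k))" by (rule E_cycle_lower_bound) (rule that)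
  obtain rf Lf where Lf: "rf > 0" "Lf \<ge> 0"
    "\<And>z u. z \<in> X \<Longrightarrow> u \<in> X \<Longrightarrow> norm (u - z) < rf \<Longrightarrow> \<bar>fr u - fr z\<bar> \<le> Lf * norm (u - z)"
    by (rule fr_uniform_lipschitz) (rule that)
  obtain r L where r: "r > 0" "L \<ge> 0"
    "\<And>z u. z \<in> X \<Longrightarrow> norm (u - z) < r \<Longrightarrow>
       \<bar>hr u - hr z - egrad h z \<bullet> (u - z)\<bar> \<le> L * (norm (u - z))\<^sup>2"
    by (rule h_uniform_smooth) (rule that)
  obtain Mh where Mh: "Mh \<ge> 0" "\<And>z. z \<in> X \<Longrightarrow> norm (egrad h z) \<le> Mh" by (rule egrad_bounded) (rule that)
  obtain K where K: "\<And>k. k \<ge> K \<Longrightarrow> K1 * b k < min rf r"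
    using eventually_b_less[of "min rf r"] Lf r by auto
  \<comment> \<open>Rates per unit of \<open>norm d\<close>: \<open>Lf\<close> for \<open>f\<close>,
    \<open>Mh + L * r\<close> for \<open>h\<close>, and \<open>F0 * M\<close> for the denominator
    weighted by \<open>Q\<close>.\<close>
  define C where "C = Lf + Mh + L * r + F0 * M"
  have C: "C \<ge> 0" using Lf Mh r F0_nonneg M by (simp add: C_def)
  show thesis
  proof (rule that)
    show "C * K1 / e \<ge> 0" using C K1_nonneg e by simp
    fix k s assume k: "k \<ge> max K Ke" and s: "T k < s" "s \<le> T (Suc k)"
    let ?t = "T (Suc k)"
    define d where "d = x s - x ?t"
    have nd: "norm d \<le> K1 * b k" using x_dist_cycle[of k s ?t] s by (simp add: d_def norm_minus_commute)
    have ndr: "norm d < rf" "norm d < r" using nd K[of k] k by auto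
    have ys: "y s = y ?t" by (rule y_cycle[OF s])
    have 1: "fr (x s) - fr (x ?t) \<le> Lf * norm d"
      using Lf(3)[OF x_in_X x_in_X, of s ?t] ndr by (simp add: d_def abs_le_iff)
    have 2: "hr (x s) - hr (x ?t) \<le> (Mh + L * r) * norm d"
    proof -
      have "hr (x s) - hr (x ?t) \<le> egrad h (x ?t) \<bullet> d + L * (norm d)\<^sup>2"
        using r(3)[OF x_in_X, of "x s" ?t] ndr by (simp add: d_def abs_le_iff)
      moreover have "egrad h (x ?t) \<bullet> d \<le> Mh * norm d"
        using norm_cauchy_schwarz[of "egrad h (x ?t)" d] mult_right_mono[OF Mh(2)[OF x_in_X], of "norm d" ?t] by simp
      moreover have "L * (norm d)\<^sup>2 \<le> L * (r * norm d)"
        using ndr r by (intro mult_left_mono) (auto simp: power2_eq_square intro: mult_right_mono)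
      ultimately show ?thesis by (simp add: algebra_simps)
    qed
    have 3: "- (Q s * (d \<bullet> y ?t)) \<le> F0 * M * norm d"
    proof -
      have "- (d \<bullet> y ?t) \<le> norm d * M"
        using Cauchy_Schwarz_ineq2[of d "y ?t"] mult_left_mono[OF M(2)[OF y_in_dual_Y[of ?t]], of "norm d"] by simp
      then have "Q s * (- (d \<bullet> y ?t)) \<le> Q s * (norm d * M)" using Q_nonneg by (intro mult_left_mono)
      also have "\<dots> \<le> F0 * (norm d * M)" using Q_le_F0 M by (intro mult_right_mono) auto
      finally show ?thesis by (simp add: mult_ac)
    qed
    have Es: "E s = E ?t + d \<bullet> y ?t" by (simp add: E_def eta_real_def ys d_def inner_diff_left)
    \<comment> \<open>Multiplying by the denominator at the end of the cycle reduces the difference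
      of quotients to numerators.\<close>
    have "(Q s - Q ?t) * E ?t = Z (x s) - Z (x ?t) - Q s * (d \<bullet> y ?t)"
      using Q_times_E[OF E_pos[of s]] Q_times_E[OF E_pos[of ?t]] by (simp add: Es algebra_simps)
    also have "\<dots> \<le> C * norm d" using 1 2 3 by (simp add: Z_def C_def algebra_simps)
    also have "\<dots> \<le> C * (K1 * b k)" using C nd by (intro mult_left_mono)
    finally have 4: "(Q s - Q ?t) * E ?t \<le> C * K1 * b k" by simp
    have "(Q s - Q ?t) * e \<le> (Q s - Q ?t) * E ?t"
      using e(2)[of k] k Q_antimono[OF s(2)] by (intro mult_left_mono) auto
    with 4 have "(Q s - Q ?t) * e \<le> C * K1 * b k" by linarith
    then show "Q s - Q ?t \<le> C * K1 / e * b k" using e by (simp add: field_simps)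
  qed
qed

text \<open>At the end of the cycle each block still has the value produced by its own proximal
  step, so the block inequalities hold at one common point and add up to an inequality for
  \<open>f\<close>. Its slope \<open>v\<close> uses \<open>x\<close>, \<open>egrad h\<close> and
  \<open>Q\<close> from the earlier steps \<open>T k + i\<close>; the residual is the drift since
  then. The constants \<open>C\<close> and \<open>Cp\<close> do not depend on the cycle.\<close>

lemma primal_residual:
  obtains C Cp K where "C \<ge> 0" "Cp \<ge> 0"
    "\<And>k. k \<ge> K \<Longrightarrow> \<exists>v. (\<forall>u. ereal (fr (x (T (Suc k))) + v \<bullet> (u - x (T (Suc k))) - Cp * (norm (u - x (T (Suc k))))\<^sup>2) \<le> f u) \<and>
       norm (v + egrad h (x (T (Suc k))) - Q (T (Suc k)) *\<^sub>R y (T (Suc k))) \<le> C * b k"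
proof -
  obtain M where M: "M \<ge> 0" "\<And>w. w \<in> dual_Y g X gX \<alpha>lo \<Longrightarrow> norm w \<le> M" by (rule dual_Y_bounded) (rule that)
  obtain a where a: "a > 0"
    "\<And>t i. t mod (N + 1) = i \<Longrightarrow> i \<noteq> 0 \<Longrightarrow>
       \<exists>\<alpha> u. a \<le> \<alpha> \<and> u \<in> block_prox f fs g h blk i \<alpha> (x t) (y t) \<and> x (Suc t) = block_replace blk i u (x t)"
    by (rule block_update_stepsize) (rule that)
  obtain Cq Kq where Cq: "Cq \<ge> 0" "\<And>k s. k \<ge> Kq \<Longrightarrow> T k < s \<Longrightarrow> s \<le> T (Suc k) \<Longrightarrow> Q s - Q (T (Suc k)) \<le> Cq * b k"
    by (rule Q_variation_cycle) (rule that)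
  obtain r L where r: "r > 0" "L \<ge> 0"
    "\<And>z u. z \<in> X \<Longrightarrow> norm (u - z) < r \<Longrightarrow> norm (egrad h u - egrad h z) \<le> L * norm (u - z)"
    by (rule h_uniform_smooth) (rule that)
  obtain K where K: "\<And>k. k \<ge> K \<Longrightarrow> K1 * b k < r" using eventually_b_less[OF r(1)] by auto
  \<comment> \<open>Drift of \<open>x\<close> over the least step size, drift of the gradient, and
    drift of \<open>Q\<close> times the bound for \<open>y\<close>.\<close>
  define C where "C = K1 / a + L * K1 + Cq * M"
  have C: "C \<ge> 0" using K1_nonneg a r Cq M by (simp add: C_def)
  show thesis
  proof (rule that)
    show "real N * C \<ge> 0" "real N / (2 * a) \<ge> 0" using C a by auto
    fix k assume k: "k \<ge> max K Kq"
    define t where "t = T (Suc k)"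
    have "\<exists>\<alpha>. a \<le> \<alpha> \<and> (\<forall>w. w \<in> block_space blk i \<longrightarrow> ereal (fsr i (P i (x t)) + ((1/\<alpha>) *\<^sub>R (P i (x (T k + i)) - P i (x t))
        - P i (egrad h (x (T k + i))) + Q (T k + i) *\<^sub>R P i (y t)) \<bullet> (w - P i (x t)) - 1/(2*\<alpha>) * (norm (w - P i (x t)))\<^sup>2) \<le> fs i w)"
      if i: "i \<in> {1..N}" for i
    proof -
      define s where "s = T k + i"
      have s: "T k < s" "s < T (Suc k)" "s - T k = i" using i by (auto simp: s_def T_Suc)
      have sm: "s mod (N + 1) = i" "i \<noteq> 0" using cycle_mod(1)[OF s(1,2)] s(3) i by auto
      obtain \<alpha> u where \<alpha>: "a \<le> \<alpha>" and u: "u \<in> block_prox f fs g h blk i \<alpha> (x s) (y s)"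
        and xs: "x (Suc s) = block_replace blk i u (x s)"
        using a(2)[OF sm] by blast
      have ys: "y s = y t" unfolding t_def by (rule y_cycle) (use s in auto)
      have \<alpha>0: "\<alpha> > 0" using \<alpha> a by simp
      note bp = block_proxD[OF u i \<alpha>0 X_dom(1)[OF x_in_X] y_in_D E_pos[unfolded E_def]]
      have ut: "u = P i (x t)"
      proof -
        have "u = P i (x (Suc s))" unfolding xs by (rule block_proj_replace(1)[OF bp(1), symmetric])
        also have "\<dots> = P i (x t)" unfolding t_def by (rule block_cycle[OF i]) (use s in \<open>auto simp: s_def\<close>)
        finally show ?thesis .
      qed
      have "Z (x s) / eta_real g (x s) (y s) = Q s" by (simp add: Q_def E_def)
      with bp(7) \<alpha> show ?thesis unfolding s_def[symmetric] ut ys by auto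
    qed
    then have "\<forall>i\<in>{1..N}. \<exists>\<alpha>. a \<le> \<alpha> \<and> (\<forall>w. w \<in> block_space blk i \<longrightarrow> ereal (fsr i (P i (x t)) + ((1/\<alpha>) *\<^sub>R (P i (x (T k + i)) - P i (x t))
        - P i (egrad h (x (T k + i))) + Q (T k + i) *\<^sub>R P i (y t)) \<bullet> (w - P i (x t)) - 1/(2*\<alpha>) * (norm (w - P i (x t)))\<^sup>2) \<le> fs i w)"
      by blast
    then obtain \<alpha> where \<alpha>: "\<forall>i\<in>{1..N}. a \<le> \<alpha> i \<and> (\<forall>w. w \<in> block_space blk i \<longrightarrow> ereal (fsr i (P i (x t)) + ((1/\<alpha> i) *\<^sub>R (P i (x (T k + i)) - P i (x t))
        - P i (egrad h (x (T k + i))) + Q (T k + i) *\<^sub>R P i (y t)) \<bullet> (w - P i (x t)) - 1/(2*\<alpha> i) * (norm (w - P i (x t)))\<^sup>2) \<le> fs i w)"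
      unfolding bchoice_iff by blast
    define v where "v i = (1/\<alpha> i) *\<^sub>R (P i (x (T k + i)) - P i (x t)) - P i (egrad h (x (T k + i))) + Q (T k + i) *\<^sub>R P i (y t)" for i
    have v_eq: "v i = P i ((1/\<alpha> i) *\<^sub>R (x (T k + i) - x t) - egrad h (x (T k + i)) + Q (T k + i) *\<^sub>R y t)" for i
      by (simp add: v_def block_proj_linear)
    have \<alpha>a: "a \<le> \<alpha> i" if "i \<in> {1..N}" for i using \<alpha> that by blast
    have vi: "ereal (fsr i (P i (x t)) + v i \<bullet> (P i u - P i (x t)) - 1/(2*\<alpha> i) * (norm (P i u - P i (x t)))\<^sup>2) \<le> fs i (P i u)"
      if "i \<in> {1..N}" for i u
      using \<alpha> that block_proj_in_space unfolding v_def by blast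
    have prox: "ereal (fr (x t) + (\<Sum>i=1..N. v i) \<bullet> (u - x t) - real N / (2 * a) * (norm (u - x t))\<^sup>2) \<le> f u" for u
    proof -
      have summand: "fsr i (P i (x t)) + v i \<bullet> (u - x t) - 1 / (2 * a) * (norm (u - x t))\<^sup>2
          \<le> fsr i (P i (x t)) + v i \<bullet> (P i u - P i (x t)) - 1/(2*\<alpha> i) * (norm (P i u - P i (x t)))\<^sup>2" if i: "i \<in> {1..N}" for i
      proof -
        have "v i \<bullet> (P i u - P i (x t)) = v i \<bullet> (u - x t)"
          unfolding v_eq block_proj_linear(2)[symmetric]
          by (subst inner_commute, subst block_proj_inner[OF block_proj_in_space]) (rule inner_commute)
        moreover have "1/(2*\<alpha> i) * (norm (P i u - P i (x t)))\<^sup>2 \<le> 1 / (2 * a) * (norm (u - x t))\<^sup>2"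
          unfolding block_proj_linear(2)[symmetric]
          using \<alpha>a[OF i] a by (intro mult_mono power_mono norm_block_proj_le) (auto simp: frac_le)
        ultimately show ?thesis by linarith
      qed
      have "(\<Sum>i=1..N. fsr i (P i (x t)) + v i \<bullet> (u - x t) - 1 / (2 * a) * (norm (u - x t))\<^sup>2)
         = fr (x t) + (\<Sum>i=1..N. v i) \<bullet> (u - x t) - real N / (2 * a) * (norm (u - x t))\<^sup>2"
        by (simp add: sum.distrib sum_subtractf inner_sum_left fr_sum[OF X_dom(1)[OF x_in_X]])
      then have "ereal (fr (x t) + (\<Sum>i=1..N. v i) \<bullet> (u - x t) - real N / (2 * a) * (norm (u - x t))\<^sup>2)
         = (\<Sum>i=1..N. ereal (fsr i (P i (x t)) + v i \<bullet> (u - x t) - 1 / (2 * a) * (norm (u - x t))\<^sup>2))"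
        by simp
      also have "\<dots> \<le> (\<Sum>i=1..N. fs i (P i u))"
        by (intro sum_mono order_trans[OF _ vi]) (use summand in auto)
      finally show ?thesis by (simp add: f_separable[of u])
    qed
    have "norm ((\<Sum>i=1..N. v i) + egrad h (x t) - Q t *\<^sub>R y t) \<le> real N * C * b k"
    proof -
      have "(\<Sum>i=1..N. v i) + egrad h (x t) - Q t *\<^sub>R y t = (\<Sum>i=1..N. v i + P i (egrad h (x t)) - P i (Q t *\<^sub>R y t))"
        by (simp only: sum.distrib sum_subtractf sum_block_proj[OF blocks])
      also have "norm \<dots> \<le> (\<Sum>i=1..N. C * b k)"
      proof (rule sum_norm_le)
        fix i assume i: "i \<in> {1..N}"
        define s where "s = T k + i"
        have s: "T k < s" "s \<le> T (Suc k)" using i by (auto simp: s_def T_Suc)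
        have xst: "norm (x s - x t) \<le> K1 * b k"
          using x_dist_cycle[of k s t] s by (simp add: t_def norm_minus_commute)
        have eq: "v i + P i (egrad h (x t)) - P i (Q t *\<^sub>R y t) =
           P i ((1/\<alpha> i) *\<^sub>R (x s - x t) - (egrad h (x s) - egrad h (x t)) + (Q s - Q t) *\<^sub>R y t)"
          by (simp add: v_eq s_def block_proj_linear algebra_simps)
        have tri: "norm (p - q + r) \<le> norm p + norm q + norm r" for p q r :: "real ^ 'n"
          using norm_triangle_ineq[of "p - q" r] norm_triangle_ineq4[of p q] by linarith
        have "norm (v i + P i (egrad h (x t)) - P i (Q t *\<^sub>R y t)) \<le> norm ((1/\<alpha> i) *\<^sub>R (x s - x t) - (egrad h (x s) - egrad h (x t)) + (Q s - Q t) *\<^sub>R y t)"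
          unfolding eq by (rule norm_block_proj_le)
        also have "\<dots> \<le> norm ((1/\<alpha> i) *\<^sub>R (x s - x t)) + norm (egrad h (x s) - egrad h (x t)) + norm ((Q s - Q t) *\<^sub>R y t)"
          by (rule tri)
        also have "\<dots> \<le> (K1 / a) * b k + L * K1 * b k + Cq * M * b k"
        proof (intro add_mono)
          have "norm ((1/\<alpha> i) *\<^sub>R (x s - x t)) = (1/\<alpha> i) * norm (x s - x t)"
            using \<alpha>a[OF i] a by simp
          also have "\<dots> \<le> (1/a) * (K1 * b k)"
            using \<alpha>a[OF i] a xst by (intro mult_mono) (auto simp: frac_le)
          finally show "norm ((1/\<alpha> i) *\<^sub>R (x s - x t)) \<le> (K1 / a) * b k" by simp
          have "norm (egrad h (x s) - egrad h (x t)) \<le> L * norm (x s - x t)"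
            using K[of k] k xst by (intro r(3)[OF x_in_X]) simp
          also have "\<dots> \<le> L * (K1 * b k)" using xst r by (intro mult_left_mono)
          finally show "norm (egrad h (x s) - egrad h (x t)) \<le> L * K1 * b k" by simp
          have "norm ((Q s - Q t) *\<^sub>R y t) = (Q s - Q t) * norm (y t)"
            using Q_antimono[OF s(2)] by (simp add: t_def)
          also have "\<dots> \<le> (Cq * b k) * M"
            using Cq(2)[OF _ s] k M(2)[OF y_in_dual_Y[of t]] Cq(1) b_nonneg
            by (intro mult_mono) (auto simp: t_def)
          finally show "norm ((Q s - Q t) *\<^sub>R y t) \<le> Cq * M * b k" by (simp add: mult_ac)
        qed
        also have "\<dots> = C * b k" by (simp add: C_def algebra_simps)
        finally show "norm (v i + P i (egrad h (x t)) - P i (Q t *\<^sub>R y t)) \<le> C * b k" .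
      qed
      finally show ?thesis by simp
    qed
    with prox show "\<exists>v. (\<forall>u. ereal (fr (x (T (Suc k))) + v \<bullet> (u - x (T (Suc k))) - real N / (2 * a) * (norm (u - x (T (Suc k))))\<^sup>2) \<le> f u) \<and>
       norm (v + egrad h (x (T (Suc k))) - Q (T (Suc k)) *\<^sub>R y (T (Suc k))) \<le> real N * C * b k"
      unfolding t_def by blast
  qed
qed

text \<open>The estimate is weighted by \<open>Q\<close>, which keeps it valid when \<open>Q\<close> tends to zero and the
  steps in \<open>y\<close> need not vanish.\<close>

lemma dual_residual:
  obtains C where "C \<ge> 0"
    "\<And>k. \<exists>\<xi>. y (T (Suc k)) \<in> subgradients g \<xi> \<and> Q (T (Suc k)) * norm (\<xi> - x (T (Suc k))) \<le> C * b k"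
proof -
  define C where "C = F0 * K1 + sqrt (F0 * (\<alpha>up * gX)) / \<alpha>lo"
  show thesis
  proof (rule that)
    show "C \<ge> 0" using F0_nonneg K1_nonneg params gX by (simp add: C_def)
    fix k
    define s where "s = T k"
    define t where "t = T (Suc k)"
    obtain \<alpha> where \<alpha>: "\<alpha>lo \<le> \<alpha>" and y': "y (Suc s) \<in> subgradients g (x s - (1/\<alpha>) *\<^sub>R (y (Suc s) - y s))"
      using dual_update(2)[OF admissible, of s] T_mod by (auto simp: s_def)
    define \<xi> where "\<xi> = x s - (1/\<alpha>) *\<^sub>R (y (Suc s) - y s)"
    define \<delta> where "\<delta> = norm (y (Suc s) - y s)"
    have \<alpha>0: "\<alpha> > 0" using \<alpha> params by simp
    have ys: "y (Suc s) = y t" unfolding s_def t_def by (rule y_cycle) (simp_all add: T_Suc)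
    have "\<xi> - x t = (x s - x t) - (1/\<alpha>) *\<^sub>R (y (Suc s) - y s)" by (simp add: \<xi>_def)
    then have "norm (\<xi> - x t) \<le> norm (x s - x t) + norm ((1/\<alpha>) *\<^sub>R (y (Suc s) - y s))"
      by (simp only: norm_triangle_ineq4)
    also have "\<dots> = norm (x s - x t) + (1/\<alpha>) * \<delta>" using \<alpha>0 by (simp add: \<delta>_def)
    also have "\<dots> \<le> K1 * b k + (1/\<alpha>lo) * \<delta>"
      using x_dist_cycle[of k s t] \<alpha> params
      by (intro add_mono mult_right_mono) (auto simp: s_def t_def norm_minus_commute T_Suc frac_le \<delta>_def)
    finally have n: "norm (\<xi> - x t) \<le> K1 * b k + (1/\<alpha>lo) * \<delta>" .
    have Qd: "Q t * \<delta> \<le> sqrt (F0 * (\<alpha>up * gX)) * b k"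
    proof -
      have Qst: "Q t \<le> Q (Suc s)" by (rule Q_antimono) (simp add: s_def t_def T_Suc)
      \<comment> \<open>One factor \<open>Q t\<close> is absorbed by \<open>F0\<close>, the other is
        the weight in the decrease of the dual step; nothing is divided by \<open>Q\<close>.\<close>
      have "(Q t * \<delta>)\<^sup>2 = Q t * (Q t * \<delta>\<^sup>2)" by (simp add: power2_eq_square)
      also have "\<dots> \<le> F0 * (Q (Suc s) * \<delta>\<^sup>2)"
        using Qst Q_le_F0 Q_nonneg F0_nonneg by (intro mult_mono mult_right_mono) auto
      also have "\<dots> \<le> F0 * (\<alpha>up * gX * (Q s - Q (Suc s)))"
        using dual_update_admissible(3)[OF admissible, of s] T_mod F0_nonneg
        by (intro mult_left_mono) (auto simp: s_def \<delta>_def)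
      also have "\<dots> \<le> F0 * (\<alpha>up * gX * (b k)\<^sup>2)"
        using Q_decrease_le_b[of k s] F0_nonneg params gX
        by (intro mult_left_mono) (auto simp: s_def T_Suc)
      finally have "Q t * \<delta> \<le> sqrt (F0 * (\<alpha>up * gX * (b k)\<^sup>2))" by (rule real_le_rsqrt)
      also have "\<dots> = sqrt (F0 * (\<alpha>up * gX)) * b k"
        by (simp only: real_sqrt_mult real_sqrt_abs abs_of_nonneg[OF b_nonneg])
      finally show ?thesis .
    qed
    have "Q t * norm (\<xi> - x t) \<le> Q t * (K1 * b k + (1/\<alpha>lo) * \<delta>)" using n Q_nonneg by (intro mult_left_mono)
    also have "\<dots> = Q t * (K1 * b k) + (1/\<alpha>lo) * (Q t * \<delta>)" by (simp add: algebra_simps)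
    also have "\<dots> \<le> F0 * (K1 * b k) + (1/\<alpha>lo) * (sqrt (F0 * (\<alpha>up * gX)) * b k)"
      using Qd Q_le_F0 K1_nonneg b_nonneg params by (intro add_mono mult_right_mono mult_left_mono) auto
    also have "\<dots> = C * b k" by (simp add: C_def algebra_simps)
    finally have "Q t * norm (\<xi> - x t) \<le> C * b k" .
    moreover have "y t \<in> subgradients g \<xi>" using y' by (simp add: \<xi>_def ys)
    ultimately show "\<exists>\<xi>. y (T (Suc k)) \<in> subgradients g \<xi> \<and> Q (T (Suc k)) * norm (\<xi> - x (T (Suc k))) \<le> C * b k"
      unfolding t_def by blast
  qed
qed

lemma merit_Q_iterate: "merit_Q f g h (x t, y t) = ereal (Q t)"
  using merit_real[OF X_dom(1)[OF x_in_X] y_in_D E_pos[unfolded E_def]] by (simp add: Q_def E_def)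

text \<open>The quotient rule divides both residuals by \<open>E\<close>, which stays above
  \<open>e\<close>. The dual component of the subgradient carries the factor \<open>Q\<close>, so
  the weighted dual residual is exactly what it asks for.\<close>

lemma residual:
  obtains C K where "C \<ge> 0"
    "\<And>k. k \<ge> K \<Longrightarrow> \<exists>w\<in>frechet_subdiff (merit_Q f g h) (x (T (Suc k)), y (T (Suc k))). norm w \<le> C * b k"
proof -
  obtain e Ke where e: "e > 0" "\<And>k. k \<ge> Ke \<Longrightarrow> e \<le> E (T (Suc k))" by (rule E_cycle_lower_bound) (rule that)
  obtain C Cp Kp where C: "C \<ge> 0" "Cp \<ge> 0"
    "\<And>k. k \<ge> Kp \<Longrightarrow> \<exists>v. (\<forall>u. ereal (fr (x (T (Suc k))) + v \<bullet> (u - x (T (Suc k))) - Cp * (norm (u - x (T (Suc k))))\<^sup>2) \<le> f u) \<and>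
       norm (v + egrad h (x (T (Suc k))) - Q (T (Suc k)) *\<^sub>R y (T (Suc k))) \<le> C * b k"
    by (rule primal_residual) (rule that)
  obtain C' where C': "C' \<ge> 0"
    "\<And>k. \<exists>\<xi>. y (T (Suc k)) \<in> subgradients g \<xi> \<and> Q (T (Suc k)) * norm (\<xi> - x (T (Suc k))) \<le> C' * b k"
    by (rule dual_residual) (rule that)
  show thesis
  proof (rule that)
    show "(C + C') / e \<ge> 0" using C C' e by simp
    fix k assume k: "k \<ge> max Ke Kp"
    define t where "t = T (Suc k)"
    obtain v where v: "\<And>u. ereal (fr (x t) + v \<bullet> (u - x t) - Cp * (norm (u - x t))\<^sup>2) \<le> f u"
      "norm (v + egrad h (x t) - Q t *\<^sub>R y t) \<le> C * b k"
      using C(3)[of k] k unfolding t_def by auto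
    obtain \<xi> where \<xi>: "y t \<in> subgradients g \<xi>" "Q t * norm (\<xi> - x t) \<le> C' * b k"
      using C'(2)[of k] unfolding t_def by auto
    let ?w = "((1 / E t) *\<^sub>R (v + egrad h (x t) - Q t *\<^sub>R y t), (Q t / E t) *\<^sub>R (\<xi> - x t))"
    have "Q t = (fr (x t) + real_of_ereal (h (x t))) / eta_real g (x t) (y t)"
      by (simp add: Q_def Z_def E_def hr_def)
    then have w: "?w \<in> frechet_subdiff (merit_Q f g h) (x t, y t)"
      unfolding E_def
      by (intro merit_Q_frechet[where fx = "fr (x t)" and C = Cp] f_not_MInf h_not_MInf g_conj_calm
            f_real X_dom(1) h_ediff X_dom(2) x_in_X \<xi>(1) E_pos[unfolded E_def] Q_nonneg C(2) v(1))
    have Ee: "E t \<ge> e" using e(2)[of k] k by (simp add: t_def)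
    have "norm ?w \<le> norm ((1 / E t) *\<^sub>R (v + egrad h (x t) - Q t *\<^sub>R y t)) + norm ((Q t / E t) *\<^sub>R (\<xi> - x t))"
      by (rule norm_Pair_le)
    also have "\<dots> = (1 / E t) * (norm (v + egrad h (x t) - Q t *\<^sub>R y t) + Q t * norm (\<xi> - x t))"
      using E_pos[of t] Q_nonneg[of t] by (simp add: distrib_left)
    also have "\<dots> \<le> (1 / e) * (C * b k + C' * b k)"
      by (intro mult_mono add_mono v(2) \<xi>(2) add_nonneg_nonneg mult_nonneg_nonneg Q_nonneg norm_ge_zero)
        (use Ee e in \<open>auto simp: frac_le\<close>)
    also have "\<dots> = (C + C') / e * b k" by (simp add: field_simps)
    finally show "\<exists>w\<in>frechet_subdiff (merit_Q f g h) (x (T (Suc k)), y (T (Suc k))). norm w \<le> (C + C') / e * b k"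
      using w unfolding t_def by blast
  qed
qed

section \<open>Cluster points of the pairs at the ends of cycles\<close>

abbreviation "p k \<equiv> (x (T (Suc k)), y (T (Suc k)))"

lemma Z_continuous: "continuous_on X Z"
proof -
  have "continuous_on X hr"
  proof (rule continuous_at_imp_continuous_on, rule ballI)
    fix z assume "z \<in> X"
    then show "isCont hr z"
      using ediff_at_GDERIV[OF h_ediff[OF X_dom(2)]] unfolding gderiv_def hr_def[abs_def]
      by (blast intro: has_derivative_continuous)
  qed
  then show ?thesis unfolding Z_def[abs_def] by (intro continuous_on_add fr_continuous)
qed

lemma iterates_bounded: "bounded (range p)"
proof -
  obtain M where M: "M \<ge> 0" "\<And>w. w \<in> dual_Y g X gX \<alpha>lo \<Longrightarrow> norm w \<le> M" by (rule dual_Y_bounded) (rule that)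
  have "range p \<subseteq> X \<times> cball 0 M" using x_in_X M(2)[OF y_in_dual_Y] by auto
  then show ?thesis
    using bounded_Times[OF compact_imp_bounded[OF X_compact] bounded_cball] by (rule bounded_subset[rotated])
qed

context
  fixes kk :: "nat \<Rightarrow> nat" and xs ys
  assumes kk: "filterlim kk at_top sequentially" and lim: "(\<lambda>n. p (kk n)) \<longlonglongrightarrow> (xs, ys)"
begin

lemma x_lim: "(\<lambda>n. x (T (Suc (kk n)))) \<longlonglongrightarrow> xs" and y_lim: "(\<lambda>n. y (T (Suc (kk n)))) \<longlonglongrightarrow> ys"
  using tendsto_fst[OF lim] tendsto_snd[OF lim] by simp_all

lemma Q_lim: "(\<lambda>n. Q (T (Suc (kk n)))) \<longlonglongrightarrow> Qs"
  using filterlim_compose[OF LIMSEQ_Suc[OF Q_T_tendsto] kk] .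

lemma b_lim: "(\<lambda>n. C * b (kk n)) \<longlonglongrightarrow> 0"
  using tendsto_mult_left[OF filterlim_compose[OF b_tendsto kk], of C] by simp

lemma cluster_x: "xs \<in> X"
  by (rule closed_sequentially[OF compact_imp_closed[OF X_compact] x_in_X x_lim])

lemma cluster_y: "ys \<in> dual_Y g X gX \<alpha>lo"
  by (rule dual_Y_closed[OF y_lim y_in_dual_Y])

lemma cluster_y_dom: "ys \<in> D"
  using cluster_y conj_fun_subgradient(1) unfolding dual_Y_def subdiff_real_convex[OF g_convex] by blast

text \<open>Calmness makes the conjugate continuous on its domain, so \<open>E\<close> converges
  along the subsequence, and its uniform lower bound keeps the limit positive. The second claim is
  the limit of \<open>Q t * E t = Z (x t)\<close>.\<close>

lemma cluster_eta: "eta_real g xs ys > 0" "Z xs = Qs * eta_real g xs ys"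
proof -
  have "(\<lambda>n. conj_real g (y (T (Suc (kk n))))) \<longlonglongrightarrow> conj_real g ys"
    by (rule continuous_on_tendsto_compose[OF calm_continuous_on_conj_real[OF g_conj_calm] y_lim cluster_y_dom])
      (simp add: y_in_D)
  then have E: "(\<lambda>n. E (T (Suc (kk n)))) \<longlonglongrightarrow> eta_real g xs ys"
    unfolding E_def eta_real_def by (intro tendsto_intros x_lim y_lim)
  obtain e K where e: "e > 0" "\<And>k. k \<ge> K \<Longrightarrow> e \<le> E (T (Suc k))" by (rule E_cycle_lower_bound) (rule that)
  have "\<forall>\<^sub>F n in sequentially. e \<le> E (T (Suc (kk n)))"
    using filterlim_at_top[THEN iffD1, OF kk, rule_format, of K] by eventually_elim (rule e(2))
  from tendsto_lowerbound[OF E this] e show "eta_real g xs ys > 0" by simp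
  have "(\<lambda>n. Z (x (T (Suc (kk n))))) \<longlonglongrightarrow> Z xs"
    by (rule continuous_on_tendsto_compose[OF Z_continuous x_lim cluster_x]) (simp add: x_in_X)
  moreover have "(\<lambda>n. Z (x (T (Suc (kk n))))) \<longlonglongrightarrow> Qs * eta_real g xs ys"
    using tendsto_mult[OF Q_lim E] by (simp add: Q_times_E[OF E_pos])
  ultimately show "Z xs = Qs * eta_real g xs ys" by (rule LIMSEQ_unique)
qed

lemma cluster_merit: "merit_Q f g h (xs, ys) = ereal Qs"
  using merit_real[OF X_dom(1)[OF cluster_x] cluster_y_dom cluster_eta(1)] cluster_eta by simp

text \<open>The KL hypothesis is available only where a limiting subgradient exists. Here 0 is one:
  the residual subgradients tend to 0 while the merit values tend to the value at the cluster
  point.\<close>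

lemma cluster_dom_subdiff: "(xs, ys) \<in> dom_subdiff (merit_Q f g h)"
proof -
  obtain C K where C: "C \<ge> 0"
    "\<And>k. k \<ge> K \<Longrightarrow> \<exists>w\<in>frechet_subdiff (merit_Q f g h) (p k). norm w \<le> C * b k"
    by (rule residual) (rule that)
  then obtain w where w: "\<And>k. k \<ge> K \<Longrightarrow> w k \<in> frechet_subdiff (merit_Q f g h) (p k)"
    "\<And>k. k \<ge> K \<Longrightarrow> norm (w k) \<le> C * b k" by metis
  obtain n0 where n0: "\<And>n. n \<ge> n0 \<Longrightarrow> kk n \<ge> K"
    using filterlim_at_top[THEN iffD1, OF kk, rule_format, of K] by (auto simp: eventually_sequentially)
  have "0 \<in> limiting_subdiff (merit_Q f g h) (xs, ys)"
    unfolding limiting_subdiff_def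
  proof (intro CollectI conjI exI allI)
    show "(xs, ys) \<in> edom (merit_Q f g h)" by (simp add: edom_def cluster_merit)
    \<comment> \<open>The shift by \<open>n0\<close> discards the early cycles, for which no
      residual subgradient is available.\<close>
    show "(\<lambda>n. p (kk (n + n0))) \<longlonglongrightarrow> (xs, ys)" by (rule LIMSEQ_ignore_initial_segment[OF lim])
    show "(\<lambda>n. merit_Q f g h (p (kk (n + n0)))) \<longlonglongrightarrow> merit_Q f g h (xs, ys)"
      unfolding merit_Q_iterate cluster_merit
      by (intro tendsto_ereal LIMSEQ_ignore_initial_segment[OF Q_lim])
    show "w (kk (n + n0)) \<in> frechet_subdiff (merit_Q f g h) (p (kk (n + n0)))" for n
      by (intro w n0) simp
    show "(\<lambda>n. w (kk (n + n0))) \<longlonglongrightarrow> 0"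
      by (rule Lim_null_comparison[OF _ LIMSEQ_ignore_initial_segment[OF b_lim[of C]]])
        (auto intro!: always_eventually w n0)
  qed
  then show ?thesis by (auto simp: dom_subdiff_def edom_def cluster_merit)
qed

lemma cluster_KL: "KL_at (merit_Q f g h) (xs, ys)"
proof (rule KL)
  show "(xs, ys) \<in> set_S g X gX \<alpha>lo"
    using cluster_x cluster_y cluster_eta(1) eta_eq_real[OF cluster_y_dom, of xs] by (simp add: set_S_def)
qed (rule cluster_dom_subdiff)

lemma cluster_critical: "critical_point f g h xs"
proof -
  obtain C Cp K where C: "C \<ge> 0" "Cp \<ge> 0"
    "\<And>k. k \<ge> K \<Longrightarrow> \<exists>v. (\<forall>u. ereal (fr (x (T (Suc k))) + v \<bullet> (u - x (T (Suc k))) - Cp * (norm (u - x (T (Suc k))))\<^sup>2) \<le> f u) \<and>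
       norm (v + egrad h (x (T (Suc k))) - Q (T (Suc k)) *\<^sub>R y (T (Suc k))) \<le> C * b k"
    by (rule primal_residual) (rule that)
  then obtain v where v:
    "\<And>k u. k \<ge> K \<Longrightarrow> ereal (fr (x (T (Suc k))) + v k \<bullet> (u - x (T (Suc k))) - Cp * (norm (u - x (T (Suc k))))\<^sup>2) \<le> f u"
    "\<And>k. k \<ge> K \<Longrightarrow> norm (v k + egrad h (x (T (Suc k))) - Q (T (Suc k)) *\<^sub>R y (T (Suc k))) \<le> C * b k"
    by metis
  \<comment> \<open>The limit of \<open>v\<close> that the vanishing primal residual forces.\<close>
  define vs where "vs = Qs *\<^sub>R ys - egrad h xs"
  have ev: "\<forall>\<^sub>F n in sequentially. kk n \<ge> K"
    using filterlim_at_top[THEN iffD1, OF kk, rule_format, of K] .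
  have gl: "(\<lambda>n. egrad h (x (T (Suc (kk n))))) \<longlonglongrightarrow> egrad h xs"
    by (rule continuous_on_tendsto_compose[OF egrad_continuous x_lim cluster_x]) (simp add: x_in_X)
  have "(\<lambda>n. v (kk n) + egrad h (x (T (Suc (kk n)))) - Q (T (Suc (kk n))) *\<^sub>R y (T (Suc (kk n)))) \<longlonglongrightarrow> 0"
    by (rule Lim_null_comparison[OF _ b_lim[of C]]) (use ev in eventually_elim, rule v)
  from tendsto_add[OF this tendsto_diff[OF tendsto_scaleR[OF Q_lim y_lim] gl]]
  have vl: "(\<lambda>n. v (kk n)) \<longlonglongrightarrow> vs" by (simp add: vs_def)
  have fl: "(\<lambda>n. fr (x (T (Suc (kk n))))) \<longlonglongrightarrow> fr xs"
    by (rule continuous_on_tendsto_compose[OF fr_continuous x_lim cluster_x]) (simp add: x_in_X)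
  have vs: "vs \<in> frechet_subdiff f xs"
  proof (rule frechet_subdiff_proximal[where \<phi> = f and x = xs, OF f_real[OF X_dom(1)[OF cluster_x]] C(2)])
    fix u
    have "(\<lambda>n. ereal (fr (x (T (Suc (kk n)))) + v (kk n) \<bullet> (u - x (T (Suc (kk n)))) - Cp * (norm (u - x (T (Suc (kk n)))))\<^sup>2))
      \<longlonglongrightarrow> ereal (fr xs + vs \<bullet> (u - xs) - Cp * (norm (u - xs))\<^sup>2)"
      by (intro tendsto_intros tendsto_ereal vl fl x_lim)
    then show "ereal (fr xs + vs \<bullet> (u - xs) - Cp * (norm (u - xs))\<^sup>2) \<le> f u"
      by (rule tendsto_upperbound) (use ev in eventually_elim, rule v, simp_all)
  qed
  have Fx: "obj_F f g h xs = ereal (Z xs / g xs)" by (rule obj_F_real[OF X_dom[OF cluster_x]])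
  \<comment> \<open>If \<open>Qs = 0\<close>, the numerator \<open>Z xs\<close> vanishes and both
    sides are zero for any subgradient \<open>w\<close>; nothing relates \<open>ys\<close> to
    \<open>xs\<close> in that case. If \<open>Qs > 0\<close>, the weight is divided out of the dual
    residual, the base points converge to \<open>xs\<close>, and \<open>w = ys\<close>
    works.\<close>
  have "\<exists>w. w \<in> subgradients g xs \<and> (Z xs / g xs) *\<^sub>R w = Qs *\<^sub>R ys"
  proof (cases "Qs = 0")
    case True
    then show ?thesis using cluster_eta(2) subgradients_nonempty[OF g_convex, of xs] by auto
  next
    case False
    then have Q0: "Qs > 0" using Qs(3) by simp
    obtain C' where C': "C' \<ge> 0"
      "\<And>k. \<exists>\<xi>. y (T (Suc k)) \<in> subgradients g \<xi> \<and> Q (T (Suc k)) * norm (\<xi> - x (T (Suc k))) \<le> C' * b k"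
      by (rule dual_residual) (rule that)
    then obtain \<xi> where \<xi>: "\<And>k. y (T (Suc k)) \<in> subgradients g (\<xi> k)"
      "\<And>k. Q (T (Suc k)) * norm (\<xi> k - x (T (Suc k))) \<le> C' * b k" by metis
    have "norm (\<xi> k - x (T (Suc k))) \<le> (C' / Qs) * b k" for k
    proof -
      have "Qs * norm (\<xi> k - x (T (Suc k))) \<le> C' * b k"
        using mult_right_mono[OF Qs(2)[of "T (Suc k)"] norm_ge_zero[of "\<xi> k - x (T (Suc k))"]] \<xi>(2)[of k] by linarith
      then show ?thesis using Q0 by (simp add: field_simps)
    qed
    then have "(\<lambda>n. \<xi> (kk n) - x (T (Suc (kk n)))) \<longlonglongrightarrow> 0"
      by (intro Lim_null_comparison[OF _ b_lim[of "C' / Qs"]] always_eventually) auto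
    from tendsto_add[OF this x_lim] have "(\<lambda>n. \<xi> (kk n)) \<longlonglongrightarrow> xs" by simp
    then have ysub: "ys \<in> subgradients g xs"
      by (rule subgradients_limit[OF g_continuous _ y_lim]) (rule \<xi>(1))
    then have "eta_real g xs ys = g xs" using conj_fun_subgradient(2)[OF ysub] by (simp add: eta_real_def)
    then have "Z xs / g xs = Qs" using cluster_eta by simp
    with ysub show ?thesis by (intro exI[of _ ys]) simp
  qed
  then obtain w where w: "w \<in> subgradients g xs" "(Z xs / g xs) *\<^sub>R w = Qs *\<^sub>R ys"
    by (elim exE conjE)
  have "0 = vs + egrad h xs - real_of_ereal (obj_F f g h xs) *\<^sub>R w"
    using w(2) by (simp add: Fx vs_def)
  then show ?thesis
    unfolding critical_point_def subdiff_real_convex[OF g_convex]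
    using vs w(1) X_dom[OF cluster_x] by (auto simp: edom_obj_F)
qed

end

section \<open>Finite length and convergence\<close>

lemma summable_b: "summable b"
proof -
  obtain C K where C: "C \<ge> 0"
    "\<And>k. k \<ge> K \<Longrightarrow> \<exists>w\<in>frechet_subdiff (merit_Q f g h) (p k). norm w \<le> C * b k"
    by (rule residual) (rule that)
  then obtain w where w: "\<And>k. k \<ge> K \<Longrightarrow> w k \<in> frechet_subdiff (merit_Q f g h) (p k)"
    "\<And>k. k \<ge> K \<Longrightarrow> norm (w k) \<le> C * b k" by metis
  obtain \<Omega> where \<Omega>: "compact \<Omega>" "\<Omega> \<noteq> {}"
    "\<And>q. q \<in> \<Omega> \<Longrightarrow> \<exists>k. filterlim k at_top sequentially \<and> (\<lambda>n. p (k n)) \<longlonglongrightarrow> q"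
    "\<And>U. open U \<Longrightarrow> \<Omega> \<subseteq> U \<Longrightarrow> \<forall>\<^sub>F n in sequentially. p n \<in> U"
    by (rule cluster_set[OF iterates_bounded]) (rule that)
  have cl: "KL_at (merit_Q f g h) q" "merit_Q f g h q = ereal Qs" if q: "q \<in> \<Omega>" for q
  proof -
    obtain k where "filterlim k at_top sequentially" "(\<lambda>n. p (k n)) \<longlonglongrightarrow> (fst q, snd q)"
      using \<Omega>(3)[OF q] by auto
    from cluster_KL[OF this] cluster_merit[OF this]
    show "KL_at (merit_Q f g h) q" "merit_Q f g h q = ereal Qs" by simp_all
  qed
  obtain \<epsilon> \<psi> \<psi>' U where ds: "desingularizing \<epsilon> \<psi> \<psi>'" and U: "open U" "\<Omega> \<subseteq> U"
    and KLU: "\<And>z w c. z \<in> U \<Longrightarrow> merit_Q f g h z = ereal c \<Longrightarrow> Qs < c \<Longrightarrow> c < Qs + \<epsilon> \<Longrightarrow>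
       w \<in> limiting_subdiff (merit_Q f g h) z \<Longrightarrow> 1 \<le> \<psi>' (c - Qs) * norm w"
    by (rule uniform_KL[OF \<Omega>(1,2) cl]) (assumption | rule that)+
  obtain K' where K': "\<And>n. n \<ge> K' \<Longrightarrow> p n \<in> U"
    using \<Omega>(4)[OF U] by (auto simp: eventually_sequentially)
  define q where "q k = Q (T k) - Qs" for k
  \<comment> \<open>\<open>p (k - 1)\<close> is the pair at step \<open>T k\<close>, where the
    excess is \<open>q k\<close>; hence the shift, and the \<open>Suc\<close> in the starting index
    below.\<close>
  define r where "r k = norm (w (k - 1))" for k
  have qb: "sqrt (q k - q (Suc k)) = b k" for k by (simp add: q_def b_def)
  have "summable (\<lambda>k. sqrt (q k - q (Suc k)))"
  proof (rule summable_sqrt_decrease[where r = r and K = "Suc (max K K')", OF _ _ _ ds C(1)])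
    show "0 \<le> q k" for k using Qs(2) by (simp add: q_def)
    show "q (Suc k) \<le> q k" for k using Q_antimono[of "T k" "T (Suc k)"] by (simp add: q_def T_Suc)
    show "q \<longlonglongrightarrow> 0" using tendsto_diff[OF Q_T_tendsto tendsto_const[of Qs]] by (simp add: q_def[abs_def])
    show "r (Suc k) \<le> C * sqrt (q k - q (Suc k))" if "Suc (max K K') \<le> k" for k
      using w(2)[of k] that by (simp add: r_def qb)
    show "1 \<le> \<psi>' (q k) * r k" if k: "Suc (max K K') \<le> k" and "0 < q k" "q k < \<epsilon>" for k
    proof -
      obtain j where j: "k = Suc j" "j \<ge> K" "j \<ge> K'" using k by (cases k) auto
      show ?thesis
        unfolding q_def r_def j(1) diff_Suc_1
        by (rule KLU[OF K'[OF j(3)] merit_Q_iterate])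
          (use that j w(1)[OF j(2)] in \<open>auto simp: q_def intro: frechet_imp_limiting\<close>)
    qed
  qed
  then show ?thesis by (simp add: qb)
qed

lemma x_convergent: "convergent x"
proof -
  define c where "c = sqrt (2 * gX / \<sigma>)"
  have c: "c \<ge> 0" using gX params by (simp add: c_def)
  have "(\<Sum>t<n. norm (x (Suc t) - x t)) \<le> real (N + 1) * c * (\<Sum>k. b k)" for n
  proof -
    \<comment> \<open>Enlarged to \<open>n\<close> full cycles, so that the steps can be grouped by
      cycle.\<close>
    have "(\<Sum>t<n. norm (x (Suc t) - x t)) \<le> (\<Sum>t<n * (N + 1). norm (x (Suc t) - x t))"
      by (intro sum_mono2) auto
    also have "\<dots> = (\<Sum>k<n. \<Sum>t\<in>{k * (N + 1)..<k * (N + 1) + (N + 1)}. norm (x (Suc t) - x t))"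
      by (rule sum.nat_group[symmetric])
    also have "\<dots> \<le> (\<Sum>k<n. real (N + 1) * c * b k)"
    proof (rule sum_mono)
      fix k
      have "(\<Sum>t\<in>{k * (N + 1)..<k * (N + 1) + (N + 1)}. norm (x (Suc t) - x t))
          \<le> (\<Sum>t\<in>{k * (N + 1)..<k * (N + 1) + (N + 1)}. c * b k)"
        unfolding c_def by (intro sum_mono x_step_cycle) (auto simp: T_def)
      then show "(\<Sum>t\<in>{k * (N + 1)..<k * (N + 1) + (N + 1)}. norm (x (Suc t) - x t)) \<le> real (N + 1) * c * b k"
        by (simp add: algebra_simps)
    qed
    also have "\<dots> = real (N + 1) * c * (\<Sum>k<n. b k)" by (simp only: sum_distrib_left)
    also have "\<dots> \<le> real (N + 1) * c * (\<Sum>k. b k)"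
      using c b_nonneg by (intro mult_left_mono sum_le_suminf summable_b) auto
    finally show ?thesis .
  qed
  then have "summable (\<lambda>t. norm (x (Suc t) - x t))" by (intro summableI_nonneg_bounded) auto
  then have "summable (\<lambda>t. x (Suc t) - x t)" by (rule summable_norm_cancel)
  then have "(\<lambda>n. x 0 + (\<Sum>t<n. x (Suc t) - x t)) \<longlonglongrightarrow> x 0 + (\<Sum>t. x (Suc t) - x t)"
    by (intro tendsto_intros summable_LIMSEQ)
  then have "x \<longlonglongrightarrow> x 0 + (\<Sum>t. x (Suc t) - x t)" by (simp add: sum_lessThan_telescope)
  then show ?thesis by (rule convergentI)
qed

text \<open>Without a limit for \<open>y\<close>, criticality is read off at some cluster point of
  the pairs, whose first component has to be the limit of \<open>x\<close>.\<close>

lemma converges_to_critical_point: "\<exists>xstar. x \<longlonglongrightarrow> xstar \<and> critical_point f g h xstar"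
proof -
  obtain l where l: "x \<longlonglongrightarrow> l" using x_convergent by (auto simp: convergent_def)
  obtain \<Omega> where \<Omega>: "\<Omega> \<noteq> {}"
    "\<And>q. q \<in> \<Omega> \<Longrightarrow> \<exists>k. filterlim k at_top sequentially \<and> (\<lambda>n. p (k n)) \<longlonglongrightarrow> q"
    by (rule cluster_set[OF iterates_bounded]) (rule that)
  from \<Omega>(1) obtain xs ys where "(xs, ys) \<in> \<Omega>" by auto
  from \<Omega>(2)[OF this] obtain k where k: "filterlim k at_top sequentially" "(\<lambda>n. p (k n)) \<longlonglongrightarrow> (xs, ys)"
    by blast
  have "(\<lambda>n. x (T (Suc (k n)))) \<longlonglongrightarrow> l"
    by (rule filterlim_compose[OF l filterlim_compose[OF filterlim_compose[OF filterlim_T filterlim_Suc] k(1)]])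
  then have "xs = l" using x_lim[OF k] by (rule LIMSEQ_unique[rotated])
  with l cluster_critical[OF k] show ?thesis by blast
qed

end

theorem theorem6p5:
  fixes f h :: "real ^ 'n::finite \<Rightarrow> ereal"
    and g :: "real ^ 'n \<Rightarrow> real"
    and fs :: "nat \<Rightarrow> real ^ 'n \<Rightarrow> ereal"
    and N :: nat and blk :: "'n \<Rightarrow> nat"
    and \<alpha>lo \<alpha>up \<sigma> \<gamma> gX :: real
    and x y :: "nat \<Rightarrow> real ^ 'n"
  assumes f_proper_lsc: "proper_on UNIV f" "lsc_on UNIV f"
    and g_proper_lsc: "proper_on UNIV (\<lambda>z. ereal (g z))" "lsc_on UNIV (\<lambda>z. ereal (g z))"
    and h_proper_lsc: "proper_on UNIV h" "lsc_on UNIV h"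
    and Omega_nonempty: "Omega g \<noteq> {}"
    and blocks: "range blk = {1..N}"
    and f_separable: "\<And>z. f z = (\<Sum>i=1..N. fs i (block_proj blk i z))"
    and fs_proper_lsc: "\<And>i. i \<in> {1..N} \<Longrightarrow> proper_on (block_space blk i) (fs i)"
      "\<And>i. i \<in> {1..N} \<Longrightarrow> lsc_on (block_space blk i) (fs i)"
    and f_continuous: "continuous_on (edom f) f"
    and fs_bounded_below:
      "\<And>i. i \<in> {1..N} \<Longrightarrow> \<exists>c::real. \<forall>z\<in>block_space blk i. ereal c \<le> fs i z"
    and h_smooth: "loc_lipschitz_differentiable_on (Omega g) h"
    and g_convex: "convex_on UNIV g"
    and g_nonneg: "\<And>z. g z \<ge> 0"
    and zeta_nonneg: "\<And>z. z \<in> edom f \<Longrightarrow> zeta f h z \<ge> 0"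
    and params: "0 < \<alpha>lo" "\<alpha>lo \<le> \<alpha>up" "0 < \<sigma>" "0 < \<gamma>" "\<gamma> < 1"
    and algorithm: "cmpga_ml f fs g h N blk \<alpha>lo \<alpha>up \<sigma> \<gamma> x y"
    and X_compact: "compact (level_X f g h (x 0))"
    and gX: "gX > 0" "\<And>z. z \<in> level_X f g h (x 0) \<Longrightarrow> g z \<le> gX"
    and f_loc_lipschitz: "locally_lipschitz_on (level_X f g h (x 0)) f"
    and g_conj_calm: "calm_on (edom (conj_fun g)) (conj_fun g)"
    and KL: "\<And>p. p \<in> set_S g (level_X f g h (x 0)) gX \<alpha>lo \<Longrightarrow>
               p \<in> dom_subdiff (merit_Q f g h) \<Longrightarrow> KL_at (merit_Q f g h) p"
  shows "\<exists>xstar. x \<longlonglongrightarrow> xstar \<and> critical_point f g h xstar"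
proof -
  have x0: "x 0 \<in> edom (obj_F f g h)" using algorithm by (simp add: cmpga_ml_def)
  interpret cmpga f h g fs N blk x \<alpha>lo \<alpha>up \<sigma> \<gamma> gX y
    by unfold_locales (fact assms x0)+
  show ?thesis by (rule converges_to_critical_point)
qed

end
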